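(* Let $\mu_1$ and $\mu_2$ be Borel probability measures on the unit circle $\mathbb{T}$, neither of which is a point mass, and set $\mu=\mu_1\boxtimes\mu_2$. For a Borel probability measure $\nu$ on $\mathbb{T}$ and $t\in\mathbb{T}$ with $1/t\notin{\rm supp}(\nu)$, let \[V_\nu(t)=\left|\int_{\mathbb{T}}\frac{d\nu(s)}{(1-ts)^2}-\left[\int_{\mathbb{T}}\frac{d\nu(s)}{1-ts}\right]^2\right|,\] and let $C_\nu=\{t\in\mathbb{T}:1/t\notin{\rm supp}(\nu)\}$. Define \[D_{\mu_1,\mu_2}=\Big\{(t_1,t_2)\in C_{\mu_1}\times C_{\mu_2}:\psi_{\mu_1}(t_1)=\psi_{\mu_2}(t_2),\ \frac{V_{\mu_1}(t_1)V_{\mu_2}(t_2)}{|\psi_{\mu_1}(t_1)(\psi_{\mu_1}(t_1)+1)|^2}<1\Big\}.\] Then $t\mapsto(\omega_1(t),\omega_2(t))$ maps $C_\mu$ homeomorphically onto $D_{\mu_1,\mu_2}$, and the inverse map is \[(t_1,t_2)\mapsto\frac{t_1t_2}{\eta_{\mu_1}(t_1)}=\frac{t_1t_2}{\eta_{\mu_2}(t_2)}.\]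
   Context: $\mathbb{D}$ is the open unit disk and $\mathbb{T}$ the unit circle. For a Borel probability measure $\nu$ on $\mathbb{T}$, $\psi_\nu(z)=\int_{\mathbb{T}}\frac{zs}{1-zs}\,d\nu(s)$ and $\eta_\nu(z)=\psi_\nu(z)/(1+\psi_\nu(z))$ for $z\in\mathbb{D}$; both extend analytically to every $z\in\mathbb{T}$ with $1/z\notin{\rm supp}(\nu)$ (given by the same formulas). The free multiplicative convolution $\mu_1\boxtimes\mu_2$ is the distribution of $x_1x_2$ for $*$-free unitaries $x_1,x_2$ in a tracial $W^*$-probability space with distributions $\mu_1,\mu_2$. The subordination functions $\omega_1,\omega_2:\mathbb{D}\cup\mathbb{T}\to\mathbb{D}\cup\mathbb{T}$ are the unique continuous functions, analytic on $\mathbb{D}$ with $\omega_j(0)=0$, such that $\eta_\mu(z)=\eta_{\mu_1}(\omega_1(z))=\eta_{\mu_2}(\omega_2(z))=\omega_1(z)\omega_2(z)/z$ for $z\in\mathbb{D}$. *)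

theory Defs
  imports "HOL-Probability.Probability"
begin

definition prob_on_T :: "complex measure \<Rightarrow> bool" where
  "prob_on_T \<nu> \<longleftrightarrow> prob_space \<nu> \<and> sets \<nu> = sets borel \<and> emeasure \<nu> (sphere 0 1) = 1"

definition msupp :: "complex measure \<Rightarrow> complex set" where
  "msupp \<nu> = {x. \<forall>e>0. emeasure \<nu> (ball x e) > 0}"

definition is_point_mass :: "complex measure \<Rightarrow> bool" where
  "is_point_mass \<nu> \<longleftrightarrow> (\<exists>a. \<nu> = return borel a)"

definition psiT :: "complex measure \<Rightarrow> complex \<Rightarrow> complex" where
  "psiT \<nu> z = (\<integral>s. z * s / (1 - z * s) \<partial>\<nu>)"

definition etaT :: "complex measure \<Rightarrow> complex \<Rightarrow> complex" where
  "etaT \<nu> z = psiT \<nu> z / (1 + psiT \<nu> z)"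

definition VT :: "complex measure \<Rightarrow> complex \<Rightarrow> real" where
  "VT \<nu> t = cmod ((\<integral>s. 1 / (1 - t * s)^2 \<partial>\<nu>) - (\<integral>s. 1 / (1 - t * s) \<partial>\<nu>)^2)"

definition CT :: "complex measure \<Rightarrow> complex set" where
  "CT \<nu> = {t \<in> sphere 0 1. inverse t \<notin> msupp \<nu>}"

definition DT :: "complex measure \<Rightarrow> complex measure \<Rightarrow> (complex \<times> complex) set" where
  "DT \<mu>1 \<mu>2 = {(t1, t2). t1 \<in> CT \<mu>1 \<and> t2 \<in> CT \<mu>2 \<and> psiT \<mu>1 t1 = psiT \<mu>2 t2 \<and>
      VT \<mu>1 t1 * VT \<mu>2 t2 / (cmod (psiT \<mu>1 t1 * (psiT \<mu>1 t1 + 1)))^2 < 1}"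

text \<open>A word in two unitaries x1 (letter False) and x2 (letter True) is a list of
(letter, integer exponent) pairs.  wnorm multiplies out adjacent powers of the same
letter and removes trivial factors, yielding a reduced (alternating, nonzero-exponent) word.\<close>

fun wnorm :: "(bool \<times> int) list \<Rightarrow> (bool \<times> int) list" where
  "wnorm [] = []"
| "wnorm ((a, k) # w) =
     (case wnorm w of
        [] \<Rightarrow> (if k = 0 then [] else [(a, k)])
      | (b, l) # w' \<Rightarrow>
          (if k = 0 then (b, l) # w'
           else if a = b then (if k + l = 0 then w' else (a, k + l) # w')
           else (a, k) # (b, l) # w'))"

text \<open>Trace of a reduced word under freeness, given the moments m b k = tau(x_b^k).
Freeness says tau(prod_i (x_{a_i}^{k_i} - m a_i k_i)) = 0 for reduced words; expanding
the product gives a recursion on the word length (the first argument is fuel).\<close>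

primrec fm :: "(bool \<Rightarrow> int \<Rightarrow> complex) \<Rightarrow> nat \<Rightarrow> (bool \<times> int) list \<Rightarrow> complex" where
  "fm m 0 w = 1"
| "fm m (Suc n) w =
     (if w = [] then 1
      else - (\<Sum>S\<in>{S. S \<subset> {..<length w}}.
                (\<Prod>i\<in>{..<length w} - S. - m (fst (w ! i)) (snd (w ! i)))
                * fm m n (wnorm (nths w S))))"

definition free_moment :: "(bool \<Rightarrow> int \<Rightarrow> complex) \<Rightarrow> (bool \<times> int) list \<Rightarrow> complex" where
  "free_moment m w = fm m (length w) (wnorm w)"

definition mom :: "complex measure \<Rightarrow> int \<Rightarrow> complex" where
  "mom \<nu> k = (\<integral>s. s powi k \<partial>\<nu>)"

text \<open>free_mult_conv mu1 mu2 mu: mu is the distribution of x1 x2 for *-free unitaries with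
distributions mu1, mu2, i.e. mu is a probability measure on T whose moments are the
moments tau((x1 x2)^n) (this determines mu, as a measure on T is determined by its
nonnegative moments).\<close>

definition free_mult_conv :: "complex measure \<Rightarrow> complex measure \<Rightarrow> complex measure \<Rightarrow> bool" where
  "free_mult_conv \<mu>1 \<mu>2 \<mu> \<longleftrightarrow> prob_on_T \<mu> \<and>
     (\<forall>n::nat. n \<ge> 1 \<longrightarrow>
        mom \<mu> (int n) =
        free_moment (\<lambda>b k. if b then mom \<mu>2 k else mom \<mu>1 k)
                    (concat (replicate n [(False, 1), (True, 1)])))"

end

theory Submission
  imports Defs "HOL-Complex_Analysis.Complex_Analysis" "HOL-Real_Asymp.Real_Asymp"
begin

text \<open>
  Write \<open>P\<^sub>\<nu> z = \<integral> 1 / |1 - z s|\<^sup>2 d\<nu>(s)\<close>, so that \<open>1 + 2 Re \<psi>\<^sub>\<nu> z = (1 - |z|\<^sup>2) P\<^sub>\<nu> z\<close>. A point \<open>t\<close> of the circle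
  lies in \<open>C\<^sub>\<nu>\<close> as soon as \<open>P\<^sub>\<nu>\<close> stays bounded at points approaching an arc around \<open>t\<close>.

  Into \<open>D\<close>: since \<open>\<psi>\<^sub>\<mu> = \<psi>\<^sub>j \<circ> \<omega>\<^sub>j\<close> and \<open>|\<omega>\<^sub>j z| \<le> |z|\<close>, near \<open>t \<in> C\<^sub>\<mu>\<close> the Poisson integral of \<open>\<mu>\<^sub>j\<close> at
  \<open>\<omega>\<^sub>j z\<close> is bounded, and \<open>\<omega>\<^sub>j\<close> maps an arc around \<open>t\<close> injectively to the circle, hence onto an arc around
  \<open>\<omega>\<^sub>j t\<close>. On the circle \<open>t \<psi>\<^sub>\<nu>' t = - (M + V\<^sub>\<nu> t)\<close> with \<open>M = |\<psi>\<^sub>\<nu> t (\<psi>\<^sub>\<nu> t + 1)|\<close>; taking the common value \<open>u\<close>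
  of \<open>\<psi>\<^sub>1, \<psi>\<^sub>2\<close> as coordinate, \<open>z = f\<^sub>1 u f\<^sub>2 u (1 + u) / u\<close> with local inverses \<open>f\<^sub>j\<close> of \<open>\<psi>\<^sub>j\<close>, and the
  logarithmic derivative of this map is a positive multiple of \<open>V\<^sub>1 V\<^sub>2 - M\<^sup>2\<close>, which has to be negative.

  Onto \<open>D\<close>: if \<open>V\<^sub>1 V\<^sub>2 < M\<^sup>2\<close>, the map \<open>u \<mapsto> z\<close> is invertible near \<open>u\<^sub>0\<close>, and for \<open>z = r t\<close> with \<open>r\<close> close to \<open>1\<close>
  it yields a solution \<open>(w\<^sub>1, w\<^sub>2)\<close> in the bidisc of \<open>w\<^sub>2 = z h\<^sub>1 w\<^sub>1\<close>, \<open>w\<^sub>1 = z h\<^sub>2 w\<^sub>2\<close>, where \<open>h\<^sub>j w = \<eta>\<^sub>j w / w\<close>.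
  Such a solution is unique by the Schwarz lemma, so it is \<open>(\<omega>\<^sub>1 z, \<omega>\<^sub>2 z)\<close>. The freeness hypothesis only
  excludes the spurious solution \<open>\<omega>\<^sub>1 = \<omega>\<^sub>2 = 0\<close>, through the first nonvanishing moment of \<open>\<mu>\<close>.
\<close>

section \<open>Measures on the circle\<close>

text \<open>The condition that 1/z lies off the support, written as an almost sure lower bound on |1
  - z s|. In this form it covers the disc, including z = 0, and the gaps on the circle at
  once.\<close>

definition cauchy_dom :: "complex measure \<Rightarrow> complex set" where
  "cauchy_dom \<nu> = {z. \<exists>d>0. AE s in \<nu>. d \<le> cmod (1 - z * s)}"

text \<open>Index 0 gives 1 + \<psi>, index 1 gives \<psi> divided by z, and the higher indices are
  the remainders of the Taylor expansion at 0.\<close>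

definition cauchy_int :: "complex measure \<Rightarrow> nat \<Rightarrow> complex \<Rightarrow> complex" where
  "cauchy_int \<nu> j z = (\<integral>s. s ^ j / (1 - z * s) \<partial>\<nu>)"

locale circle_measure =
  fixes \<nu> :: "complex measure"
  assumes prob_on_T: "prob_on_T \<nu>"
begin

sublocale prob_space \<nu>
  using prob_on_T by (simp add: prob_on_T_def)

lemma sets_eq [measurable_cong, simp]: "sets \<nu> = sets borel"
  using prob_on_T by (simp add: prob_on_T_def)

lemma space_eq [simp]: "space \<nu> = UNIV"
  using sets_eq_imp_space_eq[OF sets_eq] by simp

lemma AE_unit: "AE s in \<nu>. cmod s = 1"
proof -
  have "emeasure \<nu> (sphere 0 1) = 1"
    using prob_on_T by (simp add: prob_on_T_def)
  then have "prob (sphere 0 1) = 1"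
    by (simp add: measure_def)
  moreover have "sphere 0 1 \<in> events"
    by simp
  ultimately have "AE s in \<nu>. s \<in> sphere 0 1"
    using prob_eq_1 by blast
  then show ?thesis by simp
qed

lemma norm_integral_le_const:
  fixes f :: "complex \<Rightarrow> complex"
  assumes "integrable \<nu> f" and "AE s in \<nu>. norm (f s) \<le> B"
  shows "norm (\<integral>s. f s \<partial>\<nu>) \<le> B"
proof -
  have "norm (\<integral>s. f s \<partial>\<nu>) \<le> (\<integral>s. norm (f s) \<partial>\<nu>)" by (rule integral_norm_bound)
  also have "\<dots> \<le> B" using assms by (intro integral_le_const) auto
  finally show ?thesis .
qed

section \<open>The domain of the Cauchy integrals and its trace on the circle\<close>

lemma ball_subset_cauchy_dom: "ball 0 1 \<subseteq> cauchy_dom \<nu>"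
proof
  fix z :: complex assume "z \<in> ball 0 1"
  then have "1 - cmod z > 0" by simp
  moreover have "AE s in \<nu>. 1 - cmod z \<le> cmod (1 - z * s)"
    using AE_unit
  proof eventually_elim
    case (elim s)
    then show ?case using norm_triangle_ineq2[of 1 "z * s"] by (simp add: norm_mult)
  qed
  ultimately show "z \<in> cauchy_dom \<nu>" unfolding cauchy_dom_def by blast
qed

lemma AE_cauchy_dom_near:
  assumes "AE s in \<nu>. d \<le> cmod (1 - a * s)" and "d > 0" and "dist z a < d / 2"
  shows "AE s in \<nu>. d / 2 \<le> cmod (1 - z * s)"
  using assms(1) AE_unit
proof eventually_elim
  case (elim s)
  have "1 - a * s = (1 - z * s) + (z - a) * s" by (simp add: algebra_simps)
  then have "cmod (1 - a * s) \<le> cmod (1 - z * s) + cmod (z - a) * cmod s"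
    by (metis norm_triangle_ineq norm_mult)
  then show ?case using elim assms(3) by (simp add: dist_norm field_simps)
qed

lemma open_cauchy_dom: "open (cauchy_dom \<nu>)"
  unfolding open_dist
proof
  fix a assume "a \<in> cauchy_dom \<nu>"
  then obtain d where d: "d > 0" "AE s in \<nu>. d \<le> cmod (1 - a * s)"
    by (auto simp: cauchy_dom_def)
  have "z \<in> cauchy_dom \<nu>" if "dist z a < d / 2" for z
    using AE_cauchy_dom_near[OF d(2,1) that] d(1) unfolding cauchy_dom_def
    by (auto intro!: exI[of _ "d / 2"])
  then show "\<exists>e>0. \<forall>y. dist y a < e \<longrightarrow> y \<in> cauchy_dom \<nu>"
    using d(1) by (intro exI[of _ "d / 2"]) auto
qed

text \<open>Multiplication by the unimodular t turns the distance from 1/t to s into |1 - t s|, and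
  a point is off the support iff some ball around it is null.\<close>

lemma CT_eq: "CT \<nu> = sphere 0 1 \<inter> cauchy_dom \<nu>"
proof -
  have "inverse t \<notin> msupp \<nu> \<longleftrightarrow> t \<in> cauchy_dom \<nu>" if t: "cmod t = 1" for t
  proof -
    have [simp]: "t \<noteq> 0" using t by auto
    have eq: "dist (inverse t) s = cmod (1 - t * s)" for s
    proof -
      have "1 - t * s = t * (inverse t - s)" by (simp add: field_simps)
      then show ?thesis using t by (simp add: norm_mult dist_norm)
    qed
    have "inverse t \<notin> msupp \<nu> \<longleftrightarrow> (\<exists>e>0. emeasure \<nu> (ball (inverse t) e) = 0)"
      by (auto simp: msupp_def)
    also have "\<dots> \<longleftrightarrow> (\<exists>e>0. AE s in \<nu>. s \<notin> ball (inverse t) e)"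
    proof (intro ex_cong1 conj_cong refl)
      fix e :: real
      have "{s \<in> space \<nu>. \<not> s \<notin> ball (inverse t) e} = ball (inverse t) e" by auto
      then show "emeasure \<nu> (ball (inverse t) e) = 0 \<longleftrightarrow> (AE s in \<nu>. s \<notin> ball (inverse t) e)"
        by (subst AE_iff_measurable[OF _ refl]) simp_all
    qed
    also have "\<dots> \<longleftrightarrow> t \<in> cauchy_dom \<nu>"
      by (simp add: cauchy_dom_def eq not_less)
    finally show ?thesis .
  qed
  then show ?thesis unfolding CT_def by (intro set_eqI) (metis Int_iff mem_Collect_eq mem_sphere_0)
qed

section \<open>Holomorphy of the Cauchy integrals\<close>

lemma integrable_cauchy:
  assumes "z \<in> cauchy_dom \<nu>"
  shows "integrable \<nu> (\<lambda>s. s ^ j / (1 - z * s) ^ n)"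
proof -
  obtain d where d: "d > 0" "AE s in \<nu>. d \<le> cmod (1 - z * s)"
    using assms by (auto simp: cauchy_dom_def)
  show ?thesis
  proof (rule integrable_const_bound[where B = "1 / d ^ n"])
    show "AE s in \<nu>. norm (s ^ j / (1 - z * s) ^ n) \<le> 1 / d ^ n"
      using d(2) AE_unit
      by eventually_elim (use d(1) in \<open>auto simp: norm_divide norm_power intro!: divide_left_mono power_mono mult_pos_pos zero_less_power\<close>)
  qed measurable
qed

text \<open>The error of the difference quotient is computed exactly under the integral; it carries
  a factor z - a, and its denominators stay above d/2 and d, whence the constant 2 / d^3.\<close>

lemma has_field_derivative_cauchy_int:
  assumes "a \<in> cauchy_dom \<nu>"
  shows "(cauchy_int \<nu> j has_field_derivative (\<integral>s. s ^ Suc j / (1 - a * s)\<^sup>2 \<partial>\<nu>)) (at a)"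
proof -
  obtain d where d: "d > 0" "AE s in \<nu>. d \<le> cmod (1 - a * s)"
    using assms by (auto simp: cauchy_dom_def)
  let ?D = "\<integral>s. s ^ Suc j / (1 - a * s)\<^sup>2 \<partial>\<nu>"
  have bound: "cmod ((cauchy_int \<nu> j z - cauchy_int \<nu> j a) / (z - a) - ?D) \<le> 2 / d ^ 3 * cmod (z - a)"
    if z: "z \<noteq> a" "dist z a < d / 2" for z
  proof -
    have dz: "AE s in \<nu>. d / 2 \<le> cmod (1 - z * s)"
      by (rule AE_cauchy_dom_near[OF d(2,1) z(2)])
    then have zdom: "z \<in> cauchy_dom \<nu>" using d(1) unfolding cauchy_dom_def
      by (auto intro!: exI[of _ "d / 2"])
    let ?f = "\<lambda>s. (s ^ j / (1 - z * s) - s ^ j / (1 - a * s)) / (z - a) - s ^ Suc j / (1 - a * s)\<^sup>2"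
    have i1: "integrable \<nu> (\<lambda>s. s ^ j / (1 - z * s))" and i2: "integrable \<nu> (\<lambda>s. s ^ j / (1 - a * s))"
      using integrable_cauchy[OF zdom, of j 1] integrable_cauchy[OF assms, of j 1] by simp_all
    have i3: "integrable \<nu> (\<lambda>s. s ^ Suc j / (1 - a * s)\<^sup>2)"
      by (rule integrable_cauchy[OF assms])
    have "(cauchy_int \<nu> j z - cauchy_int \<nu> j a) / (z - a) - ?D = (\<integral>s. ?f s \<partial>\<nu>)"
      unfolding cauchy_int_def using i1 i2 i3 by simp
    moreover have "cmod (\<integral>s. ?f s \<partial>\<nu>) \<le> 2 / d ^ 3 * cmod (z - a)"
    proof (rule norm_integral_le_const)
      show "integrable \<nu> ?f" using i1 i2 i3 by auto
      have "AE s in \<nu>. cmod (?f s) \<le> 2 / d ^ 3 * cmod (z - a)"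
        using dz d(2) AE_unit
      proof eventually_elim
        case (elim s)
        have nz: "1 - z * s \<noteq> 0" "1 - a * s \<noteq> 0" using elim d(1) by auto
        have "?f s = s ^ (j + 2) * (z - a) / ((1 - z * s) * (1 - a * s)\<^sup>2)"
        proof -
          have "s ^ j / (1 - z * s) - s ^ j / (1 - a * s)
                = s ^ Suc j * (z - a) / ((1 - z * s) * (1 - a * s))"
            using nz by (simp add: field_simps)
          then have "?f s = s ^ Suc j / ((1 - z * s) * (1 - a * s)) - s ^ Suc j / (1 - a * s)\<^sup>2"
            using z(1) by simp
          also have "\<dots> = s ^ Suc j * ((1 - a * s) - (1 - z * s)) / ((1 - z * s) * (1 - a * s)\<^sup>2)"
            using nz by (simp add: divide_simps power2_eq_square) (simp add: algebra_simps)
          finally show ?thesis by (simp add: algebra_simps)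
        qed
        then have "cmod (?f s) = cmod (z - a) / (cmod (1 - z * s) * cmod (1 - a * s) ^ 2)"
          using elim by (simp add: norm_mult norm_divide norm_power)
        also have "\<dots> \<le> cmod (z - a) / (d / 2 * d ^ 2)"
          using elim d(1) nz by (intro divide_left_mono mult_mono power_mono) (auto intro!: mult_pos_pos)
        also have "\<dots> = 2 / d ^ 3 * cmod (z - a)"
          by (simp add: power2_eq_square power3_eq_cube ac_simps)
        finally show ?case .
      qed
      then show "AE s in \<nu>. norm (?f s) \<le> 2 / d ^ 3 * cmod (z - a)" .
    qed
    ultimately show ?thesis by simp
  qed
  have "((\<lambda>z. (cauchy_int \<nu> j z - cauchy_int \<nu> j a) / (z - a) - ?D) \<longlongrightarrow> 0) (at a)"
  proof (rule Lim_null_comparison)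
    show "\<forall>\<^sub>F z in at a. norm ((cauchy_int \<nu> j z - cauchy_int \<nu> j a) / (z - a) - ?D) \<le> 2 / d ^ 3 * cmod (z - a)"
      unfolding eventually_at using bound d(1) half_gt_zero by blast
    show "((\<lambda>z. 2 / d ^ 3 * cmod (z - a)) \<longlongrightarrow> 0) (at a)"
      using d(1) by (auto intro!: tendsto_eq_intros)
  qed
  then show ?thesis
    unfolding has_field_derivative_iff by (rule Lim_null[THEN iffD2])
qed

lemma holomorphic_cauchy_int: "cauchy_int \<nu> j holomorphic_on cauchy_dom \<nu>"
  using has_field_derivative_cauchy_int by (meson holomorphic_onI field_differentiable_at_within field_differentiable_def)

section \<open>The function \<psi>: Poisson integral, reflection and boundary derivative\<close>

lemma psiT_eq:
  assumes "z \<in> cauchy_dom \<nu>"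
  shows "psiT \<nu> z = cauchy_int \<nu> 0 z - 1" and "psiT \<nu> z = z * cauchy_int \<nu> 1 z"
proof -
  obtain d where d: "d > 0" "AE s in \<nu>. d \<le> cmod (1 - z * s)"
    using assms by (auto simp: cauchy_dom_def)
  have i: "integrable \<nu> (\<lambda>s. 1 / (1 - z * s))" using integrable_cauchy[OF assms, of 0 1] by simp
  have "psiT \<nu> z = (\<integral>s. 1 / (1 - z * s) - 1 \<partial>\<nu>)"
    unfolding psiT_def
  proof (rule integral_cong_AE)
    show "AE s in \<nu>. z * s / (1 - z * s) = 1 / (1 - z * s) - 1"
      using d(2)
    proof eventually_elim
      case (elim s)
      then have "1 - z * s \<noteq> 0" using d(1) by auto
      then show ?case by (simp add: field_simps)
    qed
  qed measurable
  also have "\<dots> = cauchy_int \<nu> 0 z - 1"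
    using i prob_space by (simp add: cauchy_int_def)
  finally show "psiT \<nu> z = cauchy_int \<nu> 0 z - 1" .
  show "psiT \<nu> z = z * cauchy_int \<nu> 1 z"
    by (simp add: psiT_def cauchy_int_def flip: times_divide_eq_right)
qed

lemma has_field_derivative_psiT:
  assumes "z \<in> cauchy_dom \<nu>"
  shows "(psiT \<nu> has_field_derivative (\<integral>s. s / (1 - z * s)\<^sup>2 \<partial>\<nu>)) (at z)"
proof -
  have "((\<lambda>z. cauchy_int \<nu> 0 z - 1) has_field_derivative (\<integral>s. s / (1 - z * s)\<^sup>2 \<partial>\<nu>)) (at z)"
    using has_field_derivative_cauchy_int[OF assms, of 0] by (auto intro!: derivative_eq_intros)
  then show ?thesis
    by (rule has_field_derivative_transform_within_open[OF _ open_cauchy_dom assms]) (simp add: psiT_eq)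
qed

lemma holomorphic_psiT: "psiT \<nu> holomorphic_on cauchy_dom \<nu>"
  using has_field_derivative_psiT by (meson holomorphic_onI field_differentiable_at_within field_differentiable_def)

lemma continuous_on_psiT: "continuous_on (cauchy_dom \<nu>) (psiT \<nu>)"
  by (rule holomorphic_on_imp_continuous_on[OF holomorphic_psiT])

lemma psiT_0 [simp]: "psiT \<nu> 0 = 0"
  by (simp add: psiT_def)

lemma integrable_poisson:
  assumes "z \<in> cauchy_dom \<nu>"
  shows "integrable \<nu> (\<lambda>s. 1 / (cmod (1 - z * s))\<^sup>2)"
  using integrable_norm[OF integrable_cauchy[OF assms, of 0 2]] by (simp add: norm_divide norm_power)

text \<open>Integrates the pointwise identity 2 Re (1 / (1 - z s)) - 1 = (1 - |z|^2) / |1 - z s|^2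
  for |s| = 1; the right side is the Poisson kernel.\<close>

lemma Re_psiT:
  assumes "z \<in> cauchy_dom \<nu>"
  shows "1 + 2 * Re (psiT \<nu> z) = (1 - (cmod z)\<^sup>2) * (\<integral>s. 1 / (cmod (1 - z * s))\<^sup>2 \<partial>\<nu>)"
proof -
  obtain d where d: "d > 0" "AE s in \<nu>. d \<le> cmod (1 - z * s)"
    using assms by (auto simp: cauchy_dom_def)
  have i: "integrable \<nu> (\<lambda>s. 1 / (1 - z * s))" using integrable_cauchy[OF assms, of 0 1] by simp
  have "1 + 2 * Re (psiT \<nu> z) = 2 * Re (cauchy_int \<nu> 0 z) - 1"
    by (simp add: psiT_eq(1)[OF assms])
  also have "\<dots> = (\<integral>s. 2 * Re (1 / (1 - z * s)) - 1 \<partial>\<nu>)"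
    using i prob_space by (simp add: cauchy_int_def)
  also have "\<dots> = (\<integral>s. (1 - (cmod z)\<^sup>2) * (1 / (cmod (1 - z * s))\<^sup>2) \<partial>\<nu>)"
  proof (rule integral_cong_AE)
    show "AE s in \<nu>. 2 * Re (1 / (1 - z * s)) - 1 = (1 - (cmod z)\<^sup>2) * (1 / (cmod (1 - z * s))\<^sup>2)"
      using d(2) AE_unit
    proof eventually_elim
      case (elim s)
      then have nz: "(cmod (1 - z * s))\<^sup>2 \<noteq> 0" using d(1) by auto
      have "(cmod (1 - z * s))\<^sup>2 = 1 - 2 * Re (z * s) + (cmod (z * s))\<^sup>2"
        unfolding cmod_power2 by (simp add: power2_eq_square algebra_simps)
      then have "2 * Re (1 - z * s) - (cmod (1 - z * s))\<^sup>2 = 1 - (cmod z)\<^sup>2"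
        using elim by (simp add: norm_mult)
      moreover have "Re (1 / (1 - z * s)) = Re (1 - z * s) / (cmod (1 - z * s))\<^sup>2"
        by (simp add: Re_divide' cmod_power2)
      ultimately show ?case using nz by (simp add: field_simps)
    qed
  qed measurable
  also have "\<dots> = (1 - (cmod z)\<^sup>2) * (\<integral>s. 1 / (cmod (1 - z * s))\<^sup>2 \<partial>\<nu>)"
    by (rule integral_mult_right_zero)
  finally show ?thesis .
qed

lemma poisson_ge:
  assumes "z \<in> cauchy_dom \<nu>"
  shows "(\<integral>s. 1 / (cmod (1 - z * s))\<^sup>2 \<partial>\<nu>) \<ge> 1 / (1 + cmod z)\<^sup>2"
proof -
  obtain d where d: "d > 0" "AE s in \<nu>. d \<le> cmod (1 - z * s)"
    using assms by (auto simp: cauchy_dom_def)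
  have "(\<integral>s. 1 / (1 + cmod z)\<^sup>2 \<partial>\<nu>) \<le> (\<integral>s. 1 / (cmod (1 - z * s))\<^sup>2 \<partial>\<nu>)"
  proof (rule integral_mono_AE)
    show "AE s in \<nu>. 1 / (1 + cmod z)\<^sup>2 \<le> 1 / (cmod (1 - z * s))\<^sup>2"
      using d(2) AE_unit
    proof eventually_elim
      case (elim s)
      have "cmod (1 - z * s) \<le> 1 + cmod z"
        using norm_triangle_ineq4[of 1 "z * s"] elim by (simp add: norm_mult)
      then show ?case using elim d(1) by (intro divide_left_mono power_mono) (auto intro!: mult_pos_pos)
    qed
  qed (use integrable_poisson[OF assms] in auto)
  then show ?thesis using prob_space by simp
qed

lemma Re_psiT_gt:
  assumes "z \<in> ball 0 1"
  shows "Re (psiT \<nu> z) > - 1 / 2"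
proof -
  have z: "z \<in> cauchy_dom \<nu>" using assms ball_subset_cauchy_dom by blast
  have "1 + cmod z > 0" by (simp add: add_pos_nonneg)
  then have "0 < 1 / (1 + cmod z)\<^sup>2" by simp
  also note poisson_ge[OF z]
  finally have "(\<integral>s. 1 / (cmod (1 - z * s))\<^sup>2 \<partial>\<nu>) > 0" .
  moreover have "1 - (cmod z)\<^sup>2 > 0"
    using assms by (simp add: power_less_one_iff abs_square_less_1)
  ultimately have "1 + 2 * Re (psiT \<nu> z) > 0" unfolding Re_psiT[OF z] by (rule mult_pos_pos[rotated])
  then show ?thesis by simp
qed

lemma Re_psiT_circle:
  assumes "t \<in> CT \<nu>"
  shows "Re (psiT \<nu> t) = - 1 / 2"
  using Re_psiT[of t] assms by (simp add: CT_eq)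

text \<open>For |s| = 1, replacing z by its mirror image in the circle changes 1 - z s into its
  conjugate times a factor of modulus 1/|z|.\<close>

lemma psiT_reflect:
  assumes "z \<in> cauchy_dom \<nu>" "z \<noteq> 0"
  shows "inverse (cnj z) \<in> cauchy_dom \<nu>" and "psiT \<nu> (inverse (cnj z)) = - 1 - cnj (psiT \<nu> z)"
proof -
  obtain d where d: "d > 0" "AE s in \<nu>. d \<le> cmod (1 - z * s)"
    using assms by (auto simp: cauchy_dom_def)
  have refl: "1 - inverse (cnj z) * s = - (s / cnj z) * cnj (1 - z * s)" if "cmod s = 1" for s
  proof -
    have "s * cnj s = 1" using that by (simp add: complex_norm_square[symmetric])
    then show ?thesis using assms(2) by (simp add: field_simps)
  qed
  have "AE s in \<nu>. d / cmod z \<le> cmod (1 - inverse (cnj z) * s)"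
    using d(2) AE_unit
  proof eventually_elim
    case (elim s)
    have "cmod (1 - inverse (cnj z) * s) = cmod (1 - z * s) / cmod z"
      unfolding refl[OF elim(2)] using elim by (simp add: norm_mult norm_divide del: complex_cnj_diff)
    then show ?case using elim by (simp add: divide_right_mono)
  qed
  moreover have "d / cmod z > 0" using d assms by simp
  ultimately show dom: "inverse (cnj z) \<in> cauchy_dom \<nu>"
    unfolding cauchy_dom_def by blast
  have i: "integrable \<nu> (\<lambda>s. 1 / (1 - z * s))"
    using integrable_cauchy[OF assms(1), of 0 1] by simp
  have "psiT \<nu> (inverse (cnj z)) = (\<integral>s. - cnj (1 / (1 - z * s)) \<partial>\<nu>)"
    unfolding psiT_def
  proof (rule integral_cong_AE)
    show "AE s in \<nu>. inverse (cnj z) * s / (1 - inverse (cnj z) * s) = - cnj (1 / (1 - z * s))"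
      using d(2) AE_unit
    proof eventually_elim
      case (elim s)
      have "1 - z * s \<noteq> 0" "s \<noteq> 0" using elim d(1) by auto
      then have "cnj (1 - z * s) \<noteq> 0" using complex_cnj_zero_iff by blast
      then show ?case unfolding refl[OF elim(2)] using assms(2) \<open>s \<noteq> 0\<close>
        by (simp add: field_simps del: complex_cnj_diff)
    qed
    show "(\<lambda>s. - cnj (1 / (1 - z * s))) \<in> borel_measurable \<nu>"
      using borel_measurable_integrable[OF i]
      by (intro borel_measurable_uminus measurable_compose[OF _ borel_measurable_continuous_onI[of cnj]])
        (auto intro!: continuous_intros)
  qed measurable
  also have "\<dots> = - cnj (cauchy_int \<nu> 0 z)"
    using integral_bounded_linear[OF bounded_linear_cnj i] by (simp add: cauchy_int_def)
  finally show "psiT \<nu> (inverse (cnj z)) = - 1 - cnj (psiT \<nu> z)"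
    by (simp add: psiT_eq(1)[OF assms(1)])
qed

text \<open>On the circle 1 / (1 - t s) = 1/2 + i x(s) with x real. Hence \<psi> has imaginary part
  X = E[x], \<open>VT\<close> is the variance of x, and t \<psi>'(t) =
  E[1 / (1 - t s)^2 - 1 / (1 - t s)] = -(1/4 + E[x^2]).\<close>

lemma VT_circle:
  assumes "t \<in> CT \<nu>"
  shows "VT \<nu> t \<ge> 0"
    and "cmod (psiT \<nu> t * (psiT \<nu> t + 1)) = 1 / 4 + (Im (psiT \<nu> t))\<^sup>2"
    and "t * deriv (psiT \<nu>) t = - of_real (1 / 4 + (Im (psiT \<nu> t))\<^sup>2 + VT \<nu> t)"
proof -
  have t: "cmod t = 1" "t \<in> cauchy_dom \<nu>" using assms by (auto simp: CT_eq)
  obtain d where d: "d > 0" "AE s in \<nu>. d \<le> cmod (1 - t * s)"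
    using t by (auto simp: cauchy_dom_def)
  define x where "x = (\<lambda>s. Im (1 / (1 - t * s)))"
  define X where "X = (\<integral>s. x s \<partial>\<nu>)"
  define E where "E = (\<integral>s. (x s)\<^sup>2 \<partial>\<nu>)"
  have i1: "integrable \<nu> (\<lambda>s. 1 / (1 - t * s))" and i2: "integrable \<nu> (\<lambda>s. 1 / (1 - t * s)\<^sup>2)"
    using integrable_cauchy[OF t(2), of 0 1] integrable_cauchy[OF t(2), of 0 2] by simp_all
  have x: "AE s in \<nu>. 1 / (1 - t * s) = Complex (1 / 2) (x s)"
    using d(2) AE_unit
  proof eventually_elim
    case (elim s)
    then have nz: "(cmod (1 - t * s))\<^sup>2 \<noteq> 0" using d(1) by auto
    have "(cmod (1 - t * s))\<^sup>2 = 1 - 2 * Re (t * s) + (cmod (t * s))\<^sup>2"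
      unfolding cmod_power2 by (simp add: power2_eq_square algebra_simps)
    then have "2 * Re (1 - t * s) = (cmod (1 - t * s))\<^sup>2"
      using elim t by (simp add: norm_mult)
    moreover have "Re (1 / (1 - t * s)) = Re (1 - t * s) / (cmod (1 - t * s))\<^sup>2"
      by (simp add: Re_divide' cmod_power2)
    ultimately have "Re (1 / (1 - t * s)) = Re (1 - t * s) / (2 * Re (1 - t * s))" by simp
    also have "\<dots> = 1 / 2" using nz \<open>2 * Re (1 - t * s) = (cmod (1 - t * s))\<^sup>2\<close> by auto
    finally have "Re (1 / (1 - t * s)) = 1 / 2" .
    then show ?case by (simp add: complex_eq_iff x_def)
  qed
  have ix: "integrable \<nu> x" unfolding x_def using i1 by (rule integrable_Im)
  have AE2: "AE s in \<nu>. 1 / (1 - t * s)\<^sup>2 = Complex (1 / 4 - (x s)\<^sup>2) (x s)"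
    using x
  proof eventually_elim
    case (elim s)
    have "1 / (1 - t * s)\<^sup>2 = (1 / (1 - t * s))\<^sup>2" by (simp add: power_divide)
    also have "\<dots> = Complex (1 / 4 - (x s)\<^sup>2) (x s)"
      unfolding elim by (simp add: complex_eq_iff power2_eq_square)
    finally show ?case .
  qed
  have ix2: "integrable \<nu> (\<lambda>s. (x s)\<^sup>2)"
  proof -
    have "integrable \<nu> (\<lambda>s. 1 / 4 - Re (1 / (1 - t * s)\<^sup>2))"
      using i2 by (intro Bochner_Integration.integrable_diff integrable_Re) auto
    moreover have "AE s in \<nu>. (x s)\<^sup>2 = 1 / 4 - Re (1 / (1 - t * s)\<^sup>2)"
      using AE2 by eventually_elim simp
    ultimately show ?thesis
      by (subst integrable_cong_AE[where g = "\<lambda>s. 1 / 4 - Re (1 / (1 - t * s)\<^sup>2)"]) (auto simp: x_def)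
  qed
  have A: "cauchy_int \<nu> 0 t = Complex (1 / 2) X"
  proof (rule complex_eqI)
    have "Re (cauchy_int \<nu> 0 t) = 1 / 2" using Re_psiT_circle[OF assms] psiT_eq(1)[OF t(2)] by simp
    then show "Re (cauchy_int \<nu> 0 t) = Re (Complex (1 / 2) X)" by simp
    show "Im (cauchy_int \<nu> 0 t) = Im (Complex (1 / 2) X)"
      using i1 by (simp add: cauchy_int_def X_def x_def)
  qed
  have I2: "(\<integral>s. 1 / (1 - t * s)\<^sup>2 \<partial>\<nu>) = Complex (1 / 4 - E) X"
  proof (rule complex_eqI)
    have "Re (\<integral>s. 1 / (1 - t * s)\<^sup>2 \<partial>\<nu>) = (\<integral>s. Re (1 / (1 - t * s)\<^sup>2) \<partial>\<nu>)"
      using i2 by simp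
    also have "\<dots> = (\<integral>s. 1 / 4 - (x s)\<^sup>2 \<partial>\<nu>)"
      by (rule integral_cong_AE) (use AE2 in \<open>auto simp: x_def\<close>)
    finally show "Re (\<integral>s. 1 / (1 - t * s)\<^sup>2 \<partial>\<nu>) = Re (Complex (1 / 4 - E) X)"
      using ix2 prob_space by (simp add: E_def)
    have "Im (\<integral>s. 1 / (1 - t * s)\<^sup>2 \<partial>\<nu>) = (\<integral>s. Im (1 / (1 - t * s)\<^sup>2) \<partial>\<nu>)"
      using i2 by simp
    also have "\<dots> = (\<integral>s. x s \<partial>\<nu>)"
      by (rule integral_cong_AE) (use AE2 in \<open>auto simp: x_def\<close>)
    finally show "Im (\<integral>s. 1 / (1 - t * s)\<^sup>2 \<partial>\<nu>) = Im (Complex (1 / 4 - E) X)"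
      by (simp add: X_def)
  qed
  have var: "0 \<le> E - X\<^sup>2"
  proof -
    have "variance x = E - X\<^sup>2" using variance_eq[OF ix ix2] by (simp add: E_def X_def)
    then show ?thesis using variance_positive[of x] by simp
  qed
  have psi: "psiT \<nu> t = Complex (- 1 / 2) X"
    using A psiT_eq(1)[OF t(2)] by (simp add: complex_eq_iff)
  have V: "VT \<nu> t = E - X\<^sup>2"
  proof -
    have "(\<integral>s. 1 / (1 - t * s)\<^sup>2 \<partial>\<nu>) - (\<integral>s. 1 / (1 - t * s) \<partial>\<nu>)\<^sup>2 = of_real (X\<^sup>2 - E)"
    proof -
      have "(\<integral>s. 1 / (1 - t * s) \<partial>\<nu>) = Complex (1 / 2) X" using A by (simp add: cauchy_int_def)
      then have *: "(\<integral>s. 1 / (1 - t * s) \<partial>\<nu>)\<^sup>2 = Complex (1 / 4 - X\<^sup>2) X"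
        by (simp only:) (simp add: complex_eq_iff power2_eq_square)
      show ?thesis unfolding I2 * by (simp add: complex_eq_iff)
    qed
    then show ?thesis unfolding VT_def using var by (simp add: norm_of_real del: of_real_diff)
  qed
  show "VT \<nu> t \<ge> 0" using V var by simp
  have "psiT \<nu> t * (psiT \<nu> t + 1) = - of_real (1 / 4 + X\<^sup>2)"
    unfolding psi by (simp add: complex_eq_iff power2_eq_square)
  moreover have "1 / 4 + X\<^sup>2 \<ge> 0" by simp
  ultimately show "cmod (psiT \<nu> t * (psiT \<nu> t + 1)) = 1 / 4 + (Im (psiT \<nu> t))\<^sup>2"
    unfolding psi by (simp only: norm_minus_cancel norm_of_real) simp
  have "t * deriv (psiT \<nu>) t = (\<integral>s. t * (s / (1 - t * s)\<^sup>2) \<partial>\<nu>)"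
    unfolding DERIV_imp_deriv[OF has_field_derivative_psiT[OF t(2)]]
    by (rule integral_mult_right_zero[symmetric])
  also have "\<dots> = (\<integral>s. 1 / (1 - t * s)\<^sup>2 - 1 / (1 - t * s) \<partial>\<nu>)"
  proof (rule integral_cong_AE)
    show "AE s in \<nu>. t * (s / (1 - t * s)\<^sup>2) = 1 / (1 - t * s)\<^sup>2 - 1 / (1 - t * s)"
      using d(2)
    proof eventually_elim
      case (elim s)
      then have "1 - t * s \<noteq> 0" using d(1) by auto
      then show ?case by (simp add: divide_simps power2_eq_square)
    qed
  qed measurable
  also have "\<dots> = Complex (1 / 4 - E) X - Complex (1 / 2) X"
    using i1 i2 A I2 by (simp add: cauchy_int_def)
  also have "\<dots> = - of_real (1 / 4 + X\<^sup>2 + (E - X\<^sup>2))"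
    by (simp add: complex_eq_iff)
  finally show "t * deriv (psiT \<nu>) t = - of_real (1 / 4 + (Im (psiT \<nu> t))\<^sup>2 + VT \<nu> t)"
    unfolding V psi by simp
qed

end

section \<open>Detecting gaps of the support\<close>

lemma norm_cis_diff_le: "cmod (cis a - cis b) \<le> \<bar>a - b\<bar>"
proof -
  have "cis a - cis b = cis b * (exp (\<i> * of_real (a - b)) - 1)"
    by (simp add: cis_conv_exp algebra_simps flip: exp_add)
  then have "cmod (cis a - cis b) = 2 * \<bar>sin ((a - b) / 2)\<bar>"
    by (metis norm_mult norm_cis mult_1 dist_exp_i_1)
  also have "\<dots> \<le> \<bar>a - b\<bar>"
    using abs_sin_x_le_abs_x[of "(a - b) / 2"] by simp
  finally show ?thesis .
qed

text \<open>The argument of x / p is rounded down to a multiple of 2 pi / N, and an arc is at least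
  as long as its chord.\<close>

lemma exists_root_near:
  fixes N :: nat
  assumes "cmod x = 1" "cmod p = 1" "N > 0"
  obtains k :: nat where "k < N" "dist x (p * cis (2 * pi * k / N)) \<le> 2 * pi / N"
proof -
  have p0: "p \<noteq> 0" using assms by auto
  have "cmod (x / p) = 1" using assms by (simp add: norm_divide)
  then obtain \<theta> where \<theta>: "0 \<le> \<theta>" "\<theta> < 2 * pi" "x / p = Complex (cos \<theta>) (sin \<theta>)"
    by (rule complex_unimodular_polar)
  then have cis: "x / p = cis \<theta>" by (simp add: complex_eq_iff)
  define k where "k = nat \<lfloor>\<theta> * N / (2 * pi)\<rfloor>"
  have nn: "0 \<le> \<theta> * N / (2 * pi)" using \<theta> by simp
  have k1: "real k \<le> \<theta> * N / (2 * pi)" "\<theta> * N / (2 * pi) < real k + 1"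
    using nn unfolding k_def by (simp_all add: of_nat_nat)
  have "\<theta> * N / (2 * pi) < N" using \<theta> assms(3) by (simp add: field_simps)
  then have "k < N" using k1 by linarith
  have "dist x (p * cis (2 * pi * k / N)) = cmod (cis \<theta> - cis (2 * pi * k / N))"
  proof -
    have "x = p * cis \<theta>" using p0 cis by (simp add: field_simps)
    then have "x - p * cis (2 * pi * k / N) = p * (cis \<theta> - cis (2 * pi * k / N))"
      by (simp add: algebra_simps)
    then show ?thesis using assms by (simp add: dist_norm norm_mult)
  qed
  also have "\<dots> \<le> \<bar>\<theta> - 2 * pi * k / N\<bar>"
    by (rule norm_cis_diff_le)
  also have "\<dots> \<le> 2 * pi / N"
  proof -
    have "2 * pi * k / N \<le> \<theta>" using k1(1) assms(3) by (simp add: field_simps)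
    moreover have "\<theta> \<le> 2 * pi * k / N + 2 * pi / N"
    proof -
      have "\<theta> * N < (real k + 1) * (2 * pi)"
        using k1(2) by (simp add: pos_divide_less_eq)
      then have "\<theta> \<le> (real k + 1) * (2 * pi) / N" using assms(3) by (simp add: pos_le_divide_eq)
      then show ?thesis by (simp add: algebra_simps add_divide_distrib)
    qed
    ultimately show ?thesis by linarith
  qed
  finally show thesis using that \<open>k < N\<close> by blast
qed

context circle_measure
begin

text \<open>Markov's inequality for the kernel 1 / |1 - z s|^2, which is at least 1 / (4
  \<epsilon>^2) on the ball because z and 1/s are both \<epsilon>-close to t.\<close>

lemma prob_ball_le_poisson:
  assumes "cmod t = 1" "\<epsilon> > 0" "z \<in> cauchy_dom \<nu>" "dist z t < \<epsilon>"
    and K: "(\<integral>s. 1 / (cmod (1 - z * s))\<^sup>2 \<partial>\<nu>) \<le> K"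
  shows "prob (ball (inverse t) \<epsilon>) \<le> 4 * \<epsilon>\<^sup>2 * K"
proof -
  let ?u = "\<lambda>s. 1 / (cmod (1 - z * s))\<^sup>2"
  obtain d where d: "d > 0" "AE s in \<nu>. d \<le> cmod (1 - z * s)"
    using assms by (auto simp: cauchy_dom_def)
  have [simp]: "t \<noteq> 0" using assms(1) by auto
  have "prob (ball (inverse t) \<epsilon>) \<le> prob {s \<in> space \<nu>. ?u s \<ge> 1 / (4 * \<epsilon>\<^sup>2)}"
  proof (rule finite_measure_mono_AE)
    show "AE s in \<nu>. s \<in> ball (inverse t) \<epsilon> \<longrightarrow> s \<in> {s \<in> space \<nu>. ?u s \<ge> 1 / (4 * \<epsilon>\<^sup>2)}"
      using d(2) AE_unit
    proof eventually_elim
      case (elim s)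
      show ?case
      proof
        assume s: "s \<in> ball (inverse t) \<epsilon>"
        have "1 - z * s = t * (inverse t - s) + (t - z) * s" by (simp add: field_simps)
        then have "cmod (1 - z * s) \<le> cmod (inverse t - s) + cmod (t - z)"
          by (metis assms(1) elim(2) mult_1 mult.right_neutral norm_mult norm_triangle_ineq)
        then have "cmod (1 - z * s) \<le> 2 * \<epsilon>"
          using s assms(4) by (simp add: dist_norm norm_minus_commute)
        then have "(cmod (1 - z * s))\<^sup>2 \<le> (2 * \<epsilon>)\<^sup>2" by (intro power_mono) auto
        moreover have "(cmod (1 - z * s))\<^sup>2 > 0" using elim d(1) by auto
        ultimately have "1 / (2 * \<epsilon>)\<^sup>2 \<le> ?u s" by (intro divide_left_mono) (auto intro!: mult_pos_pos)
        then show "s \<in> {s \<in> space \<nu>. ?u s \<ge> 1 / (4 * \<epsilon>\<^sup>2)}" by (simp add: power_mult_distrib)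
      qed
    qed
  qed measurable
  also have "\<dots> \<le> (\<integral>s. ?u s \<partial>\<nu>) / (1 / (4 * \<epsilon>\<^sup>2))"
    using assms(2) integrable_poisson[OF assms(3)]
    by (intro integral_Markov_inequality_measure[where A = "{}"]) auto
  also have "\<dots> = 4 * \<epsilon>\<^sup>2 * (\<integral>s. ?u s \<partial>\<nu>)"
    using assms(2) by simp
  also have "\<dots> \<le> 4 * \<epsilon>\<^sup>2 * K"
    using K by (intro mult_left_mono) auto
  finally show ?thesis .
qed

text \<open>A local bound on the Poisson integral makes the measure of a ball of radius \<open>\<epsilon>\<close> of order
  \<open>\<epsilon>\<^sup>2\<close>, while an arc is covered by order \<open>1 / \<epsilon>\<close> such balls.\<close>

lemma CT_if_poisson_bounded:
  assumes t: "cmod t = 1" and e: "e > 0"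
    and bd: "\<And>t' \<epsilon>. cmod t' = 1 \<Longrightarrow> dist t' t < e \<Longrightarrow> \<epsilon> > 0 \<Longrightarrow>
          \<exists>z\<in>cauchy_dom \<nu>. dist z t' < \<epsilon> \<and> (\<integral>s. 1 / (cmod (1 - z * s))\<^sup>2 \<partial>\<nu>) \<le> K"
  shows "t \<in> CT \<nu>"
proof -
  define p where "p = inverse t"
  have p: "cmod p = 1" "p \<noteq> 0" using t by (auto simp: p_def norm_inverse)
  have K0: "K \<ge> 0"
  proof -
    obtain z where "(\<integral>s. 1 / (cmod (1 - z * s))\<^sup>2 \<partial>\<nu>) \<le> K"
      using bd[of t 1] t e by auto
    moreover have "0 \<le> (\<integral>s. 1 / (cmod (1 - z * s))\<^sup>2 \<partial>\<nu>)"
      by (rule integral_nonneg_AE) auto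
    ultimately show ?thesis by linarith
  qed
  have *: "prob (ball r \<epsilon>) \<le> 4 * \<epsilon>\<^sup>2 * K" if "cmod r = 1" "dist r p < e" "\<epsilon> > 0" for r \<epsilon>
  proof -
    have r0: "r \<noteq> 0" using that by auto
    \<comment> \<open>Inversion is an isometry of the circle, so points near 1/t correspond to
      points near t at the same distance.\<close>
    have "inverse r - t = inverse r * t * (p - r)" using r0 t by (auto simp: p_def field_simps)
    then have "dist (inverse r) t = dist r p"
      using that t by (simp add: dist_norm norm_mult norm_inverse norm_minus_commute)
    then have "\<exists>z\<in>cauchy_dom \<nu>. dist z (inverse r) < \<epsilon> \<and> (\<integral>s. 1 / (cmod (1 - z * s))\<^sup>2 \<partial>\<nu>) \<le> K"
      using bd[of "inverse r" \<epsilon>] that by (auto simp: norm_inverse)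
    then obtain z where "z \<in> cauchy_dom \<nu>" "dist z (inverse r) < \<epsilon>" "(\<integral>s. 1 / (cmod (1 - z * s))\<^sup>2 \<partial>\<nu>) \<le> K"
      by blast
    then show ?thesis using prob_ball_le_poisson[of "inverse r" \<epsilon> z K] that by (auto simp: norm_inverse)
  qed
  \<comment> \<open>Since 7 > 2 pi, open balls of radius 7/N around the rotated N-th roots of unity
    cover the circle, and those meeting the ball of radius e/2 have centres within e of
    \<open>p\<close>. At most N balls of measure 4 (7/N)^2 K give 196 K / N.\<close>
  have bound: "prob (ball p (e / 2)) \<le> 196 * K / N" if N: "N > 0" "7 / N < e / 2" for N :: nat
  proof -
    define r where "r = (\<lambda>k::nat. p * cis (2 * pi * k / N))"
    define I where "I = {k. k < N \<and> dist (r k) p < e}"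
    have [simp]: "finite I" "card I \<le> N"
      using card_mono[of "{..<N}" I] by (auto simp: I_def)
    have pi7: "2 * pi / N < 7 / N" using pi_less_4 pi_approx N(1) by (simp add: divide_strict_right_mono)
    have "prob (ball p (e / 2)) \<le> prob (\<Union>k\<in>I. ball (r k) (7 / N))"
    proof (rule finite_measure_mono_AE)
      show "AE s in \<nu>. s \<in> ball p (e / 2) \<longrightarrow> s \<in> (\<Union>k\<in>I. ball (r k) (7 / N))"
        using AE_unit
      proof eventually_elim
        case (elim s)
        show ?case
        proof
          assume s: "s \<in> ball p (e / 2)"
          obtain k where k: "k < N" "dist s (r k) \<le> 2 * pi / N"
            using exists_root_near[OF elim p(1) N(1)] unfolding r_def by blast
          have sk: "dist (r k) s < 7 / N" using k pi7 by (simp add: dist_commute)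
          have "dist (r k) p \<le> dist (r k) s + dist s p" by (rule dist_triangle)
          also have "\<dots> < e" using sk N(2) s by (simp add: dist_commute)
          finally have "k \<in> I" using k by (simp add: I_def)
          then show "s \<in> (\<Union>k\<in>I. ball (r k) (7 / N))" using sk by auto
        qed
      qed
    qed auto
    also have "\<dots> \<le> (\<Sum>k\<in>I. prob (ball (r k) (7 / N)))"
      by (rule finite_measure_subadditive_finite) auto
    also have "\<dots> \<le> (\<Sum>k\<in>I. 4 * (7 / N)\<^sup>2 * K)"
      using p N by (intro sum_mono *) (auto simp: I_def r_def norm_mult)
    also have "\<dots> = card I * (4 * (7 / N)\<^sup>2 * K)" by simp
    also have "\<dots> \<le> N * (4 * (7 / N)\<^sup>2 * K)"
      using K0 by (intro mult_right_mono) auto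
    also have "\<dots> = 196 * K / N" using N(1) by (simp add: power2_eq_square)
    finally show ?thesis .
  qed
  have "prob (ball p (e / 2)) \<le> 0"
  proof (rule tendsto_lowerbound)
    show "(\<lambda>N. 196 * K / real N) \<longlonglongrightarrow> 0" by real_asymp
    have "(\<lambda>N. 7 / real N) \<longlonglongrightarrow> 0" by real_asymp
    then have "\<forall>\<^sub>F N in sequentially. 7 / real N < e / 2"
      by (rule order_tendstoD) (use e in auto)
    then show "\<forall>\<^sub>F N in sequentially. prob (ball p (e / 2)) \<le> 196 * K / real N"
      using eventually_gt_at_top[of 0] by eventually_elim (rule bound)
  qed auto
  then have "emeasure \<nu> (ball p (e / 2)) = 0"
    by (simp add: emeasure_eq_measure measure_le_0_iff)
  then have "p \<notin> msupp \<nu>" using e by (auto simp: msupp_def intro!: exI[of _ "e / 2"])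
  then show ?thesis using t by (simp add: CT_def p_def)
qed

end

text \<open>The angle parametrises the arc around t, and Im (w / f t) is a chart of the circle near
  f t. In these coordinates f is a continuous injective real function on an interval, hence
  open.\<close>

lemma circle_arc_image_nhd:
  fixes f :: "complex \<Rightarrow> complex"
  assumes t: "cmod t = 1" and e: "e > 0"
    and cont: "continuous_on (sphere 0 1 \<inter> ball t e) f"
    and inj: "inj_on f (sphere 0 1 \<inter> ball t e)"
    and unit: "\<And>z. z \<in> sphere 0 1 \<inter> ball t e \<Longrightarrow> cmod (f z) = 1"
  obtains e' where "e' > 0" "sphere 0 1 \<inter> ball (f t) e' \<subseteq> f ` (sphere 0 1 \<inter> ball t e)"
proof -
  let ?A = "sphere 0 1 \<inter> ball t e"
  have tA: "t \<in> ?A" using t e by simp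
  have ft: "cmod (f t) = 1" "f t \<noteq> 0" using unit[OF tA] by auto
  obtain e1 where e1: "e1 > 0" "\<And>z. z \<in> ?A \<Longrightarrow> dist z t < e1 \<Longrightarrow> dist (f z) (f t) < 1"
    using cont tA unfolding continuous_on_iff by (metis zero_less_one)
  \<comment> \<open>The bound 1 < pi/2 makes the angle injective through its sine; \<open>e1\<close>
    keeps the image within distance 1 of f t.\<close>
  define \<delta> where "\<delta> = min 1 (min e e1)"
  have \<delta>: "\<delta> > 0" "\<delta> \<le> 1" "\<delta> \<le> e" "\<delta> \<le> e1" using e e1 by (auto simp: \<delta>_def)
  define c where "c = (\<lambda>x. t * cis x)"
  have near: "dist (c x) t < \<delta>" if "x \<in> {-\<delta><..<\<delta>}" for x
  proof -
    have "c x - t = t * (cis x - cis 0)" by (simp add: c_def algebra_simps)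
    then have "dist (c x) t \<le> \<bar>x\<bar>" using norm_cis_diff_le[of x 0] t by (simp add: dist_norm norm_mult)
    then show ?thesis using that by auto
  qed
  have cA: "c x \<in> ?A" if "x \<in> {-\<delta><..<\<delta>}" for x
    using near[OF that] \<delta> t by (auto simp: c_def norm_mult dist_commute)
  have injc: "inj_on c {-\<delta><..<\<delta>}"
  proof (rule inj_onI)
    fix x y assume xy: "x \<in> {-\<delta><..<\<delta>}" "y \<in> {-\<delta><..<\<delta>}" "c x = c y"
    then have "cis x = cis y" using t by (auto simp: c_def)
    then have "sin x = sin y" by (simp add: complex_eq_iff)
    moreover have "\<bar>x\<bar> \<le> pi / 2" "\<bar>y\<bar> \<le> pi / 2" using xy \<delta> pi_gt3 by auto
    ultimately show "x = y" using sin_inj_pi[of x y] by (auto simp: abs_le_iff)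
  qed
  \<comment> \<open>Positivity selects the sign of the real part, so on the unit circle the
    imaginary part alone determines w.\<close>
  have Re_pos: "Re (w / f t) > 0" if "dist w (f t) < 1" for w
  proof -
    have "w / f t - 1 = (w - f t) / f t" using ft by (simp add: field_simps)
    then have "cmod (w / f t - 1) < 1" using that ft by (simp add: norm_divide dist_norm)
    then show ?thesis using abs_Re_le_cmod[of "w / f t - 1"] by auto
  qed
  have eqI: "w = w'" if "cmod w = 1" "cmod w' = 1" "dist w (f t) < 1" "dist w' (f t) < 1"
    "Im (w / f t) = Im (w' / f t)" for w w'
  proof -
    have "(Re (w / f t))\<^sup>2 = (Re (w' / f t))\<^sup>2"
    proof -
      have "(cmod (w / f t))\<^sup>2 = 1" "(cmod (w' / f t))\<^sup>2 = 1" using that ft by (auto simp: norm_divide)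
      then show ?thesis unfolding cmod_power2 using that(5) by simp
    qed
    then have "Re (w / f t) = Re (w' / f t)"
      using Re_pos[OF that(3)] Re_pos[OF that(4)] by (simp add: power2_eq_iff)
    then have "w / f t = w' / f t" using that(5) by (simp add: complex_eq_iff)
    then show ?thesis using ft by simp
  qed
  define \<phi> where "\<phi> = (\<lambda>x. Im (f (c x) / f t))"
  have "open (\<phi> ` {-\<delta><..<\<delta>})"
  proof (rule injective_into_1d_imp_open_map_UNIV)
    have "continuous_on {-\<delta><..<\<delta>} c"
      unfolding c_def cis_conv_exp by (intro continuous_intros)
    then have "continuous_on {-\<delta><..<\<delta>} (f \<circ> c)"
      using cA by (intro continuous_on_compose continuous_on_subset[OF cont]) auto
    then show "continuous_on {-\<delta><..<\<delta>} \<phi>"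
      unfolding \<phi>_def using ft by (intro continuous_intros) (auto simp: comp_def)
    show "inj_on \<phi> {-\<delta><..<\<delta>}"
    proof (rule inj_onI)
      fix x y assume xy: "x \<in> {-\<delta><..<\<delta>}" "y \<in> {-\<delta><..<\<delta>}" "\<phi> x = \<phi> y"
      have "f (c x) = f (c y)"
        using xy cA near \<delta> unit e1(2) unfolding \<phi>_def by (intro eqI) force+
      then have "c x = c y" using inj cA xy by (auto dest: inj_onD)
      then show "x = y" using injc xy by (auto dest: inj_onD)
    qed
  qed auto
  moreover have "0 \<in> \<phi> ` {-\<delta><..<\<delta>}"
    using ft \<delta> by (intro image_eqI[of _ _ 0]) (auto simp: \<phi>_def c_def)
  ultimately obtain e2 where e2: "e2 > 0" "ball 0 e2 \<subseteq> \<phi> ` {-\<delta><..<\<delta>}"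
    using open_contains_ball by blast
  show thesis
  proof (rule that[of "min 1 e2"])
    show "min 1 e2 > 0" using e2 by simp
    show "sphere 0 1 \<inter> ball (f t) (min 1 e2) \<subseteq> f ` ?A"
    proof
      fix w assume w: "w \<in> sphere 0 1 \<inter> ball (f t) (min 1 e2)"
      have "w / f t - 1 = (w - f t) / f t" using ft by (simp add: field_simps)
      then have "cmod (w / f t - 1) < e2"
        using w ft by (simp add: norm_divide dist_norm norm_minus_commute)
      then have "\<bar>Im (w / f t)\<bar> < e2" using abs_Im_le_cmod[of "w / f t - 1"] by auto
      then have "Im (w / f t) \<in> ball 0 e2" by simp
      then obtain x where x: "x \<in> {-\<delta><..<\<delta>}" "Im (w / f t) = \<phi> x" using e2 by blast
      have "w = f (c x)"
        using x cA near[OF x(1)] \<delta> unit e1(2)[OF cA[OF x(1)]] w unfolding \<phi>_def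
        by (intro eqI) (auto simp: dist_commute)
      then show "w \<in> f ` ?A" using cA[OF x(1)] by blast
    qed
  qed
qed

section \<open>Boundary behaviour of subordination functions\<close>

text \<open>The Schwarz lemma applies to r f for r < 1, which maps into the open disc; then r tends
  to 1.\<close>

lemma Schwarz_Lemma_cball:
  assumes hol: "f holomorphic_on ball 0 1" and "f 0 = 0"
    and le: "\<And>z. cmod z < 1 \<Longrightarrow> cmod (f z) \<le> 1" and z: "cmod z < 1"
  shows "cmod (f z) \<le> cmod z"
proof (rule field_le_mult_one_interval)
  fix r :: real assume r: "0 < r" "r < 1"
  have "cmod (of_real r * f z) \<le> cmod z"
  proof (rule Schwarz_Lemma(1))
    show "(\<lambda>z. of_real r * f z) holomorphic_on ball 0 1"
      by (intro holomorphic_intros hol)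
    show "cmod (of_real r * f w) < 1" if "cmod w < 1" for w
    proof -
      have "r * cmod (f w) \<le> r * 1" using r le[OF that] by (intro mult_left_mono) auto
      then have "cmod (of_real r * f w) \<le> r" using r by (simp add: norm_mult)
      then show ?thesis using r by linarith
    qed
  qed (use assms in auto)
  then show "r * cmod (f z) \<le> cmod z" using r by (simp add: norm_mult)
qed

text \<open>The integrands differ by (z - w) s / ((1 - z s) (1 - w s)), and 2 a b \<le> a^2 + b^2
  bounds the product by the average of the two Poisson kernels.\<close>

lemma (in circle_measure) psiT_lipschitz_poisson:
  assumes z: "z \<in> cauchy_dom \<nu>" and w: "w \<in> cauchy_dom \<nu>"
    and Kz: "(\<integral>s. 1 / (cmod (1 - z * s))\<^sup>2 \<partial>\<nu>) \<le> K" and Kw: "(\<integral>s. 1 / (cmod (1 - w * s))\<^sup>2 \<partial>\<nu>) \<le> K"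
  shows "cmod (psiT \<nu> z - psiT \<nu> w) \<le> K * cmod (z - w)"
proof -
  obtain d where d: "d > 0" "AE s in \<nu>. d \<le> cmod (1 - z * s)"
    using z by (auto simp: cauchy_dom_def)
  obtain d' where d': "d' > 0" "AE s in \<nu>. d' \<le> cmod (1 - w * s)"
    using w by (auto simp: cauchy_dom_def)
  have i: "integrable \<nu> (\<lambda>s. 1 / (1 - z * s))" "integrable \<nu> (\<lambda>s. 1 / (1 - w * s))"
    using integrable_cauchy[OF z, of 0 1] integrable_cauchy[OF w, of 0 1] by simp_all
  note ip = integrable_poisson[OF z] integrable_poisson[OF w]
  let ?h = "\<lambda>s. cmod (z - w) / 2 * (1 / (cmod (1 - z * s))\<^sup>2 + 1 / (cmod (1 - w * s))\<^sup>2)"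
  have "psiT \<nu> z - psiT \<nu> w = (\<integral>s. 1 / (1 - z * s) - 1 / (1 - w * s) \<partial>\<nu>)"
    using i by (simp add: psiT_eq(1)[OF z] psiT_eq(1)[OF w] cauchy_int_def)
  also have "cmod \<dots> \<le> (\<integral>s. cmod (1 / (1 - z * s) - 1 / (1 - w * s)) \<partial>\<nu>)"
    by (rule integral_norm_bound)
  also have "\<dots> \<le> (\<integral>s. ?h s \<partial>\<nu>)"
  proof (rule integral_mono_AE)
    show "AE s in \<nu>. cmod (1 / (1 - z * s) - 1 / (1 - w * s)) \<le> ?h s"
      using d(2) d'(2) AE_unit
    proof eventually_elim
      case (elim s)
      have nz: "1 - z * s \<noteq> 0" "1 - w * s \<noteq> 0" using elim d(1) d'(1) by auto
      then have "1 / (1 - z * s) - 1 / (1 - w * s) = (z - w) * s * (1 / (1 - z * s)) * (1 / (1 - w * s))"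
        by (simp add: divide_simps) (simp add: algebra_simps)
      then have "cmod (1 / (1 - z * s) - 1 / (1 - w * s))
          = cmod (z - w) * (1 / cmod (1 - z * s) * (1 / cmod (1 - w * s)))"
        using elim by (simp add: norm_mult norm_divide)
      also have "\<dots> \<le> cmod (z - w) * (((1 / cmod (1 - z * s))\<^sup>2 + (1 / cmod (1 - w * s))\<^sup>2) / 2)"
        using sum_squares_bound[of "1 / cmod (1 - z * s)" "1 / cmod (1 - w * s)"]
        by (intro mult_left_mono) auto
      finally show ?case by (simp add: power_divide)
    qed
    show "integrable \<nu> ?h"
      using ip by (intro integrable_mult_right Bochner_Integration.integrable_add) auto
    show "integrable \<nu> (\<lambda>s. cmod (1 / (1 - z * s) - 1 / (1 - w * s)))"
      using i by (intro integrable_norm Bochner_Integration.integrable_diff) auto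
  qed
  also have "\<dots> = cmod (z - w) / 2 * ((\<integral>s. 1 / (cmod (1 - z * s))\<^sup>2 \<partial>\<nu>) + (\<integral>s. 1 / (cmod (1 - w * s))\<^sup>2 \<partial>\<nu>))"
    unfolding integral_mult_right_zero Bochner_Integration.integral_add[OF ip] by (rule refl)
  also have "\<dots> \<le> cmod (z - w) / 2 * (K + K)"
    using Kz Kw by (intro mult_left_mono add_mono) auto
  finally show ?thesis by (simp add: mult.commute)
qed

lemma (in circle_measure) deriv_psiT_circle_nonzero:
  assumes "t \<in> CT \<nu>"
  shows "deriv (psiT \<nu>) t \<noteq> 0"
proof
  assume "deriv (psiT \<nu>) t = 0"
  then have "1 / 4 + (Im (psiT \<nu> t))\<^sup>2 + VT \<nu> t = 0"
    using VT_circle(3)[OF assms] by (metis mult_zero_right neg_equal_0_iff_equal of_real_eq_0_iff)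
  moreover have "1 / 4 + (Im (psiT \<nu> t))\<^sup>2 + VT \<nu> t > 0"
    using VT_circle(1)[OF assms] by (simp add: add_pos_nonneg)
  ultimately show False by simp
qed

text \<open>The offset 2 keeps the radii in [1/2, 1), so a nonzero boundary point is approached
  through nonzero points of the open disc.\<close>

lemma radial_tendsto:
  fixes z :: complex
  assumes r_def: "r = (\<lambda>n. 1 - 1 / (real n + 2))"
  shows "(\<lambda>n. of_real (r n) * z) \<longlonglongrightarrow> z" and "cmod z \<le> 1 \<Longrightarrow> cmod (of_real (r n) * z) < 1"
proof -
  have "(\<lambda>n. of_real (r n) * z) \<longlonglongrightarrow> of_real 1 * z"
    unfolding r_def by (intro tendsto_intros) real_asymp
  then show "(\<lambda>n. of_real (r n) * z) \<longlonglongrightarrow> z" by simp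
  have r: "0 < r n" "r n < 1" by (auto simp: r_def field_simps)
  assume "cmod z \<le> 1"
  then have "r n * cmod z \<le> r n" using r by (intro mult_left_le) auto
  then have "cmod (of_real (r n) * z) \<le> r n" using r by (simp add: norm_mult)
  then show "cmod (of_real (r n) * z) < 1" using r by linarith
qed

text \<open>By the Schwarz lemma the Poisson integral of \<open>\<nu>\<close> at \<open>\<omega> z\<close> is dominated by the Poisson integral
  of \<open>\<mu>\<close> at \<open>z\<close>. Hence it is bounded near \<open>\<omega> t\<close>, and \<open>\<psi>\<^sub>\<mu> = \<psi>\<^sub>\<nu> \<circ> \<omega>\<close> is Lipschitz in \<open>\<omega> z\<close>; since
  \<open>\<psi>\<^sub>\<mu>\<close> is injective near \<open>t\<close>, so is \<open>\<omega>\<close>, and its image is a neighbourhood of \<open>\<omega> t\<close> in the circle.\<close>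

lemma subordination_CT:
  assumes "circle_measure \<mu>" "circle_measure \<nu>"
    and cont: "continuous_on (cball 0 1) \<omega>" and hol: "\<omega> holomorphic_on ball 0 1"
    and \<omega>0: "\<omega> 0 = 0" and le1: "\<And>z. cmod z \<le> 1 \<Longrightarrow> cmod (\<omega> z) \<le> 1"
    and sub: "\<And>z. cmod z < 1 \<Longrightarrow> psiT \<nu> (\<omega> z) = psiT \<mu> z"
    and t: "t \<in> CT \<mu>" and unit: "\<And>z. z \<in> CT \<mu> \<Longrightarrow> cmod (\<omega> z) = 1"
  shows "\<omega> t \<in> CT \<nu>" and "psiT \<nu> (\<omega> t) = psiT \<mu> t"
proof -
  interpret \<mu>: circle_measure \<mu> by fact
  interpret \<nu>: circle_measure \<nu> by fact
  define r where "r = (\<lambda>n. 1 - 1 / (real n + 2))"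
  note rad = radial_tendsto[OF r_def]
  have t': "cmod t = 1" "t \<in> cauchy_dom \<mu>" using t by (auto simp: \<mu>.CT_eq)
  obtain d where d: "d > 0" "AE s in \<mu>. d \<le> cmod (1 - t * s)"
    using t' by (auto simp: cauchy_dom_def)
  \<comment> \<open>Within d/2 of t the denominator |1 - z s| is still at least d/2.\<close>
  define K where "K = 4 / d\<^sup>2"
  have near_dom: "z \<in> cauchy_dom \<mu>" if "dist z t < d / 2" for z
    using \<mu>.AE_cauchy_dom_near[OF d(2,1) that] d(1) unfolding cauchy_dom_def
    by (auto intro!: exI[of _ "d / 2"])
  have P\<mu>: "(\<integral>s. 1 / (cmod (1 - z * s))\<^sup>2 \<partial>\<mu>) \<le> K" if "dist z t < d / 2" for z
  proof (rule \<mu>.integral_le_const[OF \<mu>.integrable_poisson[OF near_dom[OF that]]])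
    show "AE s in \<mu>. 1 / (cmod (1 - z * s))\<^sup>2 \<le> K"
      using \<mu>.AE_cauchy_dom_near[OF d(2,1) that]
    proof eventually_elim
      case (elim s)
      have "1 / (cmod (1 - z * s))\<^sup>2 \<le> 1 / (d / 2)\<^sup>2"
        using elim d(1) by (intro divide_left_mono power_mono) (auto intro!: mult_pos_pos)
      then show ?case by (simp add: K_def power_divide)
    qed
  qed
  have schw: "cmod (\<omega> z) \<le> cmod z" if "cmod z < 1" for z
    using Schwarz_Lemma_cball[OF hol \<omega>0 _ that] le1 by simp
  have \<omega>dom: "\<omega> z \<in> cauchy_dom \<nu>" if "cmod z < 1" for z
    using schw[OF that] that \<nu>.ball_subset_cauchy_dom by (intro subsetD[OF \<nu>.ball_subset_cauchy_dom]) auto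
  have P\<nu>: "(\<integral>s. 1 / (cmod (1 - \<omega> z * s))\<^sup>2 \<partial>\<nu>) \<le> K" if z: "cmod z < 1" "dist z t < d / 2" for z
  proof -
    let ?P = "\<integral>s. 1 / (cmod (1 - \<omega> z * s))\<^sup>2 \<partial>\<nu>"
    have pos: "0 < 1 - (cmod (\<omega> z))\<^sup>2"
      using schw[OF z(1)] z(1) by (simp add: power_less_one_iff abs_square_less_1)
    \<comment> \<open>Both sides equal 1 + 2 Re \<psi> at the common value; |\<omega> z| \<le> |z|
      then allows division by the larger factor 1 - |\<omega> z|^2.\<close>
    have "(1 - (cmod (\<omega> z))\<^sup>2) * ?P = (1 - (cmod z)\<^sup>2) * (\<integral>s. 1 / (cmod (1 - z * s))\<^sup>2 \<partial>\<mu>)"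
      using \<nu>.Re_psiT[OF \<omega>dom[OF z(1)]] \<mu>.Re_psiT[OF near_dom[OF z(2)]] sub[OF z(1)] by simp
    also have "\<dots> \<le> (1 - (cmod (\<omega> z))\<^sup>2) * K"
    proof (rule mult_mono[OF _ P\<mu>[OF z(2)]])
      show "1 - (cmod z)\<^sup>2 \<le> 1 - (cmod (\<omega> z))\<^sup>2" using schw[OF z(1)] by (simp add: power_mono)
      show "0 \<le> (\<integral>s. 1 / (cmod (1 - z * s))\<^sup>2 \<partial>\<mu>)" by (rule integral_nonneg_AE) auto
    qed (use pos in auto)
    finally show ?thesis using pos by simp
  qed
  \<comment> \<open>The estimate holds inside the disc and passes to circle points radially. It
    involves only \<psi> of \<mu> and \<omega>, both continuous there, before
    \<open>\<omega> t\<close> is known to lie in the domain for \<nu>.\<close>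
  have lip: "cmod (psiT \<mu> z - psiT \<mu> w) \<le> K * cmod (\<omega> z - \<omega> w)"
    if z: "cmod z \<le> 1" "dist z t < d / 2" and w: "cmod w \<le> 1" "dist w t < d / 2" for z w
  proof (rule tendsto_le)
    have psi: "(\<lambda>n. psiT \<mu> (of_real (r n) * z)) \<longlonglongrightarrow> psiT \<mu> z" if "dist z t < d / 2" for z
      using \<mu>.continuous_on_psiT near_dom[OF that] rad(1)
      by (intro isCont_tendsto_compose[of z "psiT \<mu>"]) (auto simp: continuous_on_eq_continuous_at \<mu>.open_cauchy_dom)
    have om: "(\<lambda>n. \<omega> (of_real (r n) * z)) \<longlonglongrightarrow> \<omega> z" if "cmod z \<le> 1" for z
      using rad[of z] that by (intro continuous_on_tendsto_compose[OF cont]) (auto intro!: always_eventually less_imp_le)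
    show "(\<lambda>n. cmod (psiT \<mu> (of_real (r n) * z) - psiT \<mu> (of_real (r n) * w))) \<longlonglongrightarrow> cmod (psiT \<mu> z - psiT \<mu> w)"
      using psi z w by (intro tendsto_intros) auto
    show "(\<lambda>n. K * cmod (\<omega> (of_real (r n) * z) - \<omega> (of_real (r n) * w))) \<longlonglongrightarrow> K * cmod (\<omega> z - \<omega> w)"
      using om z w by (intro tendsto_intros) auto
    have ev: "\<forall>\<^sub>F n in sequentially. dist (of_real (r n) * z) t < d / 2" if "dist z t < d / 2" for z
      by (rule order_tendstoD(2)[OF tendsto_dist[OF rad(1) tendsto_const] that])
    show "\<forall>\<^sub>F n in sequentially. cmod (psiT \<mu> (of_real (r n) * z) - psiT \<mu> (of_real (r n) * w))
         \<le> K * cmod (\<omega> (of_real (r n) * z) - \<omega> (of_real (r n) * w))"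
      using ev[OF z(2)] ev[OF w(2)]
    proof eventually_elim
      case (elim n)
      have "cmod (of_real (r n) * z) < 1" "cmod (of_real (r n) * w) < 1" using rad(2) z w by auto
      then show ?case
        using \<nu>.psiT_lipschitz_poisson[OF \<omega>dom \<omega>dom P\<nu> P\<nu>, of "of_real (r n) * z" "of_real (r n) * w"] elim sub
        by simp
    qed
  qed auto
  obtain \<rho> where \<rho>: "\<rho> > 0" "inj_on (psiT \<mu>) (ball t \<rho>)"
    using has_complex_derivative_locally_injective[OF \<mu>.holomorphic_psiT t'(2) \<mu>.open_cauchy_dom \<mu>.deriv_psiT_circle_nonzero[OF t]]
    by blast
  define e where "e = min \<rho> (d / 2)"
  have e: "e > 0" "e \<le> \<rho>" "e \<le> d / 2" using \<rho> d by (auto simp: e_def)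
  let ?A = "sphere 0 1 \<inter> ball t e"
  have A: "cmod z = 1" "dist z t < d / 2" "z \<in> CT \<mu>" if "z \<in> ?A" for z
    using that e near_dom[of z] by (auto simp: dist_commute \<mu>.CT_eq)
  have inj: "inj_on \<omega> ?A"
  proof (rule inj_onI)
    fix z w assume zw: "z \<in> ?A" "w \<in> ?A" "\<omega> z = \<omega> w"
    then have "psiT \<mu> z = psiT \<mu> w" using lip[of z w] A[OF zw(1)] A[OF zw(2)] by simp
    moreover have "z \<in> ball t \<rho>" "w \<in> ball t \<rho>" using zw e by auto
    ultimately show "z = w" using \<rho>(2) by (simp add: inj_on_def)
  qed
  have contA: "continuous_on ?A \<omega>"
    by (rule continuous_on_subset[OF cont]) auto
  obtain e' where e': "e' > 0" "sphere 0 1 \<inter> ball (\<omega> t) e' \<subseteq> \<omega> ` ?A"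
    by (rule circle_arc_image_nhd[OF t'(1) e(1) contA inj unit[OF A(3)]])
  show \<omega>t: "\<omega> t \<in> CT \<nu>"
  proof (rule \<nu>.CT_if_poisson_bounded[OF unit[OF t] e'(1), of K])
    fix t' :: complex and \<epsilon> :: real
    assume "cmod t' = 1" "dist t' (\<omega> t) < e'" and \<epsilon>: "\<epsilon> > 0"
    then have "t' \<in> sphere 0 1 \<inter> ball (\<omega> t) e'" by (simp add: dist_commute)
    then obtain z where z: "z \<in> ?A" "t' = \<omega> z" using e'(2) by blast
    have "(\<lambda>n. \<omega> (of_real (r n) * z)) \<longlonglongrightarrow> \<omega> z"
      using rad[of z] A[OF z(1)] by (intro continuous_on_tendsto_compose[OF cont]) (auto intro!: always_eventually less_imp_le)
    then have "\<forall>\<^sub>F n in sequentially. dist (\<omega> (of_real (r n) * z)) (\<omega> z) < \<epsilon>"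
      using \<epsilon> by (rule tendstoD)
    moreover have "\<forall>\<^sub>F n in sequentially. dist (of_real (r n) * z) t < d / 2"
      by (rule order_tendstoD(2)[OF tendsto_dist[OF rad(1) tendsto_const] A(2)[OF z(1)]])
    ultimately have "\<forall>\<^sub>F n in sequentially. dist (\<omega> (of_real (r n) * z)) (\<omega> z) < \<epsilon> \<and> dist (of_real (r n) * z) t < d / 2"
      by eventually_elim auto
    then obtain n where n: "dist (\<omega> (of_real (r n) * z)) (\<omega> z) < \<epsilon>" "dist (of_real (r n) * z) t < d / 2"
      unfolding eventually_sequentially by blast
    have "cmod (of_real (r n) * z) < 1" using rad(2) A[OF z(1)] by simp
    then show "\<exists>z\<in>cauchy_dom \<nu>. dist z t' < \<epsilon> \<and> (\<integral>s. 1 / (cmod (1 - z * s))\<^sup>2 \<partial>\<nu>) \<le> K"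
      using n \<omega>dom P\<nu> z(2) by blast
  qed
  show "psiT \<nu> (\<omega> t) = psiT \<mu> t"
  proof (rule LIMSEQ_unique)
    show "(\<lambda>n. psiT \<mu> (of_real (r n) * t)) \<longlonglongrightarrow> psiT \<mu> t"
      using \<mu>.continuous_on_psiT t'(2) rad(1)
      by (intro isCont_tendsto_compose[of t "psiT \<mu>"]) (auto simp: continuous_on_eq_continuous_at \<mu>.open_cauchy_dom)
    have "(\<lambda>n. \<omega> (of_real (r n) * t)) \<longlonglongrightarrow> \<omega> t"
      using rad[of t] t'(1) by (intro continuous_on_tendsto_compose[OF cont]) (auto intro!: always_eventually less_imp_le)
    then have "(\<lambda>n. psiT \<nu> (\<omega> (of_real (r n) * t))) \<longlonglongrightarrow> psiT \<nu> (\<omega> t)"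
      using \<nu>.continuous_on_psiT \<omega>t
      by (intro isCont_tendsto_compose[of "\<omega> t" "psiT \<nu>"]) (auto simp: continuous_on_eq_continuous_at \<nu>.open_cauchy_dom \<nu>.CT_eq)
    moreover have "psiT \<nu> (\<omega> (of_real (r n) * t)) = psiT \<mu> (of_real (r n) * t)" for n
      using sub rad(2)[of t n] t'(1) by simp
    ultimately show "(\<lambda>n. psiT \<mu> (of_real (r n) * t)) \<longlonglongrightarrow> psiT \<nu> (\<omega> t)" by simp
  qed
qed

section \<open>Local coordinates on the circle\<close>

lemma holomorphic_local_inverse:
  assumes "f holomorphic_on S" "open S" "a \<in> S" "deriv f a \<noteq> 0"
  obtains g \<rho> \<delta> where "g holomorphic_on ball (f a) \<delta>" "ball a \<rho> \<subseteq> S" "\<rho> > 0" "\<delta> > 0"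
    "\<And>u. u \<in> ball (f a) \<delta> \<Longrightarrow> g u \<in> ball a \<rho> \<and> f (g u) = u"
    "\<And>z. z \<in> ball a \<rho> \<Longrightarrow> g (f z) = z" "deriv g (f a) = 1 / deriv f a"
proof -
  obtain \<rho> where \<rho>: "\<rho> > 0" "ball a \<rho> \<subseteq> S" "inj_on f (ball a \<rho>)"
    using has_complex_derivative_locally_injective[OF assms(1,3,2,4)] by blast
  have hol: "f holomorphic_on ball a \<rho>" using assms(1) \<rho>(2) holomorphic_on_subset by blast
  obtain g where g: "g holomorphic_on f ` ball a \<rho>"
    "\<And>z. z \<in> ball a \<rho> \<Longrightarrow> deriv f z * deriv g (f z) = 1" "\<And>z. z \<in> ball a \<rho> \<Longrightarrow> g (f z) = z"
    by (rule holomorphic_has_inverse[OF hol open_ball \<rho>(3)]) (rule that)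
  have "open (f ` ball a \<rho>)" by (rule open_mapping_thm3[OF hol open_ball \<rho>(3)])
  moreover have "f a \<in> f ` ball a \<rho>" using \<rho>(1) by simp
  ultimately obtain \<delta> where \<delta>: "\<delta> > 0" "ball (f a) \<delta> \<subseteq> f ` ball a \<rho>"
    by (meson open_contains_ball)
  show thesis
  proof (rule that[OF _ \<rho>(2,1) \<delta>(1)])
    show "g holomorphic_on ball (f a) \<delta>" using g(1) \<delta>(2) holomorphic_on_subset by blast
    show "g u \<in> ball a \<rho> \<and> f (g u) = u" if "u \<in> ball (f a) \<delta>" for u
      using that \<delta>(2) g(3) by (metis imageE subsetD)
    show "deriv g (f a) = 1 / deriv f a" using g(2)[of a] \<rho>(1) assms(4) by (simp add: field_simps)
  qed (rule g(3))
qed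


text \<open>\<open>f\<close> is a local inverse of \<psi> at \<open>t\<close>;
  \<open>\<delta>\<close> is a radius for its arguments and \<open>\<eta>\<close> one around
  \<open>t\<close>, unrelated to \<open>etaT\<close>. The clause \<open>reflect\<close> carries
  reflection in the circle over to reflection in the line Re u = -1/2, where the boundary values of
  \<psi> lie.\<close>

locale psiT_inverse = circle_measure +
  fixes t :: complex and f :: "complex \<Rightarrow> complex" and \<delta> \<eta> :: real
  assumes t_CT: "t \<in> CT \<nu>"
    and pos: "\<delta> > 0" "\<eta> > 0"
    and holomorphic: "f holomorphic_on ball (psiT \<nu> t) \<delta>"
    and right_inverse: "\<And>u. u \<in> ball (psiT \<nu> t) \<delta> \<Longrightarrow> f u \<in> cauchy_dom \<nu> \<and> f u \<noteq> 0 \<and> psiT \<nu> (f u) = u"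
    and left_inverse: "\<And>z. dist z t < \<eta> \<Longrightarrow> f (psiT \<nu> z) = z"
    and reflect: "\<And>u. u \<in> ball (psiT \<nu> t) \<delta> \<Longrightarrow> f (- 1 - cnj u) = inverse (cnj (f u))"
    and deriv_eq: "deriv f (psiT \<nu> t) = - t / of_real (1 / 4 + (Im (psiT \<nu> t))\<^sup>2 + VT \<nu> t)"
begin

lemma f_psiT [simp]: "f (psiT \<nu> t) = t"
  using left_inverse pos by simp

lemma norm_t [simp]: "cmod t = 1" and t_nonzero [simp]: "t \<noteq> 0"
  using t_CT by (auto simp: CT_eq)

end

lemma (in circle_measure) psiT_inverse_exists:
  assumes t: "t \<in> CT \<nu>"
  shows "\<exists>f \<delta> \<eta>. psiT_inverse \<nu> t f \<delta> \<eta>"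
proof -
  have t': "cmod t = 1" "t \<in> cauchy_dom \<nu>" using t by (auto simp: CT_eq)
  let ?u = "psiT \<nu> t"
  obtain f \<rho> \<delta> where f: "f holomorphic_on ball ?u \<delta>" "ball t \<rho> \<subseteq> cauchy_dom \<nu>" "\<rho> > 0" "\<delta> > 0"
    "\<And>u. u \<in> ball ?u \<delta> \<Longrightarrow> f u \<in> ball t \<rho> \<and> psiT \<nu> (f u) = u"
    "\<And>z. z \<in> ball t \<rho> \<Longrightarrow> f (psiT \<nu> z) = z" "deriv f ?u = 1 / deriv (psiT \<nu>) t"
    by (rule holomorphic_local_inverse[OF holomorphic_psiT open_cauchy_dom t'(2) deriv_psiT_circle_nonzero[OF t]])
      (rule that)
  have fu: "f ?u = t" using f(3,6) by simp
  have cont: "isCont f ?u"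
    using holomorphic_on_imp_continuous_on[OF f(1)] f(4) by (simp add: continuous_on_eq_continuous_at)
  have tt: "inverse (cnj t) = t"
  proof -
    have "t * cnj t = 1" using t'(1) by (simp add: complex_norm_square[symmetric])
    then show ?thesis by (metis inverse_unique mult.commute)
  qed
  have lim: "((\<lambda>u. inverse (cnj (f u))) \<longlongrightarrow> t) (nhds ?u)" "(f \<longlongrightarrow> t) (nhds ?u)"
  proof -
    show *: "(f \<longlongrightarrow> t) (nhds ?u)"
      using cont[unfolded isCont_def tendsto_at_iff_tendsto_nhds] unfolding fu .
    have "((\<lambda>u. inverse (cnj (f u))) \<longlongrightarrow> inverse (cnj t)) (nhds ?u)"
      using t'(1) by (intro tendsto_inverse tendsto_cnj *) auto
    then show "((\<lambda>u. inverse (cnj (f u))) \<longlongrightarrow> t) (nhds ?u)" unfolding tt .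
  qed
  have "t \<noteq> 0" using t'(1) by auto
  \<comment> \<open>Close to \<open>?u\<close> the reflected point stays in the ball on which
    \<open>f\<close> inverts \<psi> from the left, so the symmetry of \<psi> passes to
    \<open>f\<close>.\<close>
  have "\<forall>\<^sub>F u in nhds ?u. dist (inverse (cnj (f u))) t < \<rho> \<and> f u \<noteq> 0"
    using tendstoD[OF lim(1) f(3)] tendsto_imp_eventually_ne[OF lim(2) \<open>t \<noteq> 0\<close>] by eventually_elim auto
  then obtain \<delta>' where \<delta>': "\<delta>' > 0" "\<And>u. dist u ?u < \<delta>' \<Longrightarrow> dist (inverse (cnj (f u))) t < \<rho> \<and> f u \<noteq> 0"
    unfolding eventually_nhds_metric by blast
  have "psiT_inverse \<nu> t f (min \<delta> \<delta>') \<rho>"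
  proof
    show "min \<delta> \<delta>' > 0" using f(4) \<delta>'(1) by simp
    show "f holomorphic_on ball ?u (min \<delta> \<delta>')" by (rule holomorphic_on_subset[OF f(1)]) auto
    fix u assume u: "u \<in> ball ?u (min \<delta> \<delta>')"
    then have u1: "u \<in> ball ?u \<delta>" and u2: "dist u ?u < \<delta>'" by (auto simp: dist_commute)
    show *: "f u \<in> cauchy_dom \<nu> \<and> f u \<noteq> 0 \<and> psiT \<nu> (f u) = u"
      using f(2) f(5)[OF u1] \<delta>'(2)[OF u2] by blast
    have "inverse (cnj (f u)) \<in> ball t \<rho>" using \<delta>'(2)[OF u2] by (simp add: dist_commute)
    then have "f (psiT \<nu> (inverse (cnj (f u)))) = inverse (cnj (f u))" by (rule f(6))
    then show "f (- 1 - cnj u) = inverse (cnj (f u))" using psiT_reflect(2)[of "f u"] * by simp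
  next
    show "f (psiT \<nu> z) = z" if "dist z t < \<rho>" for z using f(6)[of z] that by (simp add: dist_commute)
    have "1 / deriv (psiT \<nu>) t = t / (t * deriv (psiT \<nu>) t)" using \<open>t \<noteq> 0\<close> by simp
    then show "deriv f ?u = - t / of_real (1 / 4 + (Im ?u)\<^sup>2 + VT \<nu> t)"
      unfolding f(7) VT_circle(3)[OF t] by (metis minus_divide_left minus_divide_right)
  qed (use t f(3) in auto)
  then show ?thesis by blast
qed

text \<open>Near a pair \<open>(t1, t2)\<close> with \<open>\<psi>\<^sub>1 t1 = \<psi>\<^sub>2 t2\<close>, the common value \<open>u\<close> of \<open>\<psi>\<^sub>1\<close> and \<open>\<psi>\<^sub>2\<close> serves as
  coordinate. The relation \<open>\<eta> = \<omega>1 \<omega>2 / z\<close> then reads \<open>z = kmap u\<close>.\<close>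

locale psiT_inverse_pair =
  \<mu>1: psiT_inverse \<mu>1 t1 f1 \<delta>1 \<eta>1 + \<mu>2: psiT_inverse \<mu>2 t2 f2 \<delta>2 \<eta>2
  for \<mu>1 t1 f1 \<delta>1 \<eta>1 \<mu>2 t2 f2 \<delta>2 \<eta>2 +
  assumes psi_eq: "psiT \<mu>1 t1 = psiT \<mu>2 t2"
begin

definition u0 where "u0 = psiT \<mu>1 t1"
text \<open>As Re u0 = -1/2, the radius 1/2 keeps the ball away from the zeros of u and 1 +
  u.\<close>

definition \<delta> where "\<delta> = min (1 / 2) (min \<delta>1 \<delta>2)"
definition kmap where "kmap u = f1 u * f2 u * (1 + u) / u"
text \<open>Equal to -u0 (1 + u0), because Re u0 = -1/2.\<close>

definition M where "M = 1 / 4 + (Im u0)\<^sup>2"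
definition V1 where "V1 = VT \<mu>1 t1"
definition V2 where "V2 = VT \<mu>2 t2"
text \<open>The sum 1/M - 1/(M + V1) - 1/(M + V2) over a common denominator.\<close>

definition logderiv where "logderiv = (V1 * V2 - M\<^sup>2) / (M * (M + V1) * (M + V2))"

lemma V_nonneg: "V1 \<ge> 0" "V2 \<ge> 0"
  using \<mu>1.VT_circle(1)[OF \<mu>1.t_CT] \<mu>2.VT_circle(1)[OF \<mu>2.t_CT] by (auto simp: V1_def V2_def)

lemma M_pos: "M > 0"
  unfolding M_def by (simp add: add_pos_nonneg)

lemma M_eq: "M = cmod (u0 * (u0 + 1))"
  using \<mu>1.VT_circle(2)[OF \<mu>1.t_CT] by (simp add: M_def u0_def)

lemma psiT_u0: "psiT \<mu>1 t1 = u0" "psiT \<mu>2 t2 = u0"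
  using psi_eq by (auto simp: u0_def)

lemma Re_u0: "Re u0 = - 1 / 2"
  using \<mu>1.Re_psiT_circle[OF \<mu>1.t_CT] by (simp add: u0_def)

lemma \<delta>_pos: "\<delta> > 0"
  using \<mu>1.pos \<mu>2.pos by (simp add: \<delta>_def)

lemma u0_in_ball [simp]: "u0 \<in> ball u0 \<delta>"
  using \<delta>_pos by simp

lemma f_u0 [simp]: "f1 u0 = t1" "f2 u0 = t2"
  using \<mu>1.f_psiT \<mu>2.f_psiT psiT_u0 by simp_all

lemma
  assumes "u \<in> ball u0 \<delta>"
  shows f1_right_inverse: "f1 u \<in> cauchy_dom \<mu>1 \<and> f1 u \<noteq> 0 \<and> psiT \<mu>1 (f1 u) = u"
    and f2_right_inverse: "f2 u \<in> cauchy_dom \<mu>2 \<and> f2 u \<noteq> 0 \<and> psiT \<mu>2 (f2 u) = u"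
    and f_reflect: "f1 (- 1 - cnj u) = inverse (cnj (f1 u))" "f2 (- 1 - cnj u) = inverse (cnj (f2 u))"
  using assms \<mu>1.right_inverse[of u] \<mu>2.right_inverse[of u] \<mu>1.reflect[of u] \<mu>2.reflect[of u]
  by (auto simp: psiT_u0 \<delta>_def)

lemma holomorphic_f: "f1 holomorphic_on ball u0 \<delta>" "f2 holomorphic_on ball u0 \<delta>"
  using \<mu>1.holomorphic \<mu>2.holomorphic unfolding psiT_u0
  by (auto elim!: holomorphic_on_subset simp: \<delta>_def)

lemma ball_u0_nonzero:
  assumes "u \<in> ball u0 \<delta>"
  shows "u \<noteq> 0" "1 + u \<noteq> 0"
proof -
  have "\<bar>Re (u0 - u)\<bar> < 1 / 2"
    using abs_Re_le_cmod[of "u0 - u"] assms by (simp add: dist_norm \<delta>_def)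
  then have "Re u < 0" "Re u > - 1" using Re_u0 unfolding minus_complex.simps by linarith+
  then show "u \<noteq> 0" "1 + u \<noteq> 0" by (auto simp: complex_eq_iff)
qed

lemma holomorphic_kmap: "kmap holomorphic_on ball u0 \<delta>"
  unfolding kmap_def using holomorphic_f ball_u0_nonzero by (intro holomorphic_intros) auto

lemma cnj_u0: "cnj u0 = - 1 - u0"
  using Re_u0 by (simp add: complex_eq_iff)

lemma norm_kmap_u0: "cmod (kmap u0) = 1"
proof -
  have "1 + u0 = - cnj u0" using cnj_u0 by simp
  then have "cmod (1 + u0) = cmod u0" by (metis complex_mod_cnj norm_minus_cancel)
  then show ?thesis
    unfolding kmap_def using ball_u0_nonzero[OF u0_in_ball] by (simp add: norm_mult norm_divide)
qed

text \<open>The factors \<open>f1\<close>, \<open>f2\<close> and (1 + u) / u each turn u \<mapsto>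
  -1 - cnj u into reflection in the circle, and so does their product.\<close>

lemma kmap_reflect:
  assumes "u \<in> ball u0 \<delta>"
  shows "kmap (- 1 - cnj u) = inverse (cnj (kmap u))"
proof -
  have nz: "cnj u \<noteq> 0" "1 + cnj u \<noteq> 0"
    using ball_u0_nonzero[OF assms] by (auto simp flip: complex_cnj_zero_iff[of "1 + u"])
  have "(1 + (- 1 - cnj u)) / (- 1 - cnj u) = inverse ((1 + cnj u) / cnj u)"
  proof -
    have "- 1 - cnj u = - (1 + cnj u)" by simp
    then have "(1 + (- 1 - cnj u)) / (- 1 - cnj u) = (- cnj u) / (- (1 + cnj u))" by simp
    also have "\<dots> = cnj u / (1 + cnj u)" by (rule minus_divide_divide)
    finally show ?thesis by simp
  qed
  then show ?thesis
    unfolding kmap_def f_reflect[OF assms] times_divide_eq_right[symmetric] by (simp add: divide_inverse ac_simps)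
qed

lemma deriv_f: "deriv f1 u0 = - t1 / of_real (M + V1)" "deriv f2 u0 = - t2 / of_real (M + V2)"
  using \<mu>1.deriv_eq \<mu>2.deriv_eq unfolding psiT_u0 M_def V1_def V2_def by simp_all

text \<open>Logarithmic derivatives add: \<open>f1\<close> and \<open>f2\<close> contribute -1/(M +
  V1) and -1/(M + V2), and (1 + u) / u contributes -1 / (u0 (1 + u0)) = 1/M.\<close>

lemma deriv_kmap: "deriv kmap u0 = kmap u0 * of_real logderiv"
proof (rule DERIV_imp_deriv)
  have d1: "(f1 has_field_derivative - t1 / of_real (M + V1)) (at u0)"
    using holomorphic_derivI[OF holomorphic_f(1) open_ball u0_in_ball] deriv_f by simp
  have d2: "(f2 has_field_derivative - t2 / of_real (M + V2)) (at u0)"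
    using holomorphic_derivI[OF holomorphic_f(2) open_ball u0_in_ball] deriv_f by simp
  note nz = ball_u0_nonzero[OF u0_in_ball]
  have Mu: "u0 * (1 + u0) = - of_real M"
  proof -
    have "u0 * (1 + u0) = - (u0 * cnj u0)" unfolding cnj_u0 by (simp add: algebra_simps)
    also have "u0 * cnj u0 = of_real ((Re u0)\<^sup>2 + (Im u0)\<^sup>2)" by (rule complex_mult_cnj)
    also have "\<dots> = of_real M" unfolding M_def Re_u0 by (simp add: power2_eq_square)
    finally show ?thesis .
  qed
  have q: "((\<lambda>u. (1 + u) / u) has_field_derivative (1 + u0) / u0 * (1 / of_real M)) (at u0)"
  proof -
    have "1 / of_real M = - 1 / (u0 * (1 + u0))" unfolding Mu by simp
    then have "(1 + u0) / u0 * (1 / of_real M) = (1 + u0) / u0 * (- 1 / (u0 * (1 + u0)))" by simp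
    also have "\<dots> = - 1 / (u0 * u0)" using nz by (simp add: divide_simps)
    finally have "- 1 / (u0 * u0) = (1 + u0) / u0 * (1 / of_real M)" by simp
    moreover have "((\<lambda>u. (1 + u) / u) has_field_derivative - 1 / (u0 * u0)) (at u0)"
      using nz by (auto intro!: derivative_eq_intros simp: field_simps)
    ultimately show ?thesis by simp
  qed
  have "((\<lambda>u. f1 u * f2 u * ((1 + u) / u)) has_field_derivative
      (- t1 / of_real (M + V1) * f2 u0 + - t2 / of_real (M + V2) * f1 u0) * ((1 + u0) / u0) +
      (1 + u0) / u0 * (1 / of_real M) * (f1 u0 * f2 u0)) (at u0)"
    by (rule DERIV_mult[OF DERIV_mult[OF d1 d2] q])
  moreover have "(- t1 / of_real (M + V1) * f2 u0 + - t2 / of_real (M + V2) * f1 u0) * ((1 + u0) / u0) +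
      (1 + u0) / u0 * (1 / of_real M) * (f1 u0 * f2 u0) = kmap u0 * of_real logderiv"
  proof -
    have "(- t1 / of_real (M + V1) * f2 u0 + - t2 / of_real (M + V2) * f1 u0) * ((1 + u0) / u0) +
      (1 + u0) / u0 * (1 / of_real M) * (f1 u0 * f2 u0) =
      t1 * t2 * ((1 + u0) / u0) * (1 / of_real M - 1 / of_real (M + V1) - 1 / of_real (M + V2))"
      unfolding f_u0 divide_inverse by (simp add: algebra_simps del: of_real_add)
    also have "1 / of_real M - 1 / of_real (M + V1) - 1 / of_real (M + V2)
        = (of_real (1 / M - 1 / (M + V1) - 1 / (M + V2)) :: complex)" by simp
    also have "1 / M - 1 / (M + V1) - 1 / (M + V2) = logderiv"
    proof -
      have nn: "M \<noteq> 0" "M + V1 \<noteq> 0" "M + V2 \<noteq> 0" using M_pos V_nonneg by auto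
      then have "1 / M - 1 / (M + V1) - 1 / (M + V2)
        = ((M + V1) * (M + V2) - M * (M + V2) - M * (M + V1)) / (M * (M + V1) * (M + V2))"
        by (simp add: diff_divide_distrib)
      then show ?thesis by (simp add: logderiv_def algebra_simps power2_eq_square)
    qed
    finally show ?thesis by (simp add: kmap_def)
  qed
  ultimately show "(kmap has_field_derivative kmap u0 * of_real logderiv) (at u0)"
    unfolding kmap_def[abs_def] by simp
qed

lemma logderiv_neg_iff: "logderiv < 0 \<longleftrightarrow> V1 * V2 < M\<^sup>2"
proof -
  have "M * (M + V1) * (M + V2) > 0" using M_pos V_nonneg by (simp add: add_pos_nonneg)
  then show ?thesis unfolding logderiv_def by (simp add: divide_less_0_iff)
qed

end

section \<open>The coordinate at a given pair, and the variance inequality for boundary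
  values\<close>

lemma psiT_inverse_pair_exists:
  assumes "circle_measure \<mu>1" "circle_measure \<mu>2" "t1 \<in> CT \<mu>1" "t2 \<in> CT \<mu>2" "psiT \<mu>1 t1 = psiT \<mu>2 t2"
  obtains f1 \<delta>1 \<eta>1 f2 \<delta>2 \<eta>2 where "psiT_inverse_pair \<mu>1 t1 f1 \<delta>1 \<eta>1 \<mu>2 t2 f2 \<delta>2 \<eta>2"
  using circle_measure.psiT_inverse_exists[OF assms(1,3)] circle_measure.psiT_inverse_exists[OF assms(2,4)] assms(5)
  unfolding psiT_inverse_pair_def psiT_inverse_pair_axioms_def by blast

text \<open>The composition of \<open>kmap\<close> with \<psi> of \<mu> fixes the radial points
  close to t, so its derivative at t is 1. This derivative is \<open>logderiv\<close> times t
  \<psi>'(t) = -(M + V) < 0, with V the variance of \<mu> at t, which forces \<open>logderiv\<close>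
  < 0.\<close>

lemma subordination_variance_less:
  fixes \<mu>1 \<mu>2 \<mu> :: "complex measure"
  assumes "circle_measure \<mu>1" "circle_measure \<mu>2" "circle_measure \<mu>"
    and t: "t \<in> CT \<mu>" and t1: "\<omega>1 t \<in> CT \<mu>1" and t2: "\<omega>2 t \<in> CT \<mu>2"
    and u0: "psiT \<mu>1 (\<omega>1 t) = psiT \<mu> t" "psiT \<mu>2 (\<omega>2 t) = psiT \<mu> t"
    and cont: "continuous_on (cball 0 1) \<omega>1" "continuous_on (cball 0 1) \<omega>2"
    and sub: "\<And>z. cmod z < 1 \<Longrightarrow> psiT \<mu>1 (\<omega>1 z) = psiT \<mu> z" "\<And>z. cmod z < 1 \<Longrightarrow> psiT \<mu>2 (\<omega>2 z) = psiT \<mu> z"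
    and eta: "\<And>z. cmod z < 1 \<Longrightarrow> etaT \<mu> z = \<omega>1 z * \<omega>2 z / z"
  shows "VT \<mu>1 (\<omega>1 t) * VT \<mu>2 (\<omega>2 t) < (cmod (psiT \<mu> t * (psiT \<mu> t + 1)))\<^sup>2"
proof -
  interpret \<mu>1: circle_measure \<mu>1 by fact
  interpret \<mu>2: circle_measure \<mu>2 by fact
  interpret \<mu>: circle_measure \<mu> by fact
  have t': "cmod t = 1" "t \<in> cauchy_dom \<mu>" "t \<noteq> 0" using t by (auto simp: \<mu>.CT_eq)
  obtain f1 \<delta>1 \<eta>1 f2 \<delta>2 \<eta>2 where "psiT_inverse_pair \<mu>1 (\<omega>1 t) f1 \<delta>1 \<eta>1 \<mu>2 (\<omega>2 t) f2 \<delta>2 \<eta>2"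
    using psiT_inverse_pair_exists[OF assms(1,2) t1 t2] u0 by metis
  then interpret P: psiT_inverse_pair \<mu>1 "\<omega>1 t" f1 \<delta>1 \<eta>1 \<mu>2 "\<omega>2 t" f2 \<delta>2 \<eta>2 .
  have u: "psiT \<mu> t = P.u0" using u0 by (simp add: P.u0_def)
  define r where "r = (\<lambda>n. 1 - 1 / (real n + 2))"
  note rad = radial_tendsto[OF r_def, of t]
  define x where "x = (\<lambda>n. of_real (r n) * t)"
  have x: "x \<longlonglongrightarrow> t" "cmod (x n) < 1" "x n \<noteq> t" "x n \<noteq> 0" for n
  proof -
    show "x \<longlonglongrightarrow> t" using rad(1) by (simp add: x_def)
    show lt: "cmod (x n) < 1" using rad(2) t' by (simp add: x_def)
    then show "x n \<noteq> t" using t' by auto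
    have "r n > 0" by (simp add: r_def field_simps)
    then show "x n \<noteq> 0" using t' by (simp add: x_def)
  qed
  have om: "(\<lambda>n. \<omega>1 (x n)) \<longlonglongrightarrow> \<omega>1 t" "(\<lambda>n. \<omega>2 (x n)) \<longlonglongrightarrow> \<omega>2 t"
    using x t' by (auto intro!: continuous_on_tendsto_compose[OF cont(1)] continuous_on_tendsto_compose[OF cont(2)] always_eventually less_imp_le)
  define G where "G = (\<lambda>z. P.kmap (psiT \<mu> z))"
  have dG: "(G has_field_derivative deriv P.kmap P.u0 * deriv (psiT \<mu>) t) (at t)"
    unfolding G_def
  proof (rule DERIV_chain2[of P.kmap _ "psiT \<mu>"])
    show "(P.kmap has_field_derivative deriv P.kmap P.u0) (at (psiT \<mu> t))"
      using holomorphic_derivI[OF P.holomorphic_kmap open_ball P.u0_in_ball] by (simp add: u)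
    show "(psiT \<mu> has_field_derivative deriv (psiT \<mu>) t) (at t)"
      by (rule holomorphic_derivI[OF \<mu>.holomorphic_psiT \<mu>.open_cauchy_dom t'(2)])
  qed
  have Gx: "\<forall>\<^sub>F n in sequentially. G (x n) = x n"
  proof -
    have "\<forall>\<^sub>F n in sequentially. dist (\<omega>1 (x n)) (\<omega>1 t) < \<eta>1" "\<forall>\<^sub>F n in sequentially. dist (\<omega>2 (x n)) (\<omega>2 t) < \<eta>2"
      using tendstoD[OF om(1) P.\<mu>1.pos(2)] tendstoD[OF om(2) P.\<mu>2.pos(2)] by auto
    moreover have "\<omega>1 t \<noteq> 0" "\<omega>2 t \<noteq> 0" using t1 t2 by (auto simp: \<mu>1.CT_eq \<mu>2.CT_eq)
    then have "\<forall>\<^sub>F n in sequentially. \<omega>1 (x n) \<noteq> 0" "\<forall>\<^sub>F n in sequentially. \<omega>2 (x n) \<noteq> 0"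
      using om by (auto intro!: tendsto_imp_eventually_ne)
    ultimately show ?thesis
    proof eventually_elim
      case (elim n)
      define w where "w = psiT \<mu> (x n)"
      have "f1 w = \<omega>1 (x n)" "f2 w = \<omega>2 (x n)"
        using P.\<mu>1.left_inverse[OF elim(1)] P.\<mu>2.left_inverse[OF elim(2)] sub x(2)[of n] by (auto simp: w_def)
      then have "P.kmap w = \<omega>1 (x n) * \<omega>2 (x n) * (1 + w) / w" by (simp add: P.kmap_def)
      also have "\<omega>1 (x n) * \<omega>2 (x n) = x n * (w / (1 + w))"
        using eta[OF x(2)[of n]] x(4)[of n] unfolding etaT_def w_def by (simp add: field_simps)
      also have "w \<noteq> 0 \<and> 1 + w \<noteq> 0"
      proof -
        \<comment> \<open>Division by zero gives 0, so a nonzero quotient rules out both w = 0 and 1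
          + w = 0.\<close>
        have "w / (1 + w) \<noteq> 0"
          using eta[OF x(2)[of n]] x(4)[of n] elim unfolding etaT_def w_def by auto
        then show ?thesis by auto
      qed
      then have "x n * (w / (1 + w)) * (1 + w) / w = x n" by simp
      finally show ?case by (simp add: G_def w_def)
    qed
  qed
  have Gt: "G t = t"
  proof (rule LIMSEQ_unique)
    show "(\<lambda>n. G (x n)) \<longlonglongrightarrow> G t"
      using DERIV_isCont[OF dG] x(1) by (rule isCont_tendsto_compose)
    show "(\<lambda>n. G (x n)) \<longlonglongrightarrow> t"
      by (rule Lim_transform_eventually[OF x(1)]) (use Gx in \<open>auto elim: eventually_mono\<close>)
  qed
  have "deriv P.kmap P.u0 * deriv (psiT \<mu>) t = 1"
  proof (rule LIMSEQ_unique)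
    have "((\<lambda>y. (G y - G t) / (y - t)) \<longlongrightarrow> deriv P.kmap P.u0 * deriv (psiT \<mu>) t) (at t)"
      using dG by (simp add: has_field_derivative_iff)
    moreover have "filterlim x (at t) sequentially"
      using x by (auto simp: filterlim_at)
    ultimately show "(\<lambda>n. (G (x n) - G t) / (x n - t)) \<longlonglongrightarrow> deriv P.kmap P.u0 * deriv (psiT \<mu>) t"
      by (rule filterlim_compose)
    show "(\<lambda>n. (G (x n) - G t) / (x n - t)) \<longlonglongrightarrow> 1"
    proof (rule tendsto_eventually)
      show "\<forall>\<^sub>F n in sequentially. (G (x n) - G t) / (x n - t) = 1"
        using Gx by eventually_elim (use x(3) Gt in auto)
    qed
  qed
  then have "of_real P.logderiv * (t * deriv (psiT \<mu>) t) = 1"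
    using P.deriv_kmap Gt by (simp add: G_def u ac_simps)
  then have "of_real (P.logderiv * - (P.M + VT \<mu> t)) = (of_real 1 :: complex)"
    unfolding \<mu>.VT_circle(3)[OF t] by (simp add: P.M_def u)
  then have c1: "P.logderiv * - (P.M + VT \<mu> t) = 1" by (simp only: of_real_eq_iff)
  have "P.M + VT \<mu> t > 0" using P.M_pos \<mu>.VT_circle(1)[OF t] by simp
  then have "P.logderiv < 0" using c1 by (smt (verit) mult_nonneg_nonneg minus_mult_right)
  then show ?thesis using P.logderiv_neg_iff P.M_eq by (simp add: P.V1_def P.V2_def u)
qed

section \<open>Uniqueness and boundary values of the solution\<close>

text \<open>The quotient \<eta>(w) / w with its removable singularity filled in:
  \<open>cauchy_int\<close> of index 1 replaces \<psi>(w) / w, and the value at 0 is the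
  mean.\<close>

definition hT :: "complex measure \<Rightarrow> complex \<Rightarrow> complex" where
  "hT \<nu> w = cauchy_int \<nu> 1 w / (1 + psiT \<nu> w)"

context circle_measure
begin

lemma one_plus_psiT_nonzero:
  assumes "cmod z < 1"
  shows "1 + psiT \<nu> z \<noteq> 0"
proof
  assume "1 + psiT \<nu> z = 0"
  then have "Re (1 + psiT \<nu> z) = 0" by simp
  then show False using Re_psiT_gt[of z] assms by simp
qed

lemma etaT_eq_hT:
  assumes "cmod z < 1"
  shows "etaT \<nu> z = z * hT \<nu> z"
  using psiT_eq(2)[of z] assms ball_subset_cauchy_dom by (auto simp: etaT_def hT_def)

lemma holomorphic_psiT_ball: "psiT \<nu> holomorphic_on ball 0 1"
  by (rule holomorphic_on_subset[OF holomorphic_psiT ball_subset_cauchy_dom])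

lemma holomorphic_hT: "hT \<nu> holomorphic_on ball 0 1"
  unfolding hT_def using one_plus_psiT_nonzero
  by (intro holomorphic_intros holomorphic_psiT_ball holomorphic_on_subset[OF holomorphic_cauchy_int ball_subset_cauchy_dom]) auto

text \<open>Re \<psi> > -1/2 says that \<psi> is closer to 0 than to -1.\<close>

lemma norm_etaT_less_1:
  assumes "cmod z < 1"
  shows "cmod (etaT \<nu> z) < 1"
proof -
  have "(cmod (psiT \<nu> z))\<^sup>2 < (cmod (1 + psiT \<nu> z))\<^sup>2"
    unfolding cmod_power2 using Re_psiT_gt[of z] assms by (simp add: power2_eq_square algebra_simps)
  then have "cmod (psiT \<nu> z) < cmod (1 + psiT \<nu> z)"
    by (rule power_less_imp_less_base) simp
  then show ?thesis
    using one_plus_psiT_nonzero[OF assms] by (simp add: etaT_def norm_divide)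
qed

lemma hT_0: "hT \<nu> 0 = mom \<nu> 1"
  by (simp add: hT_def cauchy_int_def mom_def)

lemma norm_hT_le_1:
  assumes "cmod z < 1"
  shows "cmod (hT \<nu> z) \<le> 1"
proof (cases "z = 0")
  case False
  have "etaT \<nu> holomorphic_on ball 0 1"
    unfolding etaT_def using one_plus_psiT_nonzero
    by (intro holomorphic_intros holomorphic_psiT_ball) auto
  then have "cmod (etaT \<nu> z) \<le> cmod z"
    by (rule Schwarz_Lemma(1)) (use norm_etaT_less_1 assms in \<open>auto simp: etaT_def\<close>)
  then show ?thesis using False by (simp add: etaT_eq_hT[OF assms] norm_mult)
next
  case True
  have "cmod (\<integral>s. s \<partial>\<nu>) \<le> 1"
  proof (rule norm_integral_le_const)
    show "integrable \<nu> (\<lambda>s. s)"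
      using integrable_cauchy[of 0 1 0] subsetD[OF ball_subset_cauchy_dom, of 0] by simp
    show "AE s in \<nu>. cmod s \<le> 1" using AE_unit by eventually_elim auto
  qed
  then show ?thesis unfolding True by (simp add: hT_0 mom_def)
qed

end

text \<open>An automorphism of the disc moves a to 0. A second fixed point is then an equality case
  of the Schwarz lemma, so \<Phi> would be the identity, against the bound \<rho> < 1.\<close>

lemma unique_fixed_point_disc:
  assumes hol: "\<Phi> holomorphic_on ball 0 1" and r: "\<rho> < 1"
    and le: "\<And>w. cmod w < 1 \<Longrightarrow> cmod (\<Phi> w) \<le> \<rho>"
    and a: "cmod a < 1" "\<Phi> a = a" and b: "cmod b < 1" "\<Phi> b = b"
  shows "a = b"
proof (rule ccontr)
  assume ab: "a \<noteq> b"
  obtain F G where FG: "F a = 0" "F holomorphic_on ball 0 1" "F ` ball 0 1 \<subseteq> ball 0 1"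
    "G holomorphic_on ball 0 1" "G ` ball 0 1 \<subseteq> ball 0 1"
    "\<And>z. z \<in> ball 0 1 \<Longrightarrow> F (G z) = z" "\<And>z. z \<in> ball 0 1 \<Longrightarrow> G (F z) = z"
    using ball_biholomorphism_exists[of a] a(1) by (metis mem_ball_0)
  have G0: "G 0 = a" using FG(1) FG(7)[of a] a(1) by simp
  have in_ball: "\<Phi> w \<in> ball 0 1" if "w \<in> ball 0 1" for w using le[of w] that r by simp
  define H where "H = (\<lambda>z. F (\<Phi> (G z)))"
  have Hhol: "H holomorphic_on ball 0 1"
  proof -
    have "(\<Phi> \<circ> G) holomorphic_on ball 0 1"
      by (rule holomorphic_on_compose_gen[OF FG(4) hol FG(5)])
    moreover have "(\<Phi> \<circ> G) ` ball 0 1 \<subseteq> ball 0 1" using FG(5) in_ball by auto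
    ultimately have "(F \<circ> (\<Phi> \<circ> G)) holomorphic_on ball 0 1"
      by (rule holomorphic_on_compose_gen[OF _ FG(2)])
    then show ?thesis by (simp add: H_def comp_def)
  qed
  have H0: "H 0 = 0" by (simp add: H_def G0 a FG(1))
  have H1: "cmod (H z) < 1" if "cmod z < 1" for z
  proof -
    have "H z \<in> ball 0 1" unfolding H_def using that FG(3,5) in_ball by (meson image_subset_iff mem_ball_0)
    then show ?thesis by simp
  qed
  define c where "c = F b"
  have "b \<in> ball 0 1" using b(1) by simp
  then have "F b \<in> ball 0 1" "G (F b) = b" using FG(3,7) by blast+
  then have c: "cmod c < 1" "G c = b" by (auto simp: c_def)
  have c0: "c \<noteq> 0" using c(2) G0 ab by auto
  have Hc: "H c = c" by (simp add: H_def c(2) b(2)) (simp add: c_def)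
  obtain \<alpha> where \<alpha>: "\<And>z. cmod z < 1 \<Longrightarrow> H z = \<alpha> * z"
    using Schwarz_Lemma(3)[OF Hhol H0 H1 a(1)] c Hc c0 by metis
  have "\<alpha> = 1" using \<alpha>[OF c(1)] Hc c0 by simp
  then have id: "\<Phi> w = w" if "cmod w < 1" for w
  proof -
    have "w \<in> ball 0 1" using that by simp
    then have "F w \<in> ball 0 1" using FG(3) by blast
    then have Fw: "cmod (F w) < 1" by simp
    then have "F (\<Phi> w) = F w" using \<alpha>[OF Fw] \<open>\<alpha> = 1\<close> FG(7)[of w] that by (simp add: H_def)
    then show ?thesis using FG(7) that in_ball by (metis mem_ball_0)
  qed
  \<comment> \<open>A point of the disc with modulus above \<rho>, which the identity would
    fix.\<close>
  define s where "s = (1 + max \<rho> 0) / 2"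
  have "0 \<le> s" "s < 1" "\<rho> < s" using r by (auto simp: s_def max_def)
  then show False using id[of "of_real s"] le[of "of_real s"] by simp
qed

text \<open>To first order F(r t) = F(t) (1 - a (1 - r)), so the modulus drops at rate a > 0 along
  the inward radius; close to t the error consumes at most half of the drop.\<close>

lemma radial_norm_less_1:
  fixes F :: "complex \<Rightarrow> complex"
  assumes der: "(F has_field_derivative F t / t * of_real a) (at t)" and a: "a > 0"
    and t: "cmod t = 1" "cmod (F t) = 1"
  shows "\<exists>d>0. \<forall>r. 1 - d < r \<and> r < 1 \<longrightarrow> cmod (F (of_real r * t)) < 1"
proof -
  have t0: "t \<noteq> 0" using t by auto
  obtain d where d: "d > 0"
    "\<And>y. cmod (y - t) < d \<Longrightarrow> cmod (F y - F t - F t / t * of_real a * (y - t)) \<le> a / 2 * cmod (y - t)"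
    using der a unfolding has_field_derivative_def has_derivative_at_alt by (metis half_gt_zero)
  show ?thesis
  \<comment> \<open>The bound 1/a keeps 1 - a (1 - r) nonnegative, hence equal to its
    modulus.\<close>
  proof (intro exI[of _ "min d (1 / a)"] conjI allI impI)
    show "min d (1 / a) > 0" using d a by simp
    fix r assume r: "1 - min d (1 / a) < r \<and> r < 1"
    have "1 - r \<le> 1 / a" using r by linarith
    then have ar: "a * (1 - r) \<le> 1" using a by (simp add: field_simps)
    have eq: "of_real r * t - t = of_real (r - 1) * t" by (simp add: algebra_simps)
    have n: "cmod (of_real r * t - t) = 1 - r"
      unfolding eq using r t by (simp add: norm_mult del: of_real_diff)
    have "cmod (of_real r * t - t) < d" using n r by auto
    from d(2)[OF this]
    have "cmod (F (of_real r * t) - F t - F t / t * of_real a * (of_real r * t - t)) \<le> a / 2 * (1 - r)"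
      unfolding n .
    moreover have "F t / t * of_real a * (of_real r * t - t) = F t * of_real (a * (r - 1))"
      unfolding eq using t0 by simp
    moreover have "F (of_real r * t) - F t - F t * of_real (a * (r - 1)) = F (of_real r * t) - F t * of_real (1 - a * (1 - r))"
      by (simp add: algebra_simps)
    ultimately have "cmod (F (of_real r * t) - F t * of_real (1 - a * (1 - r))) \<le> a / 2 * (1 - r)"
      by (simp only:)
    then have "cmod (F (of_real r * t)) \<le> cmod (F t * of_real (1 - a * (1 - r))) + a / 2 * (1 - r)"
      using norm_triangle_sub[of "F (of_real r * t)" "F t * of_real (1 - a * (1 - r))"] by linarith
    also have "cmod (F t * of_real (1 - a * (1 - r))) = 1 - a * (1 - r)"
      using ar t by (simp only: norm_mult norm_of_real) simp
    also have "1 - a * (1 - r) + a / 2 * (1 - r) = 1 - a / 2 * (1 - r)" by (simp add: field_simps)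
    also have "\<dots> < 1" using a r by simp
    finally show "cmod (F (of_real r * t)) < 1" .
  qed
qed

lemma radial_near:
  assumes "cmod t = 1" "r < 1" "1 - d < r"
  shows "of_real r * t \<in> ball t d"
proof -
  have "t - of_real r * t = of_real (1 - r) * t" by (simp add: algebra_simps)
  then have "dist t (of_real r * t) = \<bar>1 - r\<bar>"
    using assms by (simp only: dist_norm norm_mult norm_of_real) simp
  then show ?thesis using assms by simp
qed

text \<open>The first component is a fixed point of w \<mapsto> z h2 (z h1 w), where hj is
  \<open>hT\<close> of the j-th measure; this map sends the disc into the closed disc of radius |z|
  < 1.\<close>

lemma subordination_solution_unique:
  assumes "circle_measure \<mu>1" "circle_measure \<mu>2" and z: "cmod z < 1"
    and a: "cmod a1 < 1" "cmod a2 < 1" "a2 = z * hT \<mu>1 a1" "a1 = z * hT \<mu>2 a2"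
    and b: "cmod b1 < 1" "cmod b2 < 1" "b2 = z * hT \<mu>1 b1" "b1 = z * hT \<mu>2 b2"
  shows "a1 = b1" "a2 = b2"
proof -
  interpret \<mu>1: circle_measure \<mu>1 by fact
  interpret \<mu>2: circle_measure \<mu>2 by fact
  have le: "cmod (z * hT \<mu>1 w) \<le> cmod z" "cmod (z * hT \<mu>2 w) \<le> cmod z" if "cmod w < 1" for w
    using mult_left_mono[OF \<mu>1.norm_hT_le_1[OF that], of "cmod z"] mult_left_mono[OF \<mu>2.norm_hT_le_1[OF that], of "cmod z"]
    by (auto simp: norm_mult)
  have hol: "(\<lambda>w. z * hT \<mu>1 w) holomorphic_on ball 0 1" "(\<lambda>w. z * hT \<mu>2 w) holomorphic_on ball 0 1"
    by (intro holomorphic_intros \<mu>1.holomorphic_hT \<mu>2.holomorphic_hT)+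
  show "a1 = b1"
  proof (rule unique_fixed_point_disc[of "\<lambda>w. z * hT \<mu>2 (z * hT \<mu>1 w)", OF _ z])
    have "((\<lambda>w. z * hT \<mu>2 w) \<circ> (\<lambda>w. z * hT \<mu>1 w)) holomorphic_on ball 0 1"
      by (rule holomorphic_on_compose_gen[OF hol]) (use le_less_trans[OF le(1) z] in auto)
    then show "(\<lambda>w. z * hT \<mu>2 (z * hT \<mu>1 w)) holomorphic_on ball 0 1" by (simp add: comp_def)
    show "cmod (z * hT \<mu>2 (z * hT \<mu>1 w)) \<le> cmod z" if "cmod w < 1" for w
      by (rule le(2)) (use le(1)[OF that] z in linarith)
    show "z * hT \<mu>2 (z * hT \<mu>1 a1) = a1" "z * hT \<mu>2 (z * hT \<mu>1 b1) = b1"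
      unfolding a(3)[symmetric] a(4)[symmetric] b(3)[symmetric] b(4)[symmetric] by (rule refl)+
  qed (fact a(1) b(1))+
  then show "a2 = b2" unfolding a(3) b(3) by simp
qed

section \<open>The fixed point system in the local coordinate\<close>

context psiT_inverse_pair
begin

lemma kmap_fixed_point:
  assumes u: "u \<in> ball u0 \<delta>" and lt: "cmod (f1 u) < 1" "cmod (f2 u) < 1"
  shows "f2 u = kmap u * hT \<mu>1 (f1 u)" "f1 u = kmap u * hT \<mu>2 (f2 u)"
proof -
  note nz = ball_u0_nonzero[OF u]
  have e1: "f1 u * hT \<mu>1 (f1 u) = u / (1 + u)"
    using \<mu>1.etaT_eq_hT[OF lt(1)] f1_right_inverse[OF u] by (simp add: etaT_def)
  have e2: "f2 u * hT \<mu>2 (f2 u) = u / (1 + u)"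
    using \<mu>2.etaT_eq_hT[OF lt(2)] f2_right_inverse[OF u] by (simp add: etaT_def)
  have "kmap u * hT \<mu>1 (f1 u) = f2 u * ((1 + u) / u) * (f1 u * hT \<mu>1 (f1 u))"
    by (simp add: kmap_def)
  then show "f2 u = kmap u * hT \<mu>1 (f1 u)" unfolding e1 using nz by simp
  have "kmap u * hT \<mu>2 (f2 u) = f1 u * ((1 + u) / u) * (f2 u * hT \<mu>2 (f2 u))"
    by (simp add: kmap_def)
  then show "f1 u = kmap u * hT \<mu>2 (f2 u)" unfolding e2 using nz by simp
qed

text \<open>Besides the local inverse \<open>P\<close> it records two facts for later limits: circle
  points go to the line Re u = -1/2, and on the radial segment given by \<open>d\<close> the pair
  (f1 (P z), f2 (P z)) lies in the open bidisc.\<close>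

definition kmap_inverse where
  "kmap_inverse P e d \<longleftrightarrow> e > 0 \<and> P holomorphic_on ball (kmap u0) e \<and> P (kmap u0) = u0 \<and>
    (\<forall>z\<in>ball (kmap u0) e. P z \<in> ball u0 \<delta> \<and> kmap (P z) = z \<and> (cmod z = 1 \<longrightarrow> Re (P z) = - 1 / 2)) \<and>
    0 < d \<and> d \<le> e \<and>
    (\<forall>r. 1 - d < r \<and> r < 1 \<longrightarrow> cmod (f1 (P (of_real r * kmap u0))) < 1 \<and> cmod (f2 (P (of_real r * kmap u0))) < 1)"

lemma kmap_inverse_exists:
  assumes "V1 * V2 < M\<^sup>2"
  shows "\<exists>P e d. kmap_inverse P e d"
proof -
  let ?t = "kmap u0"
  have t0: "?t \<noteq> 0" using norm_kmap_u0 by auto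
  have c: "logderiv < 0" using assms logderiv_neg_iff by simp
  have dk: "deriv kmap u0 \<noteq> 0" using c t0 by (simp add: deriv_kmap)
  obtain P \<rho> e where P: "P holomorphic_on ball ?t e" "ball u0 \<rho> \<subseteq> ball u0 \<delta>" "\<rho> > 0" "e > 0"
    "\<And>z. z \<in> ball ?t e \<Longrightarrow> P z \<in> ball u0 \<rho> \<and> kmap (P z) = z"
    "\<And>u. u \<in> ball u0 \<rho> \<Longrightarrow> P (kmap u) = u" "deriv P ?t = 1 / deriv kmap u0"
    by (rule holomorphic_local_inverse[OF holomorphic_kmap open_ball u0_in_ball dk]) (rule that)
  have Pt: "P ?t = u0" using P(3,6) by simp
  \<comment> \<open>A circle point is its own mirror image, so by \<open>kmap_reflect\<close> and
    injectivity its preimage is fixed by u \<mapsto> -1 - cnj u.\<close>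
  have PRe: "Re (P z) = - 1 / 2" if z: "z \<in> ball ?t e" "cmod z = 1" for z
  proof -
    define u where "u = P z"
    have u: "u \<in> ball u0 \<rho>" "kmap u = z" using P(5)[OF z(1)] by (auto simp: u_def)
    have "u0 - (- 1 - cnj u) = - cnj (u0 - u)" by (simp add: cnj_u0)
    then have "cmod (u0 - (- 1 - cnj u)) = cmod (u0 - u)" by (metis complex_mod_cnj norm_minus_cancel)
    then have "- 1 - cnj u \<in> ball u0 \<rho>" using u(1) by (simp add: dist_norm del: complex_cnj_diff)
    then have "P (kmap (- 1 - cnj u)) = - 1 - cnj u" by (rule P(6))
    also have "kmap (- 1 - cnj u) = inverse (cnj z)" using kmap_reflect[of u] u P(2) by auto
    also have "inverse (cnj z) = z"
    proof -
      have "z * cnj z = 1" using z(2) by (simp add: complex_norm_square[symmetric])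
      then show ?thesis by (metis inverse_unique mult.commute)
    qed
    finally have "u = - 1 - cnj u" by (simp add: u_def)
    then have "Re u = - 1 - Re u" by (metis complex_cnj(1) minus_complex.simps(1) one_complex.simps(1) uminus_complex.simps(1) complex.sel(1) cnj.simps(1))
    then show ?thesis by (simp add: u_def)
  qed
  have dP: "(P has_field_derivative 1 / (?t * of_real logderiv)) (at ?t)"
    using holomorphic_derivI[OF P(1) open_ball, of ?t] P(4,7) by (simp add: deriv_kmap)
  \<comment> \<open>The rate for f composed with \<open>P\<close> is -1 / ((M + V)
    \<open>logderiv\<close>); the sign of \<open>logderiv\<close> makes it positive, so inward
    radial motion enters the disc.\<close>
  have *: "\<exists>d>0. \<forall>r. 1 - d < r \<and> r < 1 \<longrightarrow> cmod (f (P (of_real r * ?t))) < 1"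
    if f: "f holomorphic_on ball u0 \<delta>" "deriv f u0 = - s / of_real (M + V)" "f u0 = s" "cmod s = 1" "V \<ge> 0" for f s V
  proof (rule radial_norm_less_1[of "\<lambda>z. f (P z)"])
    have "(f has_field_derivative - s / of_real (M + V)) (at (P ?t))"
      using holomorphic_derivI[OF f(1) open_ball u0_in_ball] f(2) Pt by simp
    from DERIV_chain2[OF this dP]
    have "((\<lambda>z. f (P z)) has_field_derivative - s / of_real (M + V) * (1 / (?t * of_real logderiv))) (at ?t)" .
    moreover have "- s / of_real (M + V) * (1 / (?t * of_real logderiv)) = f (P ?t) / ?t * of_real (- 1 / ((M + V) * logderiv))"
      using Pt f(3) by simp
    ultimately show "((\<lambda>z. f (P z)) has_field_derivative f (P ?t) / ?t * of_real (- 1 / ((M + V) * logderiv))) (at ?t)"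
      by simp
    show "- 1 / ((M + V) * logderiv) > 0"
      using c M_pos f(5) by (simp add: zero_less_divide_iff divide_less_0_iff mult_less_0_iff)
  qed (use norm_kmap_u0 f Pt in auto)
  obtain d1 where d1: "d1 > 0" "\<forall>r. 1 - d1 < r \<and> r < 1 \<longrightarrow> cmod (f1 (P (of_real r * ?t))) < 1"
    using *[OF holomorphic_f(1) deriv_f(1)] V_nonneg by auto
  obtain d2 where d2: "d2 > 0" "\<forall>r. 1 - d2 < r \<and> r < 1 \<longrightarrow> cmod (f2 (P (of_real r * ?t))) < 1"
    using *[OF holomorphic_f(2) deriv_f(2)] V_nonneg by auto
  have "kmap_inverse P e (min e (min d1 d2))"
    unfolding kmap_inverse_def
  proof (intro conjI ballI allI impI)
    fix z assume z: "z \<in> ball ?t e"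
    show "P z \<in> ball u0 \<delta>" "kmap (P z) = z" using P(2) P(5)[OF z] by blast+
    show "Re (P z) = - 1 / 2" if "cmod z = 1" using PRe[OF z that] .
  qed (use P(1,4) Pt d1 d2 in auto)
  then show ?thesis by blast
qed

text \<open>With both means zero, (0, 0) would solve the system for every z. By uniqueness it would
  be the local solution, but \<open>f1\<close> has no zeros in the ball.\<close>

lemma not_both_mean_zero:
  assumes "V1 * V2 < M\<^sup>2"
  shows "hT \<mu>1 0 \<noteq> 0 \<or> hT \<mu>2 0 \<noteq> 0"
proof (rule ccontr)
  assume "\<not> ?thesis"
  then have h0: "hT \<mu>1 0 = 0" "hT \<mu>2 0 = 0" by blast+
  let ?t = "kmap u0"
  obtain P e d where "kmap_inverse P e d"
    using kmap_inverse_exists[OF assms] by blast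
  then have P: "e > 0" "\<forall>z\<in>ball ?t e. P z \<in> ball u0 \<delta> \<and> kmap (P z) = z" "0 < d" "d \<le> e"
    "\<forall>r. 1 - d < r \<and> r < 1 \<longrightarrow> cmod (f1 (P (of_real r * ?t))) < 1 \<and> cmod (f2 (P (of_real r * ?t))) < 1"
    unfolding kmap_inverse_def by simp_all
  define r where "r = 1 - min d 1 / 2"
  have r: "1 - d < r" "r < 1" "r > 0" using P(3) by (auto simp: r_def min_def)
  define z where "z = of_real r * ?t"
  have z: "z \<in> ball ?t e" unfolding z_def using radial_near[OF norm_kmap_u0 r(2)] r P(4) by simp
  define u where "u = P z"
  have u: "u \<in> ball u0 \<delta>" "kmap u = z" using P(2) z by (auto simp: u_def)
  have lt: "cmod (f1 u) < 1" "cmod (f2 u) < 1" using P(5) r by (auto simp: u_def z_def)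
  have cz: "cmod z < 1" using r norm_kmap_u0 by (simp add: z_def norm_mult)
  have "f1 u = 0"
    by (rule subordination_solution_unique(1)[OF \<mu>1.circle_measure_axioms \<mu>2.circle_measure_axioms cz lt, of 0 0])
      (use kmap_fixed_point[OF u(1) lt] u(2) h0 in auto)
  then show False using f1_right_inverse[OF u(1)] by simp
qed

end

text \<open>g vanishes on the nonempty open set where f does not, hence on all of S by the identity
  theorem.\<close>

lemma holomorphic_mult_eq_0:
  assumes hol: "f holomorphic_on S" "g holomorphic_on S" and S: "open S" "connected S"
    and eq: "\<And>z. z \<in> S \<Longrightarrow> f z * g z = 0" and a: "a \<in> S" "f a \<noteq> 0" and z: "z \<in> S"
  shows "g z = 0"
proof -
  have "continuous_on S f" by (rule holomorphic_on_imp_continuous_on[OF hol(1)])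
  then obtain A where "open A" "A \<inter> S = f -` (- {0}) \<inter> S"
    using continuous_on_open_invariant[of S f] by (metis open_Compl closed_singleton)
  then have op: "open (f -` (- {0}) \<inter> S)" using S(1) by (metis open_Int)
  show ?thesis
  proof (rule analytic_continuation_open[OF op S(1) _ S(2) _ hol(2) holomorphic_on_const[of 0]])
    show "f -` (- {0}) \<inter> S \<noteq> {}" using a by auto
    show "g w = 0" if "w \<in> f -` (- {0}) \<inter> S" for w using eq[of w] that by auto
  qed (use z in auto)
qed

lemma holomorphic_lipschitz_cball:
  fixes P :: "complex \<Rightarrow> complex"
  assumes "P holomorphic_on ball t e" "0 < e'" "e' < e"
  shows "\<exists>L. \<forall>z\<in>cball t e'. \<forall>w\<in>cball t e'. cmod (P z - P w) \<le> L * cmod (z - w)"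
proof -
  have sub: "cball t e' \<subseteq> ball t e" using assms by auto
  have "continuous_on (cball t e') (deriv P)"
    using holomorphic_on_imp_continuous_on[OF holomorphic_deriv[OF assms(1) open_ball]] sub continuous_on_subset by blast
  then have "compact (deriv P ` cball t e')" by (rule compact_continuous_image) simp
  then obtain L where L: "\<And>z. z \<in> cball t e' \<Longrightarrow> cmod (deriv P z) \<le> L"
    by (meson bounded_iff compact_imp_bounded imageI)
  have "cmod (P z - P w) \<le> L * cmod (z - w)" if "z \<in> cball t e'" "w \<in> cball t e'" for z w
  proof (rule field_differentiable_bound[of "cball t e'" P "deriv P"])
    show "(P has_field_derivative deriv P x) (at x within cball t e')" if "x \<in> cball t e'" for x
      using holomorphic_derivI[OF assms(1) open_ball, of x] sub that by (auto intro: has_field_derivative_at_within)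
  qed (use L that in auto)
  then show ?thesis by blast
qed

section \<open>Realising a pair in D as boundary values\<close>

context psiT_inverse_pair
begin

text \<open>Uniqueness identifies (\<omega>1 z, \<omega>2 z) with (f1 (P z), f2 (P z)) on a radius,
  and the radial limit gives the two boundary values. On the disc near \<open>kmap u0\<close>,
  \<psi> of \<mu> then equals the holomorphic \<open>P\<close>, whose Lipschitz bound controls the
  Poisson integral of \<mu>.\<close>

lemma subordination_onto:
  assumes "circle_measure \<mu>" and small: "V1 * V2 < M\<^sup>2"
    and cont: "continuous_on (cball 0 1) \<omega>1" "continuous_on (cball 0 1) \<omega>2"
    and lt: "\<And>z. cmod z < 1 \<Longrightarrow> cmod (\<omega>1 z) < 1" "\<And>z. cmod z < 1 \<Longrightarrow> cmod (\<omega>2 z) < 1"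
    and sub: "\<And>z. cmod z < 1 \<Longrightarrow> psiT \<mu>1 (\<omega>1 z) = psiT \<mu> z"
    and sol: "\<And>z. cmod z < 1 \<Longrightarrow> \<omega>2 z = z * hT \<mu>1 (\<omega>1 z)" "\<And>z. cmod z < 1 \<Longrightarrow> \<omega>1 z = z * hT \<mu>2 (\<omega>2 z)"
  shows "kmap u0 \<in> CT \<mu>" "\<omega>1 (kmap u0) = t1" "\<omega>2 (kmap u0) = t2"
proof -
  interpret \<mu>: circle_measure \<mu> by fact
  define t where "t = kmap u0"
  have t: "cmod t = 1" using norm_kmap_u0 by (simp add: t_def)
  obtain P e d where "kmap_inverse P e d"
    using kmap_inverse_exists[OF small] by blast
  then have e: "e > 0" and holP: "P holomorphic_on ball t e" and Pt: "P t = u0"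
    and P: "\<forall>z\<in>ball t e. P z \<in> ball u0 \<delta> \<and> kmap (P z) = z \<and> (cmod z = 1 \<longrightarrow> Re (P z) = - 1 / 2)"
    and d: "0 < d" "d \<le> e"
    and fP: "\<forall>r. 1 - d < r \<and> r < 1 \<longrightarrow> cmod (f1 (P (of_real r * t))) < 1 \<and> cmod (f2 (P (of_real r * t))) < 1"
    unfolding kmap_inverse_def t_def by simp_all
  have rad: "\<omega>1 (of_real r * t) = f1 (P (of_real r * t))" "\<omega>2 (of_real r * t) = f2 (P (of_real r * t))"
    "psiT \<mu> (of_real r * t) = P (of_real r * t)"
    if r: "1 - d < r" "r < 1" "0 < r" for r
  proof -
    define z where "z = of_real r * t"
    have zb: "z \<in> ball t e" unfolding z_def using radial_near[OF t r(2)] r d by simp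
    define u where "u = P z"
    have u: "u \<in> ball u0 \<delta>" "kmap u = z" using P zb by (auto simp: u_def)
    have ltu: "cmod (f1 u) < 1" "cmod (f2 u) < 1" using fP r by (auto simp: u_def z_def)
    have cz: "cmod z < 1" using r t by (simp add: z_def norm_mult)
    note eq = subordination_solution_unique[OF \<mu>1.circle_measure_axioms \<mu>2.circle_measure_axioms cz
        lt(1)[OF cz] lt(2)[OF cz] sol(1)[OF cz] sol(2)[OF cz] ltu]
    show 1: "\<omega>1 (of_real r * t) = f1 (P (of_real r * t))" and "\<omega>2 (of_real r * t) = f2 (P (of_real r * t))"
      using eq kmap_fixed_point[OF u(1) ltu] u(2) by (auto simp: u_def z_def)
    show "psiT \<mu> (of_real r * t) = P (of_real r * t)"
      using sub[OF cz] f1_right_inverse[OF u(1)] 1 by (simp add: u_def z_def)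
  qed
  define q where "q = (\<lambda>n. 1 - 1 / (real n + 2))"
  note qt = radial_tendsto[OF q_def, of t]
  have ev: "\<forall>\<^sub>F n in sequentially. 1 - d < q n \<and> q n < 1 \<and> 0 < q n"
  proof -
    have "q \<longlonglongrightarrow> 1" unfolding q_def by real_asymp
    then have "\<forall>\<^sub>F n in sequentially. 1 - d < q n" by (rule order_tendstoD) (use d in auto)
    moreover have "q n < 1" "0 < q n" for n by (auto simp: q_def field_simps)
    ultimately show ?thesis by simp
  qed
  have lim: "\<omega> t = f u0"
    if "continuous_on (cball 0 1) \<omega>" "f holomorphic_on ball u0 \<delta>"
      "\<And>r. 1 - d < r \<Longrightarrow> r < 1 \<Longrightarrow> 0 < r \<Longrightarrow> \<omega> (of_real r * t) = f (P (of_real r * t))" for \<omega> f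
  proof (rule LIMSEQ_unique)
    show "(\<lambda>n. \<omega> (of_real (q n) * t)) \<longlonglongrightarrow> \<omega> t"
      using qt t by (intro continuous_on_tendsto_compose[OF that(1)]) (auto intro!: always_eventually less_imp_le)
    have "isCont P t" using holomorphic_on_imp_continuous_on[OF holP] e by (simp add: continuous_on_eq_continuous_at)
    then have "(\<lambda>n. P (of_real (q n) * t)) \<longlonglongrightarrow> u0" using isCont_tendsto_compose[OF _ qt(1)] Pt by metis
    moreover have "isCont f u0"
      using holomorphic_on_imp_continuous_on[OF that(2)] \<delta>_pos by (simp add: continuous_on_eq_continuous_at)
    ultimately have "(\<lambda>n. f (P (of_real (q n) * t))) \<longlonglongrightarrow> f u0" by (rule isCont_tendsto_compose[rotated])
    then show "(\<lambda>n. \<omega> (of_real (q n) * t)) \<longlonglongrightarrow> f u0"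
      by (rule Lim_transform_eventually) (use ev that(3) in \<open>auto elim!: eventually_mono\<close>)
  qed
  show "\<omega>1 (kmap u0) = t1" "\<omega>2 (kmap u0) = t2"
    using lim[OF cont(1) holomorphic_f(1) rad(1)] lim[OF cont(2) holomorphic_f(2) rad(2)] by (simp_all add: t_def)
  \<comment> \<open>Agreement on the radial segment spreads by the identity theorem over the
    connected intersection of the two balls.\<close>
  have ident: "psiT \<mu> w = P w" if w: "w \<in> ball t e" "cmod w < 1" for w
  proof -
    let ?B = "ball t e \<inter> ball 0 1"
    define r0 where "r0 = 1 - min d 1 / 2"
    have r0: "1 - d < r0" "r0 < 1" "r0 > 0" using d by (auto simp: r0_def min_def)
    define U where "U = (\<lambda>r. of_real r * t) ` {max 0 (1 - d)<..<1}"
    have "psiT \<mu> w - P w = 0"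
    proof (rule analytic_continuation[where f = "\<lambda>z. psiT \<mu> z - P z" and w = w and S = ?B and U = U and \<xi> = "of_real r0 * t"])
      show "(\<lambda>z. psiT \<mu> z - P z) holomorphic_on ?B"
        by (intro holomorphic_intros holomorphic_on_subset[OF \<mu>.holomorphic_psiT_ball] holomorphic_on_subset[OF holP]) auto
      show "connected ?B" by (intro convex_connected convex_Int convex_ball)
      have inB: "of_real r * t \<in> ?B" if "max 0 (1 - d) < r" "r < 1" for r
        using radial_near[OF t that(2), of e] that d t by (auto simp: norm_mult)
      then show "U \<subseteq> ?B" "of_real r0 * t \<in> ?B" using r0 by (auto simp: U_def)
      show "of_real r0 * t islimpt U"
        unfolding U_def
      proof (rule islimpt_isCont_image)
        show "r0 islimpt {max 0 (1 - d)<..<1}"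
          using r0 by (intro interior_limit_point) auto
        show "isCont (\<lambda>r. complex_of_real r * t) r0" by (intro continuous_intros)
        show "\<forall>\<^sub>F y in at r0. complex_of_real y * t \<noteq> complex_of_real r0 * t"
          using t by (auto simp: eventually_at_filter)
      qed
      show "psiT \<mu> z - P z = 0" if "z \<in> U" for z
        using that rad(3) by (auto simp: U_def)
    qed (use w in auto)
    then show ?thesis by simp
  qed
  have e2: "0 < e / 2" "e / 2 < e" using e by auto
  obtain L where L: "\<forall>z\<in>cball t (e / 2). \<forall>w\<in>cball t (e / 2). cmod (P z - P w) \<le> L * cmod (z - w)"
    using holomorphic_lipschitz_cball[OF holP e2] by blast
  have "t \<in> CT \<mu>"
  proof (rule \<mu>.CT_if_poisson_bounded[OF t, of "e / 4" "2 * L"])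
    show "e / 4 > 0" using e by simp
    fix t' :: complex and \<epsilon> :: real
    assume t': "cmod t' = 1" "dist t' t < e / 4" and \<epsilon>: "\<epsilon> > 0"
    define s where "s = min (1 / 2) (min (\<epsilon> / 2) (e / 8))"
    have s: "0 < s" "s < 1" "s < \<epsilon>" "s < e / 4" using e \<epsilon> by (auto simp: s_def min_def)
    define z where "z = of_real (1 - s) * t'"
    have cz: "cmod z = 1 - s" using s t' by (simp add: z_def norm_mult del: of_real_diff)
    have dz: "dist z t' = s"
    proof -
      have "z - t' = of_real (- s) * t'" by (simp add: z_def algebra_simps)
      then show ?thesis using s t' by (simp add: dist_norm norm_mult)
    qed
    have dzt: "dist z t < e / 2" using dist_triangle[of z t t'] dz s t' by simp
    have zdom: "z \<in> cauchy_dom \<mu>" using \<mu>.ball_subset_cauchy_dom cz s by (intro subsetD[OF \<mu>.ball_subset_cauchy_dom]) simp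
    let ?I = "\<integral>s. 1 / (cmod (1 - z * s))\<^sup>2 \<partial>\<mu>"
    \<comment> \<open>Since Re (P t') = -1/2, the left side is an increment of \<open>P\<close> over
      distance s, while 1 - |z|^2 \<ge> s; dividing by s leaves the bound 2 L.\<close>
    have "1 + 2 * Re (psiT \<mu> z) = 2 * (Re (P z) - Re (P t'))"
      using ident[of z] P[rule_format, of t'] t' dzt cz s e by (simp add: dist_commute)
    also have "\<dots> \<le> 2 * cmod (P z - P t')"
      using abs_Re_le_cmod[of "P z - P t'"] by simp
    also have "\<dots> \<le> 2 * (L * s)"
      using L[rule_format, of z t'] dzt t' dz e by (simp add: dist_norm norm_minus_commute)
    finally have "(1 - (cmod z)\<^sup>2) * ?I \<le> 2 * (L * s)" using \<mu>.Re_psiT[OF zdom] by simp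
    moreover have "s * ?I \<le> (1 - (cmod z)\<^sup>2) * ?I"
    proof (rule mult_right_mono)
      have "1 - (cmod z)\<^sup>2 = s + s * (1 - s)" unfolding cz by (simp add: power2_eq_square algebra_simps)
      then show "s \<le> 1 - (cmod z)\<^sup>2" using s by simp
      show "0 \<le> ?I" by (rule integral_nonneg_AE) auto
    qed
    ultimately have "s * ?I \<le> s * (2 * L)" by (simp add: mult_ac)
    then have "?I \<le> 2 * L" using s(1) by (simp only: mult_le_cancel_left_pos)
    then show "\<exists>z\<in>cauchy_dom \<mu>. dist z t' < \<epsilon> \<and> (\<integral>s. 1 / (cmod (1 - z * s))\<^sup>2 \<partial>\<mu>) \<le> 2 * L"
      using zdom dz s by blast
  qed
  then show "kmap u0 \<in> CT \<mu>" by (simp add: t_def)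
qed

end

section \<open>Free moments\<close>

text \<open>Positive exponents suffice for subwords of (x1 x2)^n, and they exclude cancellation when
  powers are merged.\<close>

definition reduced :: "(bool \<times> int) list \<Rightarrow> bool" where
  "reduced w \<longleftrightarrow> (\<forall>p\<in>set w. snd p > 0) \<and> successively (\<lambda>p q. fst p \<noteq> fst q) w"

text \<open>The shape of a reduced word after deleting some powers of the letter other than
  \<open>a\<close>: equal neighbours can occur only for \<open>a\<close>.\<close>

definition separated :: "bool \<Rightarrow> (bool \<times> int) list \<Rightarrow> bool" where
  "separated a w \<longleftrightarrow> (\<forall>p\<in>set w. snd p > 0) \<and> successively (\<lambda>p q. fst p = a \<or> fst q = a) w"

definition letter_sum :: "bool \<Rightarrow> (bool \<times> int) list \<Rightarrow> int" where
  "letter_sum a w = sum_list (map (\<lambda>p. if fst p = a then snd p else 0) w)"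

definition other_moments :: "(bool \<Rightarrow> int \<Rightarrow> complex) \<Rightarrow> bool \<Rightarrow> (bool \<times> int) list \<Rightarrow> complex" where
  "other_moments m a w = prod_list (map (\<lambda>p. if fst p = a then 1 else m (fst p) (snd p)) w)"

lemma reduced_Nil [simp]: "reduced []"
  by (simp add: reduced_def)

lemma reduced_Cons: "reduced (p # w) \<longleftrightarrow> snd p > 0 \<and> reduced w \<and> (w \<noteq> [] \<longrightarrow> fst p \<noteq> fst (hd w))"
  by (auto simp: reduced_def successively_Cons)

lemma separated_Nil [simp]: "separated a []"
  by (simp add: separated_def)

lemma separated_Cons:
  "separated a (p # w) \<longleftrightarrow> snd p > 0 \<and> separated a w \<and> (w \<noteq> [] \<longrightarrow> fst p = a \<or> fst (hd w) = a)"
  by (auto simp: separated_def successively_Cons)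

lemma letter_sum_simps [simp]:
  "letter_sum a [] = 0" "letter_sum a (p # w) = (if fst p = a then snd p else 0) + letter_sum a w"
  by (simp_all add: letter_sum_def)

lemma other_moments_simps [simp]:
  "other_moments m a [] = 1"
  "other_moments m a (p # w) = (if fst p = a then 1 else m (fst p) (snd p)) * other_moments m a w"
  by (simp_all add: other_moments_def)

lemma wnorm_reduced: "reduced w \<Longrightarrow> wnorm w = w"
proof (induction w)
  case (Cons p w)
  then show ?case by (cases p; cases w) (auto simp: reduced_Cons)
qed simp

text \<open>Normalisation merges only powers of \<open>a\<close>. Their positive exponents add up,
  and the remaining letters are untouched.\<close>

lemma wnorm_separated:
  assumes "separated a v"
  shows "reduced (wnorm v) \<and> letter_sum a (wnorm v) = letter_sum a v \<and>
    other_moments m a (wnorm v) = other_moments m a v \<and> length (wnorm v) \<le> length v \<and>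
    (v \<noteq> [] \<longrightarrow> wnorm v \<noteq> [] \<and> fst (hd (wnorm v)) = fst (hd v) \<and> fst (last (wnorm v)) = fst (last v))"
  using assms
proof (induction v)
  case (Cons p w)
  obtain b k where p: "p = (b, k)" by (cases p)
  have k: "k > 0" and w: "separated a w" using Cons.prems p by (auto simp: separated_Cons)
  note IH = Cons.IH[OF w]
  show ?case
  proof (cases "w = []")
    case True
    then show ?thesis using k p by (simp add: reduced_Cons)
  next
    case False
    then obtain q n' where n: "wnorm w = q # n'" using IH by (cases "wnorm w") auto
    obtain c l where q: "q = (c, l)" by (cases q)
    have c: "c = fst (hd w)" using IH n q False by simp
    have l: "l > 0" using IH n q by (simp add: reduced_Cons)
    show ?thesis
    proof (cases "b = c")
      case True
      then have "b = a" using Cons.prems p c False by (auto simp: separated_Cons)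
      then have "wnorm (p # w) = (a, k + l) # n'" "c = a" using True n q p k l by auto
      then show ?thesis using IH n q p k l False \<open>b = a\<close> by (auto simp: reduced_Cons split: if_splits)
    next
      case neq: False
      then have "wnorm (p # w) = p # q # n'" using n q p k by simp
      then show ?thesis using IH n q p k l False neq by (auto simp: reduced_Cons)
    qed
  qed
qed simp

text \<open>Two letters different from \<open>a\<close> in a reduced word have a power of
  \<open>a\<close> between them, and this one is kept.\<close>

lemma nths_separated:
  assumes "reduced w" and "\<And>i. i < length w \<Longrightarrow> fst (w ! i) = a \<Longrightarrow> i \<in> S"
  shows "separated a (nths w S) \<and> letter_sum a (nths w S) = letter_sum a w \<and>
    (w \<noteq> [] \<longrightarrow> fst (hd w) = a \<longrightarrow> nths w S \<noteq> [] \<and> fst (hd (nths w S)) = a) \<and>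
    (w \<noteq> [] \<longrightarrow> fst (last w) = a \<longrightarrow> nths w S \<noteq> [] \<and> fst (last (nths w S)) = a)"
  using assms
proof (induction w arbitrary: S)
  case (Cons p w)
  let ?S = "{j. Suc j \<in> S}"
  have w: "reduced w" "snd p > 0" using Cons.prems(1) by (auto simp: reduced_Cons)
  have S: "i \<in> ?S" if "i < length w" "fst (w ! i) = a" for i
    using Cons.prems(2)[of "Suc i"] that by simp
  note IH = Cons.IH[OF w(1) S]
  have p: "0 \<in> S" if "fst p = a" using Cons.prems(2)[of 0] that by simp
  have hd: "fst p \<noteq> a \<Longrightarrow> w \<noteq> [] \<Longrightarrow> fst (hd w) = a" using Cons.prems(1) by (auto simp: reduced_Cons)
  show ?case
  proof (cases "w = []")
    case True
    then show ?thesis using w p by (auto simp: nths_Cons separated_Cons)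
  next
    case False
    then show ?thesis using IH w p hd by (auto simp: nths_Cons separated_Cons)
  qed
qed simp

lemma prod_list_map_nths:
  "prod_list (map f (nths w S)) = (\<Prod>i\<in>S \<inter> {..<length w}. f (w ! i) :: complex)"
proof (induction w rule: rev_induct)
  case (snoc x w)
  have "(\<Prod>i\<in>S \<inter> {..<length w}. f ((w @ [x]) ! i)) = (\<Prod>i\<in>S \<inter> {..<length w}. f (w ! i))"
    by (rule prod.cong) (auto simp: nth_append)
  then show ?case using snoc by (auto simp: nths_append lessThan_Suc Int_insert_right nth_append)
qed simp

section \<open>The freeness recursion and the leading moment of a word\<close>

lemma fm_Nil [simp]: "fm m n [] = 1"
  by (cases n) simp_all

lemma fm_single: "fm m (Suc n) [p] = m (fst p) (snd p)"
proof -
  have "{S. S \<subset> {..<Suc 0}} = {{}}" by auto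
  then show ?thesis by simp
qed

text \<open>The empty subword contributes the product of the two moments, each one-letter subword
  its negative; the outer sign turns the total into the product.\<close>

lemma fm_pair:
  assumes "fst p \<noteq> fst q" "snd p \<noteq> 0" "snd q \<noteq> 0"
  shows "fm m (Suc (Suc n)) [p, q] = m (fst p) (snd p) * m (fst q) (snd q)"
proof -
  have eq: "{S. S \<subset> {..<length [p, q]}} = {{}, {0}, {Suc 0}}"
    by (auto simp: lessThan_Suc)
  have d: "{..<length [p, q]} = {0, Suc 0}" "{..<length [p, q]} - {0} = {Suc 0}"
    "{..<length [p, q]} - {Suc 0} = {0}"
    by auto
  have [simp]: "wnorm [p] = [p]" "wnorm [q] = [q]" using assms by (cases p; cases q; simp)+
  have "nths [p, q] {} = []" "nths [p, q] {0} = [p]" "nths [p, q] {Suc 0} = [q]"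
    by (simp_all add: nths_Cons)
  moreover have "fm m (Suc (Suc n)) [p, q] = - (\<Sum>S\<in>{{}, {0}, {Suc 0}}.
      (\<Prod>i\<in>{..<length [p, q]} - S. - m (fst ([p, q] ! i)) (snd ([p, q] ! i))) * fm m (Suc n) (wnorm (nths [p, q] S)))"
    by (subst fm.simps(2)) (simp only: eq, simp)
  ultimately show ?thesis
    by (simp add: d fm_single insert_Diff_if del: fm.simps(2) list.size)
qed

text \<open>The letters alternate, so a word with \<open>a\<close> at one end has at least half of
  its letters equal to \<open>a\<close>; reversal swaps the two ends.\<close>

lemma length_reduced_le:
  assumes "reduced w" "w \<noteq> []" "fst (hd w) = a \<or> fst (last w) = a"
  shows "length w \<le> 2 * length (filter (\<lambda>p. fst p = a) w)"
proof -
  have *: "length w \<le> 2 * length (filter (\<lambda>p. fst p = a) w) + (if w \<noteq> [] \<and> fst (hd w) \<noteq> a then 1 else 0)"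
    if "successively (\<lambda>p q. fst p \<noteq> fst q) w" for w :: "(bool \<times> int) list"
    using that
  proof (induction w)
    case (Cons p w)
    then show ?case by (cases "w = []") (auto simp: successively_Cons split: if_splits)
  qed simp
  have s: "successively (\<lambda>p q. fst p \<noteq> fst q) w"
    using assms(1) by (simp add: reduced_def)
  then have "successively (\<lambda>p q. fst q \<noteq> fst p) w"
    by (rule successively_mono) auto
  then have s': "successively (\<lambda>p q. fst p \<noteq> fst q) (rev w)"
    by (simp only: successively_rev)
  show ?thesis
    using assms(2,3) *[OF s] *[OF s'] by (auto simp: hd_rev rev_filter[symmetric] split: if_splits)
qed

lemma letter_sum_ge:
  assumes "\<forall>p\<in>set w. snd p > 0" "p \<in> set w" "fst p = a"
  shows "letter_sum a w \<ge> snd p"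
    and "letter_sum a w \<ge> snd p + int (length (filter (\<lambda>p. fst p = a) w)) - 1"
proof -
  have nn: "letter_sum a w \<ge> int (length (filter (\<lambda>p. fst p = a) w))" if "\<forall>p\<in>set w. snd p > 0" for w
    using that by (induction w) auto
  show *: "letter_sum a w \<ge> snd p + int (length (filter (\<lambda>p. fst p = a) w)) - 1"
    using assms
  proof (induction w)
    case (Cons q w)
    then show ?case using nn[of w] by auto
  qed simp
  have "p \<in> set (filter (\<lambda>p. fst p = a) w)" using assms(2,3) by simp
  then have "length (filter (\<lambda>p. fst p = a) w) > 0" by (rule length_pos_if_in_set)
  then show "letter_sum a w \<ge> snd p" using * by linarith
qed

text \<open>If the moments of \<open>a\<close> of order below \<open>k\<close> vanish, only the subwords containing every power of
  \<open>a\<close> contribute to the recursion, and these have the same total exponent of \<open>a\<close>.\<close>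

lemma fm_first_moment:
  assumes van: "\<And>j. 0 < j \<Longrightarrow> j < k \<Longrightarrow> m a j = 0" and k: "k > 0"
  shows "reduced w \<Longrightarrow> letter_sum a w = k \<Longrightarrow> fst (hd w) = a \<or> fst (last w) = a \<Longrightarrow> length w \<le> n
    \<Longrightarrow> fm m n w = m a k * other_moments m a w"
proof (induction n arbitrary: w)
  case 0
  then show ?case using k by simp
next
  case (Suc n)
  have w0: "w \<noteq> []" using Suc.prems(2) k by auto
  have pos: "\<forall>p\<in>set w. snd p > 0" using Suc.prems(1) by (simp add: reduced_def)
  show ?case
  proof (cases "\<exists>p\<in>set w. fst p = a \<and> snd p = k")
    \<comment> \<open>One power of \<open>a\<close> already exhausts the exponent k, so it is the
      only one, and the word has at most two letters.\<close>
    case True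
    then obtain p where p: "p \<in> set w" "fst p = a" "snd p = k" by blast
    have "length (filter (\<lambda>p. fst p = a) w) \<le> 1"
      using letter_sum_ge(2)[OF pos p(1,2)] p Suc.prems(2) by simp
    then have "length w \<le> 2"
      using length_reduced_le[OF Suc.prems(1) w0 Suc.prems(3)] by linarith
    then consider q where "w = [q]" | q r where "w = [q, r]"
      using w0 by (cases w; cases "tl w"; cases "tl (tl w)") auto
    then show ?thesis
    proof cases
      case 1
      then have "q = p" using p by simp
      then show ?thesis using 1 p fm_single[of m n p] by (simp del: fm.simps(2))
    next
      case (2 q r)
      then have qr: "fst q \<noteq> fst r" "snd q > 0" "snd r > 0" "q = p \<or> r = p"
        using Suc.prems(1) p by (auto simp: reduced_Cons)
      obtain n' where "n = Suc n'" using Suc.prems(4) 2 by (cases n) auto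
      then have "fm m (Suc n) w = m (fst q) (snd q) * m (fst r) (snd r)"
        unfolding 2 using fm_pair[of q r m n'] qr by (simp del: fm.simps(2))
      then show ?thesis using qr p unfolding 2 by (auto simp del: fm.simps(2))
    qed
  next
    case False
    let ?I = "{..<length w}"
    let ?m = "\<lambda>i. m (fst (w ! i)) (snd (w ! i))"
    let ?c = "\<lambda>i. if fst (w ! i) = a then 1 else ?m i"
    have zero: "?m i = 0" if "i < length w" "fst (w ! i) = a" for i
    proof -
      have i: "w ! i \<in> set w" using that by simp
      have "snd (w ! i) \<le> k" using letter_sum_ge(1)[OF pos i that(2)] Suc.prems(2) by simp
      moreover have "snd (w ! i) \<noteq> k" using False i that by blast
      ultimately show ?thesis using van[of "snd (w ! i)"] pos i that(2) by simp
    qed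
    \<comment> \<open>A subset omitting a power of \<open>a\<close> has a vanishing factor on both
      sides. Any other subset keeps the whole exponent k and an end letter \<open>a\<close>, so the
      induction hypothesis applies.\<close>
    have summand: "(\<Prod>i\<in>?I - S. - ?m i) * fm m n (wnorm (nths w S)) = (\<Prod>i\<in>?I - S. - ?m i) * (m a k * (\<Prod>i\<in>S. ?c i))"
      if S: "S \<subset> ?I" for S
    proof (cases "\<forall>i<length w. fst (w ! i) = a \<longrightarrow> i \<in> S")
      case True
      have nth: "separated a (nths w S)" "letter_sum a (nths w S) = k"
        "fst (hd w) = a \<Longrightarrow> nths w S \<noteq> [] \<and> fst (hd (nths w S)) = a"
        "fst (last w) = a \<Longrightarrow> nths w S \<noteq> [] \<and> fst (last (nths w S)) = a"
        using nths_separated[OF Suc.prems(1), of a S] True w0 Suc.prems(2) by auto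
      note wn = wnorm_separated[OF nth(1), of m]
      have "length (nths w S) = card S"
        using S by (subst length_nths) (auto intro!: arg_cong[of _ _ card])
      also have "card S < length w" using psubset_card_mono[OF _ S] by simp
      finally have len: "length (nths w S) < length w" .
      have "fm m n (wnorm (nths w S)) = m a k * other_moments m a (wnorm (nths w S))"
      proof (rule Suc.IH)
        show "fst (hd (wnorm (nths w S))) = a \<or> fst (last (wnorm (nths w S))) = a"
          using Suc.prems(3) nth wn by auto
      qed (use wn nth len Suc.prems(4) in auto)
      also have "other_moments m a (wnorm (nths w S)) = (\<Prod>i\<in>S. ?c i)"
      proof -
        have "S \<inter> ?I = S" using S by auto
        then show ?thesis using wn prod_list_map_nths[of "\<lambda>p. if fst p = a then 1 else m (fst p) (snd p)" w S]
          by (simp add: other_moments_def)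
      qed
      finally show ?thesis by simp
    next
      case False
      then obtain i where "i < length w" "fst (w ! i) = a" "i \<notin> S" by blast
      then have "(\<Prod>i\<in>?I - S. - ?m i) = 0" using zero[of i] by (intro prod_zero) auto
      then show ?thesis by simp
    qed
    have ex: "\<exists>i<length w. fst (w ! i) \<noteq> a"
    proof (rule ccontr)
      assume "\<not> ?thesis"
      then have all: "\<forall>p\<in>set w. fst p = a" by (metis in_set_conv_nth)
      obtain p v where w: "w = p # v" using w0 by (cases w) auto
      have "v = []" using Suc.prems(1) all w by (cases v) (auto simp: reduced_Cons)
      then show False using Suc.prems(2) w all False by auto
    qed
    \<comment> \<open>Summed over all subsets the terms factor, and the factor at a letter other
      than \<open>a\<close> is zero. The proper subsets therefore sum to minus the term of the full
      set.\<close>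
    have "(\<Sum>S\<in>Pow ?I. (\<Prod>i\<in>S. ?c i) * (\<Prod>i\<in>?I - S. - ?m i)) = (\<Prod>i\<in>?I. ?c i + - ?m i)"
      by (rule prod_add[symmetric]) simp
    also have "\<dots> = 0"
      using ex by (intro prod_zero) auto
    finally have total: "(\<Sum>S\<in>Pow ?I. (\<Prod>i\<in>?I - S. - ?m i) * (m a k * (\<Prod>i\<in>S. ?c i))) = 0"
      by (simp add: mult_ac flip: sum_distrib_left)
    have "finite {S. S \<subset> ?I}" by (rule finite_subset[of _ "Pow ?I"]) auto
    moreover have "Pow ?I = insert ?I {S. S \<subset> ?I}" by auto
    ultimately have "(\<Sum>S\<in>Pow ?I. (\<Prod>i\<in>?I - S. - ?m i) * (m a k * (\<Prod>i\<in>S. ?c i)))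
       = m a k * (\<Prod>i\<in>?I. ?c i) + (\<Sum>S\<in>{S. S \<subset> ?I}. (\<Prod>i\<in>?I - S. - ?m i) * (m a k * (\<Prod>i\<in>S. ?c i)))"
      by (simp add: sum.insert)
    also have "(\<Sum>S\<in>{S. S \<subset> ?I}. (\<Prod>i\<in>?I - S. - ?m i) * (m a k * (\<Prod>i\<in>S. ?c i)))
      = (\<Sum>S\<in>{S. S \<subset> ?I}. (\<Prod>i\<in>?I - S. - ?m i) * fm m n (wnorm (nths w S)))"
      by (intro sum.cong refl summand[symmetric]) simp
    also have "\<dots> = - fm m (Suc n) w" using w0 by simp
    finally have "fm m (Suc n) w = m a k * (\<Prod>i\<in>?I. ?c i)" unfolding total by simp
    also have "(\<Prod>i\<in>?I. ?c i) = other_moments m a w"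
      using prod_list_map_nths[of "\<lambda>p. if fst p = a then 1 else m (fst p) (snd p)" w UNIV]
      by (simp add: other_moments_def nths_all)
    finally show ?thesis .
  qed
qed

text \<open>The word starts with one letter and ends with the other, so \<open>a\<close> stands at
  an end in either case; its total exponent is n, and the other letter occurs n times with exponent
  1.\<close>

lemma free_moment_first:
  assumes "n \<ge> 1" and "\<And>j. 0 < j \<Longrightarrow> j < int n \<Longrightarrow> m a j = 0"
  shows "free_moment m (concat (replicate n [(False, 1), (True, 1)])) = m a (int n) * m (\<not> a) 1 ^ n"
proof -
  let ?w = "\<lambda>n. concat (replicate n [(False, 1), (True, 1 :: int)])"
  have red: "reduced (?w n) \<and> (n \<noteq> 0 \<longrightarrow> ?w n \<noteq> [] \<and> fst (hd (?w n)) = False \<and> fst (last (?w n)) = True) \<and>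
      letter_sum a (?w n) = int n \<and> other_moments m a (?w n) = m (\<not> a) 1 ^ n" for n
    by (induction n) (auto simp: reduced_Cons)
  have "fm m (length (?w n)) (?w n) = m a (int n) * other_moments m a (?w n)"
    by (rule fm_first_moment) (use red[of n] assms in auto)
  then show ?thesis
    unfolding free_moment_def using red[of n] by (simp add: wnorm_reduced)
qed

section \<open>Moments as Taylor coefficients, and boundary values of \<eta>\<close>

context circle_measure
begin

lemma cauchy_int_0: "cauchy_int \<nu> n 0 = mom \<nu> (int n)"
  by (simp add: cauchy_int_def mom_def)

lemma cauchy_int_Suc:
  assumes "cmod z < 1"
  shows "cauchy_int \<nu> n z = mom \<nu> (int n) + z * cauchy_int \<nu> (Suc n) z"
proof -
  have dom: "z \<in> cauchy_dom \<nu>" "0 \<in> cauchy_dom \<nu>" using ball_subset_cauchy_dom assms by auto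
  obtain d where d: "d > 0" "AE s in \<nu>. d \<le> cmod (1 - z * s)"
    using dom by (auto simp: cauchy_dom_def)
  have i: "integrable \<nu> (\<lambda>s. s ^ n)" "integrable \<nu> (\<lambda>s. s ^ Suc n / (1 - z * s))"
    using integrable_cauchy[OF dom(2), of n 0] integrable_cauchy[OF dom(1), of "Suc n" 1] by simp_all
  have "cauchy_int \<nu> n z = (\<integral>s. s ^ n + z * (s ^ Suc n / (1 - z * s)) \<partial>\<nu>)"
    unfolding cauchy_int_def
  proof (rule integral_cong_AE)
    show "AE s in \<nu>. s ^ n / (1 - z * s) = s ^ n + z * (s ^ Suc n / (1 - z * s))"
      using d(2)
    proof eventually_elim
      case (elim s)
      then have "1 - z * s \<noteq> 0" using d(1) by auto
      then show ?case by (simp add: field_simps)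
    qed
  qed measurable
  also have "\<dots> = (\<integral>s. s ^ n \<partial>\<nu>) + z * (\<integral>s. s ^ Suc n / (1 - z * s) \<partial>\<nu>)"
    unfolding integral_mult_right_zero[symmetric]
    using i by (intro Bochner_Integration.integral_add integrable_mult_right) auto
  finally show ?thesis by (simp add: cauchy_int_def mom_def)
qed

text \<open>Each vanishing remainder gives a zero moment by evaluation at 0; division by z, through
  the identity theorem, gives the next remainder.\<close>

lemma moments_zero_if_psiT_zero:
  assumes "\<And>z. cmod z < 1 \<Longrightarrow> psiT \<nu> z = 0"
  shows "mom \<nu> (int (Suc n)) = 0"
proof -
  have *: "cauchy_int \<nu> (Suc n) z = 0" if "cmod z < 1" "\<And>z. cmod z < 1 \<Longrightarrow> z * cauchy_int \<nu> (Suc n) z = 0" for n z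
    by (rule holomorphic_mult_eq_0[of "\<lambda>z. z" "ball 0 1" "cauchy_int \<nu> (Suc n)" "1 / 2"])
      (use that in \<open>auto intro!: holomorphic_on_subset[OF holomorphic_cauchy_int ball_subset_cauchy_dom]\<close>)
  have "\<forall>z. cmod z < 1 \<longrightarrow> cauchy_int \<nu> (Suc n) z = 0"
  proof (induction n)
    case 0
    show ?case using * assms psiT_eq(2) ball_subset_cauchy_dom by (metis One_nat_def mem_ball_0 subsetD)
  next
    case (Suc n)
    then have "mom \<nu> (int (Suc n)) = 0" using cauchy_int_0[of "Suc n"] by simp
    then have "z * cauchy_int \<nu> (Suc (Suc n)) z = 0" if "cmod z < 1" for z
      using cauchy_int_Suc[OF that, of "Suc n"] Suc that by simp
    then show ?case using * by blast
  qed
  then show ?thesis using cauchy_int_0[of "Suc n"] by simp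
qed

text \<open>Then \<psi>(z) is z^(n+1) times a remainder bounded by 1 / (1 - |z|) for every
  n.\<close>

lemma psiT_zero_if_moments_zero:
  assumes "\<And>n. mom \<nu> (int (Suc n)) = 0" and z: "cmod z < 1"
  shows "psiT \<nu> z = 0"
proof -
  have dom: "z \<in> cauchy_dom \<nu>" using ball_subset_cauchy_dom z by auto
  have eq: "psiT \<nu> z = z ^ Suc n * cauchy_int \<nu> (Suc n) z" for n
  proof (induction n)
    case 0
    show ?case using psiT_eq(2)[OF dom] by simp
  next
    case (Suc n)
    then show ?case using cauchy_int_Suc[OF z, of "Suc n"] assms(1)[of n] by (simp add: mult_ac)
  qed
  have bd: "cmod (cauchy_int \<nu> n z) \<le> 1 / (1 - cmod z)" for n
    unfolding cauchy_int_def
  proof (rule norm_integral_le_const)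
    show "integrable \<nu> (\<lambda>s. s ^ n / (1 - z * s))" using integrable_cauchy[OF dom, of n 1] by simp
    show "AE s in \<nu>. cmod (s ^ n / (1 - z * s)) \<le> 1 / (1 - cmod z)"
      using AE_unit
    proof eventually_elim
      case (elim s)
      have "1 - cmod z \<le> cmod (1 - z * s)" using norm_triangle_ineq2[of 1 "z * s"] elim by (simp add: norm_mult)
      then show ?case using elim z by (simp add: norm_divide norm_power frac_le)
    qed
  qed
  have "(\<lambda>n. z ^ Suc n * cauchy_int \<nu> (Suc n) z) \<longlonglongrightarrow> 0"
  proof (rule Lim_null_comparison)
    show "\<forall>\<^sub>F n in sequentially. norm (z ^ Suc n * cauchy_int \<nu> (Suc n) z) \<le> cmod z ^ Suc n * (1 / (1 - cmod z))"
      unfolding norm_mult norm_power by (intro always_eventually allI mult_left_mono bd) auto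
    have "(\<lambda>n. cmod z ^ Suc n) \<longlonglongrightarrow> 0" using z by (intro LIMSEQ_Suc LIMSEQ_power_zero) auto
    then show "(\<lambda>n. cmod z ^ Suc n * (1 / (1 - cmod z))) \<longlonglongrightarrow> 0" by (rule tendsto_mult_left_zero)
  qed
  then show ?thesis unfolding eq[symmetric] by (simp add: LIMSEQ_const_iff)
qed

lemma one_plus_psiT_circle_nonzero:
  assumes "t \<in> CT \<nu>"
  shows "psiT \<nu> t \<noteq> 0" "1 + psiT \<nu> t \<noteq> 0"
  using Re_psiT_circle[OF assms] by (auto simp: complex_eq_iff)

lemma isCont_psiT: "t \<in> CT \<nu> \<Longrightarrow> isCont (psiT \<nu>) t"
  using continuous_on_psiT by (auto simp: CT_eq continuous_on_eq_continuous_at open_cauchy_dom)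

lemma isCont_etaT: "t \<in> CT \<nu> \<Longrightarrow> isCont (etaT \<nu>) t"
  unfolding etaT_def using one_plus_psiT_circle_nonzero by (intro continuous_intros isCont_psiT) auto

lemma norm_etaT_circle:
  assumes "t \<in> CT \<nu>"
  shows "cmod (etaT \<nu> t) = 1"
proof -
  have "(cmod (psiT \<nu> t))\<^sup>2 = (cmod (1 + psiT \<nu> t))\<^sup>2"
    unfolding cmod_power2 using Re_psiT_circle[OF assms] by (simp add: power2_eq_square)
  then have "cmod (psiT \<nu> t) = cmod (1 + psiT \<nu> t)" by simp
  then show ?thesis using one_plus_psiT_circle_nonzero[OF assms] by (simp add: etaT_def norm_divide)
qed

text \<open>Otherwise \<psi> vanishes on the disc and, by continuity, at t, where its real part is
  -1/2.\<close>

lemma nonzero_moment_if_CT: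
  assumes "t \<in> CT \<nu>"
  shows "\<exists>n. mom \<nu> (int (Suc n)) \<noteq> 0"
proof (rule ccontr)
  assume "\<not> ?thesis"
  then have z: "psiT \<nu> z = 0" if "cmod z < 1" for z using psiT_zero_if_moments_zero that by blast
  define r where "r = (\<lambda>n. 1 - 1 / (real n + 2))"
  note rad = radial_tendsto[OF r_def, of t]
  have "(\<lambda>n. psiT \<nu> (of_real (r n) * t)) \<longlonglongrightarrow> psiT \<nu> t"
    by (rule isCont_tendsto_compose[OF isCont_psiT[OF assms] rad(1)])
  moreover have "psiT \<nu> (of_real (r n) * t) = 0" for n
    using z rad(2) assms by (simp add: CT_eq)
  ultimately have "psiT \<nu> t = 0" by (simp add: LIMSEQ_const_iff)
  then show False using one_plus_psiT_circle_nonzero[OF assms] by simp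
qed

end

text \<open>The letter \<open>a\<close> stands for the second measure if true. If its first
  nonvanishing moment has order n + 1, that moment of \<mu> is this moment times the (n + 1)-st
  power of the other mean.\<close>

lemma free_mult_conv_first_moment:
  assumes conv: "free_mult_conv \<mu>1 \<mu>2 \<mu>"
    and mean: "mom (if a then \<mu>1 else \<mu>2) 1 \<noteq> 0" and ex: "\<exists>n. mom (if a then \<mu>2 else \<mu>1) (int (Suc n)) \<noteq> 0"
  shows "\<exists>n. mom \<mu> (int (Suc n)) \<noteq> 0"
proof -
  define m where "m = (\<lambda>b k. if b then mom \<mu>2 k else mom \<mu>1 k)"
  define n where "n = (LEAST n. m a (int (Suc n)) \<noteq> 0)"
  have ex': "\<exists>n. m a (int (Suc n)) \<noteq> 0" using ex unfolding m_def by (cases a) simp_all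
  have n: "m a (int (Suc n)) \<noteq> 0" unfolding n_def by (rule LeastI_ex[OF ex'])
  have "m a j = 0" if j: "0 < j" "j < int (Suc n)" for j
  proof -
    define i where "i = nat j - 1"
    have "j = int (Suc i)" "i < n" using j by (auto simp: i_def)
    then show ?thesis using not_less_Least[of i "\<lambda>n. m a (int (Suc n)) \<noteq> 0"] by (auto simp: n_def)
  qed
  then have "free_moment m (concat (replicate (Suc n) [(False, 1), (True, 1)])) = m a (int (Suc n)) * m (\<not> a) 1 ^ Suc n"
    by (intro free_moment_first) auto
  moreover have "mom \<mu> (int (Suc n)) = free_moment m (concat (replicate (Suc n) [(False, 1), (True, 1)]))"
    using conv unfolding free_mult_conv_def m_def[symmetric] by (metis le_add1 plus_1_eq_Suc)
  ultimately have "mom \<mu> (int (Suc n)) = m a (int (Suc n)) * m (\<not> a) 1 ^ Suc n"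
    by metis
  moreover have "m (\<not> a) 1 \<noteq> 0" using mean by (simp add: m_def split: if_splits)
  ultimately have "mom \<mu> (int (Suc n)) \<noteq> 0" using n by simp
  then show ?thesis by blast
qed

section \<open>The homeomorphism\<close>

theorem theorem6p3:
  fixes \<mu>1 \<mu>2 \<mu> :: "complex measure" and \<omega>1 \<omega>2 :: "complex \<Rightarrow> complex"
  assumes "prob_on_T \<mu>1" and "prob_on_T \<mu>2"
    and "\<not> is_point_mass \<mu>1" and "\<not> is_point_mass \<mu>2"
    and "free_mult_conv \<mu>1 \<mu>2 \<mu>"
    and "continuous_on (cball 0 1) \<omega>1" and "continuous_on (cball 0 1) \<omega>2"
    and "\<omega>1 ` cball 0 1 \<subseteq> cball 0 1" and "\<omega>2 ` cball 0 1 \<subseteq> cball 0 1"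
    and "\<omega>1 holomorphic_on ball 0 1" and "\<omega>2 holomorphic_on ball 0 1"
    and "\<omega>1 0 = 0" and "\<omega>2 0 = 0"
    and "\<forall>z\<in>ball 0 1. etaT \<mu> z = etaT \<mu>1 (\<omega>1 z) \<and> etaT \<mu> z = etaT \<mu>2 (\<omega>2 z)
                       \<and> etaT \<mu> z = \<omega>1 z * \<omega>2 z / z"
  shows "homeomorphism (CT \<mu>) (DT \<mu>1 \<mu>2) (\<lambda>t. (\<omega>1 t, \<omega>2 t))
           (\<lambda>(t1, t2). t1 * t2 / etaT \<mu>1 t1)
       \<and> (\<forall>(t1, t2)\<in>DT \<mu>1 \<mu>2. t1 * t2 / etaT \<mu>1 t1 = t1 * t2 / etaT \<mu>2 t2)"
proof -
  interpret \<mu>1: circle_measure \<mu>1 by unfold_locales (fact assms)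
  interpret \<mu>2: circle_measure \<mu>2 by unfold_locales (fact assms)
  interpret \<mu>: circle_measure \<mu> using assms(5) by unfold_locales (simp add: free_mult_conv_def)
  note cm = \<mu>1.circle_measure_axioms \<mu>2.circle_measure_axioms \<mu>.circle_measure_axioms
  have le1: "cmod (\<omega>1 z) \<le> 1" "cmod (\<omega>2 z) \<le> 1" if "cmod z \<le> 1" for z
    using assms(8,9) that by (auto simp: image_subset_iff)
  have lt: "cmod (\<omega>1 z) < 1" "cmod (\<omega>2 z) < 1" if "cmod z < 1" for z
    using le_less_trans[OF Schwarz_Lemma_cball[OF assms(10,12) _ that] that]
      le_less_trans[OF Schwarz_Lemma_cball[OF assms(11,13) _ that] that] le1 by auto
  have eta: "etaT \<mu> z = etaT \<mu>1 (\<omega>1 z)" "etaT \<mu> z = etaT \<mu>2 (\<omega>2 z)" "etaT \<mu> z = \<omega>1 z * \<omega>2 z / z"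
    if "cmod z < 1" for z
    using bspec[OF assms(14), of z] that by (metis mem_ball_0)+
  \<comment> \<open>\<eta> is an injective Moebius function of \<psi>, so the subordination relation
    for \<eta> can be restated for \<psi>.\<close>
  have inj: "x = y" if "x / (1 + x) = y / (1 + y)" "1 + x \<noteq> 0" "1 + y \<noteq> 0" for x y :: complex
    using that by (simp add: divide_simps) (simp add: algebra_simps)
  have sub: "psiT \<mu>1 (\<omega>1 z) = psiT \<mu> z" "psiT \<mu>2 (\<omega>2 z) = psiT \<mu> z" if "cmod z < 1" for z
    using eta(1,2)[OF that] \<mu>.one_plus_psiT_nonzero[OF that]
      \<mu>1.one_plus_psiT_nonzero[OF lt(1)[OF that]] \<mu>2.one_plus_psiT_nonzero[OF lt(2)[OF that]]
    unfolding etaT_def by (auto intro: inj)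
  have prod: "\<omega>1 t * \<omega>2 t = t * etaT \<mu> t" if t: "t \<in> CT \<mu>" for t
  proof (rule LIMSEQ_unique)
    define r where "r = (\<lambda>n. 1 - 1 / (real n + 2))"
    have t1: "cmod t \<le> 1" using t by (simp add: \<mu>.CT_eq)
    note rad = radial_tendsto[OF r_def, of t]
    have "(\<lambda>n. \<omega>1 (of_real (r n) * t)) \<longlonglongrightarrow> \<omega>1 t" "(\<lambda>n. \<omega>2 (of_real (r n) * t)) \<longlonglongrightarrow> \<omega>2 t"
      using rad t1 by (auto intro!: continuous_on_tendsto_compose[OF assms(6)] continuous_on_tendsto_compose[OF assms(7)] always_eventually less_imp_le)
    then show "(\<lambda>n. \<omega>1 (of_real (r n) * t) * \<omega>2 (of_real (r n) * t)) \<longlonglongrightarrow> \<omega>1 t * \<omega>2 t"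
      by (rule tendsto_mult)
    have "(\<lambda>n. of_real (r n) * t * etaT \<mu> (of_real (r n) * t)) \<longlonglongrightarrow> t * etaT \<mu> t"
      by (intro tendsto_mult rad isCont_tendsto_compose[OF \<mu>.isCont_etaT[OF t] rad(1)])
    moreover have "of_real (r n) * t * etaT \<mu> (of_real (r n) * t) = \<omega>1 (of_real (r n) * t) * \<omega>2 (of_real (r n) * t)" for n
    proof -
      have "r n > 0" by (simp add: r_def field_simps)
      then have "of_real (r n) * t \<noteq> 0" using t by (auto simp: \<mu>.CT_eq)
      then show ?thesis using eta(3)[OF rad(2)[OF t1]] by (simp del: mult_eq_0_iff)
    qed
    ultimately show "(\<lambda>n. \<omega>1 (of_real (r n) * t) * \<omega>2 (of_real (r n) * t)) \<longlonglongrightarrow> t * etaT \<mu> t" by simp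
  qed
  \<comment> \<open>\<eta> is unimodular on the gaps, so two factors of modulus at most 1 have a
    product of modulus 1.\<close>
  have unit: "cmod (\<omega>1 t) = 1" "cmod (\<omega>2 t) = 1" if t: "t \<in> CT \<mu>" for t
  proof -
    have t1: "cmod t = 1" using t by (simp add: \<mu>.CT_eq)
    have "cmod (\<omega>1 t) * cmod (\<omega>2 t) = 1"
      using arg_cong[OF prod[OF t], of cmod] \<mu>.norm_etaT_circle[OF t] t1 by (simp add: norm_mult)
    moreover have "cmod (\<omega>1 t) * cmod (\<omega>2 t) \<le> cmod (\<omega>1 t)" "cmod (\<omega>1 t) * cmod (\<omega>2 t) \<le> cmod (\<omega>2 t)"
      using le1[of t] t1 by (auto intro: mult_left_le mult_left_le_one_le)
    ultimately show "cmod (\<omega>1 t) = 1" "cmod (\<omega>2 t) = 1" using le1[of t] t1 by linarith+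
  qed
  have fwd: "(\<omega>1 t, \<omega>2 t) \<in> DT \<mu>1 \<mu>2" "\<omega>1 t * \<omega>2 t / etaT \<mu>1 (\<omega>1 t) = t" if t: "t \<in> CT \<mu>" for t
  proof -
    note c1 = subordination_CT[OF cm(3,1) assms(6,10,12) le1(1) sub(1) t unit(1)]
    note c2 = subordination_CT[OF cm(3,2) assms(7,11,13) le1(2) sub(2) t unit(2)]
    have "VT \<mu>1 (\<omega>1 t) * VT \<mu>2 (\<omega>2 t) < (cmod (psiT \<mu> t * (psiT \<mu> t + 1)))\<^sup>2"
      by (rule subordination_variance_less[OF cm t c1(1) c2(1) c1(2) c2(2) assms(6,7) sub eta(3)])
    moreover have "(cmod (psiT \<mu> t * (psiT \<mu> t + 1)))\<^sup>2 > 0"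
      using \<mu>.one_plus_psiT_circle_nonzero[OF t] by (simp add: add.commute)
    ultimately show "(\<omega>1 t, \<omega>2 t) \<in> DT \<mu>1 \<mu>2"
      using c1 c2 by (simp add: DT_def del: norm_mult)
    have "etaT \<mu>1 (\<omega>1 t) = etaT \<mu> t" using c1(2) by (simp add: etaT_def)
    then show "\<omega>1 t * \<omega>2 t / etaT \<mu>1 (\<omega>1 t) = t"
      using prod[OF t] \<mu>.norm_etaT_circle[OF t] by auto
  qed
  have bwd: "t1 * t2 / etaT \<mu>1 t1 \<in> CT \<mu> \<and> \<omega>1 (t1 * t2 / etaT \<mu>1 t1) = t1 \<and> \<omega>2 (t1 * t2 / etaT \<mu>1 t1) = t2"
    if D: "(t1, t2) \<in> DT \<mu>1 \<mu>2" for t1 t2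
  proof -
    have D': "t1 \<in> CT \<mu>1" "t2 \<in> CT \<mu>2" "psiT \<mu>1 t1 = psiT \<mu>2 t2"
      "VT \<mu>1 t1 * VT \<mu>2 t2 / (cmod (psiT \<mu>1 t1 * (psiT \<mu>1 t1 + 1)))\<^sup>2 < 1"
      using D by (auto simp: DT_def)
    obtain f1 \<delta>1 \<eta>1 f2 \<delta>2 \<eta>2 where "psiT_inverse_pair \<mu>1 t1 f1 \<delta>1 \<eta>1 \<mu>2 t2 f2 \<delta>2 \<eta>2"
      using psiT_inverse_pair_exists[OF cm(1,2) D'(1-3)] by blast
    then interpret P: psiT_inverse_pair \<mu>1 t1 f1 \<delta>1 \<eta>1 \<mu>2 t2 f2 \<delta>2 \<eta>2 .
    have small: "P.V1 * P.V2 < P.M\<^sup>2"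
      using D'(4) P.M_pos unfolding P.V1_def P.V2_def P.M_eq P.u0_def by (simp add: divide_less_eq_1 del: norm_mult)
    have "mom \<mu>1 1 \<noteq> 0 \<or> mom \<mu>2 1 \<noteq> 0"
      using P.not_both_mean_zero[OF small] by (simp add: \<mu>1.hT_0 \<mu>2.hT_0)
    \<comment> \<open>One factor has nonzero mean and the other some nonzero moment, so \<mu> has a
      nonzero moment. Hence neither subordination function vanishes identically.\<close>
    then have "\<exists>n. mom \<mu> (int (Suc n)) \<noteq> 0"
      using free_mult_conv_first_moment[OF assms(5), of True] free_mult_conv_first_moment[OF assms(5), of False]
        \<mu>1.nonzero_moment_if_CT[OF D'(1)] \<mu>2.nonzero_moment_if_CT[OF D'(2)] by auto
    then obtain z0 where z0: "cmod z0 < 1" "psiT \<mu> z0 \<noteq> 0"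
      using \<mu>.moments_zero_if_psiT_zero by blast
    then have "\<omega>1 z0 * \<omega>2 z0 \<noteq> 0"
      using eta(3)[OF z0(1)] \<mu>.one_plus_psiT_nonzero[OF z0(1)] by (auto simp: etaT_def)
    then have nz: "\<omega>1 z0 \<noteq> 0" "\<omega>2 z0 \<noteq> 0" by auto
    have hol: "(\<lambda>z. hT \<mu>1 (\<omega>1 z)) holomorphic_on ball 0 1" "(\<lambda>z. hT \<mu>2 (\<omega>2 z)) holomorphic_on ball 0 1"
      using holomorphic_on_compose_gen[OF assms(10) \<mu>1.holomorphic_hT] holomorphic_on_compose_gen[OF assms(11) \<mu>2.holomorphic_hT] lt
      by (auto simp: comp_def image_subset_iff)
    \<comment> \<open>The fixed point equations multiplied by \<omega>1 z and \<omega>2 z; since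
      these do not vanish identically, the identity theorem cancels them below.\<close>
    have e: "\<omega>1 z * \<omega>2 z = z * (\<omega>1 z * hT \<mu>1 (\<omega>1 z))" "\<omega>1 z * \<omega>2 z = z * (\<omega>2 z * hT \<mu>2 (\<omega>2 z))"
      if "cmod z < 1" for z
    proof -
      have "\<omega>1 z * \<omega>2 z = z * etaT \<mu> z" using eta(3)[OF that] assms(12) by (cases "z = 0") auto
      then show "\<omega>1 z * \<omega>2 z = z * (\<omega>1 z * hT \<mu>1 (\<omega>1 z))" "\<omega>1 z * \<omega>2 z = z * (\<omega>2 z * hT \<mu>2 (\<omega>2 z))"
        using eta(1,2)[OF that] \<mu>1.etaT_eq_hT[OF lt(1)[OF that]] \<mu>2.etaT_eq_hT[OF lt(2)[OF that]] by simp_all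
    qed
    have sol1: "\<omega>2 z = z * hT \<mu>1 (\<omega>1 z)" if "cmod z < 1" for z
    proof -
      have "\<omega>2 z - z * hT \<mu>1 (\<omega>1 z) = 0"
      proof (rule holomorphic_mult_eq_0[where f = \<omega>1 and S = "ball 0 1" and a = z0 and z = z and g = "\<lambda>z. \<omega>2 z - z * hT \<mu>1 (\<omega>1 z)"])
        show "(\<lambda>z. \<omega>2 z - z * hT \<mu>1 (\<omega>1 z)) holomorphic_on ball 0 1"
          by (intro holomorphic_intros assms hol)
        show "\<omega>1 w * (\<omega>2 w - w * hT \<mu>1 (\<omega>1 w)) = 0" if "w \<in> ball 0 1" for w
          using e(1)[of w] that by (simp add: algebra_simps)
      qed (use assms(10) z0 nz that in auto)
      then show ?thesis by simp
    qed
    have sol2: "\<omega>1 z = z * hT \<mu>2 (\<omega>2 z)" if "cmod z < 1" for z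
    proof -
      have "\<omega>1 z - z * hT \<mu>2 (\<omega>2 z) = 0"
      proof (rule holomorphic_mult_eq_0[where f = \<omega>2 and S = "ball 0 1" and a = z0 and z = z and g = "\<lambda>z. \<omega>1 z - z * hT \<mu>2 (\<omega>2 z)"])
        show "(\<lambda>z. \<omega>1 z - z * hT \<mu>2 (\<omega>2 z)) holomorphic_on ball 0 1"
          by (intro holomorphic_intros assms hol)
        show "\<omega>2 w * (\<omega>1 w - w * hT \<mu>2 (\<omega>2 w)) = 0" if "w \<in> ball 0 1" for w
          using e(2)[of w] that by (simp add: algebra_simps)
      qed (use assms(11) z0 nz that in auto)
      then show ?thesis by simp
    qed
    \<comment> \<open>The local inverses take the values \<open>t1\<close> and \<open>t2\<close> at
      \<open>P.u0\<close>, so the proposed inverse is the value of \<open>kmap\<close>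
      there.\<close>
    have "t1 * t2 / etaT \<mu>1 t1 = P.kmap P.u0"
      by (simp add: P.kmap_def etaT_def P.psiT_u0)
    then show ?thesis
      using P.subordination_onto[OF cm(3) small assms(6,7) lt sub(1) sol1 sol2] by simp
  qed
  have "homeomorphism (CT \<mu>) (DT \<mu>1 \<mu>2) (\<lambda>t. (\<omega>1 t, \<omega>2 t)) (\<lambda>(t1, t2). t1 * t2 / etaT \<mu>1 t1)"
  proof (rule homeomorphismI)
    have "CT \<mu> \<subseteq> cball 0 1" by (auto simp: \<mu>.CT_eq)
    then show "continuous_on (CT \<mu>) (\<lambda>t. (\<omega>1 t, \<omega>2 t))"
      using assms(6,7) by (auto intro!: continuous_on_Pair elim: continuous_on_subset)
    have "continuous_on (CT \<mu>1) (etaT \<mu>1)"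
      using \<mu>1.isCont_etaT by (simp add: continuous_at_imp_continuous_on)
    then have "continuous_on (DT \<mu>1 \<mu>2) (\<lambda>p. etaT \<mu>1 (fst p))"
      by (rule continuous_on_compose2) (auto simp: DT_def intro!: continuous_intros)
    moreover have "etaT \<mu>1 (fst p) \<noteq> 0" if "p \<in> DT \<mu>1 \<mu>2" for p
      using \<mu>1.norm_etaT_circle[of "fst p"] that by (auto simp: DT_def)
    ultimately show "continuous_on (DT \<mu>1 \<mu>2) (\<lambda>(t1, t2). t1 * t2 / etaT \<mu>1 t1)"
      unfolding case_prod_unfold by (intro continuous_intros) auto
  qed (use fwd bwd in auto)
  moreover have "\<forall>(t1, t2)\<in>DT \<mu>1 \<mu>2. t1 * t2 / etaT \<mu>1 t1 = t1 * t2 / etaT \<mu>2 t2"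
    by (auto simp: DT_def etaT_def)
  ultimately show ?thesis by blast
qed

end
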